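(* Let $d\in\mathbb{N}$ and let $\{B(t)\}_{t\ge 0}$ be a standard Brownian motion in $\mathbb{R}^d$ adapted to a filtration $\{\mathcal{F}_t\}_{t\ge0}$. Let $\Phi(x)=\frac{1}{\sqrt{2\pi}}\int_{-\infty}^x e^{-s^2/2}\,ds$ be the standard Gaussian cumulative distribution function, and define $\xi:[-1,1]\to[0,\infty)$ by $$\xi(s)=\sqrt{\tfrac{2}{\pi}}\;\exp\!\Big(-\tfrac12\,\Phi^{-1}\big(\tfrac{1-s}{2}\big)^2\Big)$$ (with $\xi(\pm1)=0$). For every $u\in\mathbb{R}^d$ let $\{W_u(t)\}_{t\ge0}$ be the solution of the stochastic differential equation $$W_u(0)=0,\qquad dW_u(t)=\xi\big(W_u(t)\big)\,\langle u,dB(t)\rangle,$$ all driven by the same Brownian motion $B$, and let $\sigma_u=\lim_{t\to\infty}W_u(t)$ (which exists and lies in $\{-1,1\}$ almost surely). Then for all unit vectors $u,v\in\mathbb{S}^{d-1}=\{x\in\mathbb{R}^d:\langle x,x\rangle=1\}$, $$\mathbb{E}\big[\sigma_u\sigma_v\big]=\frac{2}{\pi}\arcsin\big(\langle u,v\rangle\big).$$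
   Context: $\langle\cdot,\cdot\rangle$ is the standard scalar product on $\mathbb{R}^d$. The processes $W_u$ form the "slowed-down sticky Brownian motion" with speed function $\xi$; the crucial point is that a single Brownian motion $B$ drives the one-dimensional SDEs for all $u$ simultaneously, so the signs $\sigma_u$ are correlated across $u$.
   Formalization: The parenthetical claim that σ_u exists and lies in {-1,1} almost surely is stated and proved for u ≠ 0 only, since for u = 0 the solution is W_0 ≡ 0 and σ_0 = 0; the formula for unit vectors is unchanged. *)

theory Defs
  imports "HOL-Probability.Probability"
begin

text \<open>
  Processes and filtrations are indexed by \<open>real\<close>; only times \<open>t \<ge> 0\<close> are ever constrained.
\<close>

locale filtered_prob_space = prob_space M for M :: "'a measure" +
  fixes F :: "real \<Rightarrow> 'a measure"
  assumes subalgebra_F: "0 \<le> t \<Longrightarrow> subalgebra M (F t)"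
    and F_mono: "0 \<le> s \<Longrightarrow> s \<le> t \<Longrightarrow> sets (F s) \<subseteq> sets (F t)"

text \<open>
  A standard Brownian motion relative to the filtration: besides being adapted, its increments
  after time \<open>s\<close> are independent of \<open>F s\<close>. The density below is that of the centred Gaussian law
  with covariance \<open>t - s\<close> times the identity.
\<close>

locale brownian_motion = filtered_prob_space M F
  for M :: "'a measure" and F :: "real \<Rightarrow> 'a measure" +
  fixes B :: "real \<Rightarrow> 'a \<Rightarrow> real ^ 'd"
  assumes B_adapted: "0 \<le> t \<Longrightarrow> B t \<in> borel_measurable (F t)"
    and B_start: "AE \<omega> in M. B 0 \<omega> = 0"
    and B_continuous: "AE \<omega> in M. continuous_on {0..} (\<lambda>t. B t \<omega>)"
    and B_increment_indep: "0 \<le> s \<Longrightarrow> s \<le> t \<Longrightarrow>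
      indep_set (sets (F s)) (sets (vimage_algebra (space M) (\<lambda>\<omega>. B t \<omega> - B s \<omega>) borel))"
    and B_increment_distr: "0 \<le> s \<Longrightarrow> s < t \<Longrightarrow>
      distributed M lborel (\<lambda>\<omega>. B t \<omega> - B s \<omega>)
        (\<lambda>x. ennreal (\<Prod>i\<in>UNIV. normal_density 0 (sqrt (t - s)) (x $ i)))"

text \<open>
  A simple integrand on \<open>[0, t]\<close> is given by a partition \<open>0 = \<tau> 0 \<le> \<dots> \<le> \<tau> n = t\<close> and bounded
  vectors \<open>\<eta> k\<close>, known at time \<open>\<tau> k\<close>; the process equals \<open>\<eta> k\<close> on the interval from \<open>\<tau> k\<close>
  (exclusive) to \<open>\<tau> (Suc k)\<close> (inclusive).
\<close>

definition simple_integrand ::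
  "(real \<Rightarrow> 'a measure) \<Rightarrow> real \<Rightarrow> nat \<Rightarrow> (nat \<Rightarrow> real) \<Rightarrow> (nat \<Rightarrow> 'a \<Rightarrow> real ^ 'd) \<Rightarrow> bool" where
  "simple_integrand F t n \<tau> \<eta> \<longleftrightarrow>
     \<tau> 0 = 0 \<and> \<tau> n = t \<and>
     (\<forall>k<n. \<tau> k \<le> \<tau> (Suc k) \<and> \<eta> k \<in> borel_measurable (F (\<tau> k)) \<and>
        (\<exists>C. \<forall>\<omega>\<in>space (F (\<tau> k)). norm (\<eta> k \<omega>) \<le> C))"

definition simple_process ::
  "nat \<Rightarrow> (nat \<Rightarrow> real) \<Rightarrow> (nat \<Rightarrow> 'a \<Rightarrow> real ^ 'd) \<Rightarrow> real \<Rightarrow> 'a \<Rightarrow> real ^ 'd" where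
  "simple_process n \<tau> \<eta> s \<omega> = (\<Sum>k<n. indicator {\<tau> k<..\<tau> (Suc k)} s *\<^sub>R \<eta> k \<omega>)"

definition simple_ito_integral ::
  "(real \<Rightarrow> 'a \<Rightarrow> real ^ 'd) \<Rightarrow> nat \<Rightarrow> (nat \<Rightarrow> real) \<Rightarrow> (nat \<Rightarrow> 'a \<Rightarrow> real ^ 'd) \<Rightarrow> 'a \<Rightarrow> real" where
  "simple_ito_integral B n \<tau> \<eta> \<omega> = (\<Sum>k<n. \<eta> k \<omega> \<bullet> (B (\<tau> (Suc k)) \<omega> - B (\<tau> k) \<omega>))"

definition ito_integrand ::
  "'a measure \<Rightarrow> (real \<Rightarrow> 'a measure) \<Rightarrow> real \<Rightarrow> (real \<Rightarrow> 'a \<Rightarrow> real ^ 'd) \<Rightarrow> bool" where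
  "ito_integrand M F t H \<longleftrightarrow>
     (\<forall>s\<in>{0..t}. H s \<in> borel_measurable (F s)) \<and>
     (\<lambda>(s, \<omega>). H s \<omega>) \<in> borel_measurable (restrict_space borel {0..t} \<Otimes>\<^sub>M M) \<and>
     (\<integral>\<^sup>+\<omega>. (\<integral>\<^sup>+s\<in>{0..t}. ennreal ((norm (H s \<omega>))\<^sup>2) \<partial>lborel) \<partial>M) < \<infinity>"

text \<open>
  The It\^o integral of \<open>\<langle>H(s), dB(s)\<rangle>\<close> over \<open>[0, t]\<close>, as the mean-square limit of the
  integrals of simple integrands approximating \<open>H\<close>. The limit \<open>I\<close> is determined only up to
  almost sure equality, hence a relation rather than a function.
\<close>

definition has_ito_integral ::
  "'a measure \<Rightarrow> (real \<Rightarrow> 'a measure) \<Rightarrow> (real \<Rightarrow> 'a \<Rightarrow> real ^ 'd) \<Rightarrow>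
   (real \<Rightarrow> 'a \<Rightarrow> real ^ 'd) \<Rightarrow> real \<Rightarrow> ('a \<Rightarrow> real) \<Rightarrow> bool" where
  "has_ito_integral M F B H t I \<longleftrightarrow>
     ito_integrand M F t H \<and> I \<in> borel_measurable M \<and>
     (\<exists>n \<tau> \<eta>. (\<forall>m::nat. simple_integrand F t (n m) (\<tau> m) (\<eta> m)) \<and>
        (\<lambda>m. \<integral>\<^sup>+\<omega>. (\<integral>\<^sup>+s\<in>{0..t}.
            ennreal ((norm (H s \<omega> - simple_process (n m) (\<tau> m) (\<eta> m) s \<omega>))\<^sup>2) \<partial>lborel) \<partial>M)
          \<longlonglongrightarrow> 0 \<and>
        (\<lambda>m. \<integral>\<^sup>+\<omega>. ennreal ((I \<omega> - simple_ito_integral B (n m) (\<tau> m) (\<eta> m) \<omega>)\<^sup>2) \<partial>M)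
          \<longlonglongrightarrow> 0)"

text \<open>
  \<open>X\<close> solves \<open>dX(t) = a(X(t)) \<langle>u, dB(t)\<rangle>\<close>, \<open>X(0) = x\<close>, where the coefficient \<open>a\<close> is a function on
  the state space \<open>D\<close>, so that \<open>X\<close> has to be \<open>D\<close>-valued.
\<close>

definition sde_solution ::
  "'a measure \<Rightarrow> (real \<Rightarrow> 'a measure) \<Rightarrow> (real \<Rightarrow> 'a \<Rightarrow> real ^ 'd) \<Rightarrow>
   real set \<Rightarrow> (real \<Rightarrow> real) \<Rightarrow> real ^ 'd \<Rightarrow> real \<Rightarrow> (real \<Rightarrow> 'a \<Rightarrow> real) \<Rightarrow> bool" where
  "sde_solution M F B D a u x X \<longleftrightarrow>
     (\<forall>t\<ge>0. X t \<in> borel_measurable (F t)) \<and>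
     (AE \<omega> in M. continuous_on {0..} (\<lambda>t. X t \<omega>)) \<and>
     (AE \<omega> in M. \<forall>t\<ge>0. X t \<omega> \<in> D) \<and>
     (AE \<omega> in M. X 0 \<omega> = x) \<and>
     (\<forall>t\<ge>0. has_ito_integral M F B (\<lambda>s \<omega>. a (X s \<omega>) *\<^sub>R u) t (\<lambda>\<omega>. X t \<omega> - X 0 \<omega>))"

definition Phi :: "real \<Rightarrow> real" where
  "Phi x = 1 / sqrt (2 * pi) * (LINT s:{..x}|lborel. exp (- s\<^sup>2 / 2))"

text \<open>
  For \<open>\<bar>s\<bar> < 1\<close> the argument of \<open>inv Phi\<close> lies in the open unit interval, the range of \<open>Phi\<close>.
  Only the values on \<open>[-1, 1]\<close> matter.
\<close>

definition \<xi> :: "real \<Rightarrow> real" where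
  "\<xi> s = (if \<bar>s\<bar> < 1 then sqrt (2 / pi) * exp (- (1 / 2) * (inv Phi ((1 - s) / 2))\<^sup>2) else 0)"

end

theory Submission
  imports Defs
begin

text \<open>
  On the interval write \<open>W\<^sub>u = 1 - 2 \<Phi>(Y\<^sub>u)\<close>. In the coordinate \<open>Y\<close> the derivatives \<open>\<phi>\<^sup>(\<^sup>n\<^sup>)\<close> of the Gaussian
  density are eigenfunctions of the generator of \<open>W\<^sub>u\<close>, with eigenvalue \<open>-(n + 1) / 2\<close>. For unit vectors with
  \<open>\<rho> = \<langle>u, v\<rangle>\<close> the correlations \<open>A\<^sub>n = E[f\<^sub>n(W\<^sub>u) f\<^sub>n(W\<^sub>v)]\<close> of \<open>f\<^sub>n = 2 \<phi>\<^sup>(\<^sup>n\<^sup>)(Y)\<close> therefore satisfy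
  \<open>A\<^sub>n' = -(n + 1) A\<^sub>n + \<rho> A\<^sub>n\<^sub>+\<^sub>1\<close>, while \<open>(E[W\<^sub>u W\<^sub>v])' = \<rho> A\<^sub>0\<close>. Since \<open>f\<^sub>n\<close> vanishes at the absorbing points
  \<open>\<plusminus>1\<close>, integrating over all times and iterating gives
  \<open>E[\<sigma>\<^sub>u \<sigma>\<^sub>v] = \<Sum>\<^sub>n f\<^sub>n(0)\<^sup>2 \<rho>\<^sup>n\<^sup>+\<^sup>1 / (n + 1)!\<close>, the power series of \<open>2 / \<pi> arcsin \<rho>\<close>. The remainder after \<open>N\<close>
  steps is dominated by the one for \<open>u = v\<close>, where the left-hand side is \<open>1\<close>; this also settles \<open>\<bar>\<rho>\<bar> = 1\<close>.
  Everything is deduced from the It\^o isometry and a martingale argument, so no uniqueness theorem for the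
  equation is used.
\<close>

section \<open>Product integrals and square integrable limits\<close>

text \<open>The eigenvalue and the coupling come from \<open>f_n' = - f_(n+1) / \<xi>\<close> and
  \<open>f_n'' = - (n + 1) f_n / \<xi>^2\<close>: the generator of one solution is
  \<open>\<xi>^2 / 2\<close> times the second derivative, while the cross term of two solutions with
  the same noise is \<rho> times the product of the two \<open>\<xi> f_n'\<close>, that is, the pair
  at level n + 1. Two obstacles shape the work. The first is to expand an observable of a pair of
  solutions in expectation: along a partition the first-order terms vanish by the martingale
  property, the second-order terms are computed by the isometry, and the cubic terms disappear
  because the discrete quadratic variation is bounded in L2 while the largest increment tends to 0.
  The second is that the \<open>f_n\<close> have unbounded derivatives at the absorbing points, so
  the formula is used for \<open>f_n(\<theta> x)\<close> with \<theta> below 1. The remainder is a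
  time integral of a correlation of \<open>f_N\<close>. It is bounded by the mean of its two
  diagonal versions, and the expansion itself makes these explicit; as time tends to infinity they
  become 1 minus the partial sums of the coefficients, so the conclusion rests on the coefficients
  having sum 1.\<close>

lemma lborel_vec_prod:
  fixes g :: "'d::finite \<Rightarrow> real \<Rightarrow> real"
  assumes "\<And>i. integrable lborel (g i)"
  shows integrable_lborel_vec_prod: "integrable lborel (\<lambda>x::real^'d. \<Prod>i\<in>UNIV. g i (x $ i))"
    and integral_lborel_vec_prod:
      "(\<integral>x. (\<Prod>i\<in>UNIV. g i ((x::real^'d) $ i)) \<partial>lborel) = (\<Prod>i\<in>UNIV. \<integral>x. g i x \<partial>lborel)"
proof -
  interpret product_sigma_finite "\<lambda>_::real^'d. lborel :: real measure" ..
  \<comment> \<open>\<open>lborel_eq\<close> presents Lebesgue measure as the image of a product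
    measure indexed by \<open>Basis\<close>; \<open>ix\<close> recovers the coordinate from the
    basis vector, so that the factors can be reindexed before Fubini.\<close>
  define ix where "ix b = (THE i. b = (axis i 1 :: real^'d))" for b
  have ix[simp]: "ix (axis i 1) = i" for i
    unfolding ix_def by (rule the_equality) (auto simp: axis_eq_axis)
  have inj: "inj (\<lambda>i. axis i 1 :: real^'d)"
    by (auto simp: inj_def axis_eq_axis)
  have Basis: "(Basis :: (real^'d) set) = range (\<lambda>i. axis i 1)"
    by (auto simp: Basis_vec_def)
  have re: "(\<Prod>b\<in>Basis. G b) = (\<Prod>i\<in>UNIV. G (axis i 1))" for G :: "real^'d \<Rightarrow> real"
    unfolding Basis by (subst prod.reindex[OF inj]) simp
  have meas[measurable]: "g i \<in> borel_measurable borel" for i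
    using borel_measurable_integrable[OF assms[of i]] by simp
  have eq: "(\<Prod>i\<in>UNIV. g i ((\<Sum>b\<in>Basis. f b *\<^sub>R b :: real^'d) $ i)) = (\<Prod>b\<in>Basis. g (ix b) (f b))" for f
  proof -
    have "(\<Sum>b\<in>Basis. f b *\<^sub>R b :: real^'d) $ i = f (axis i 1)" for i
      using inner_sum_left_Basis[of "axis i 1 :: real^'d" f]
      by (simp add: cart_eq_inner_axis axis_in_Basis_iff)
    then show ?thesis by (simp add: re)
  qed
  have m: "(\<lambda>x::real^'d. \<Prod>i\<in>UNIV. g i (x $ i)) \<in> borel_measurable borel"
    by measurable
  have m2: "(\<lambda>f. \<Sum>b\<in>Basis. f b *\<^sub>R b :: real^'d) \<in> borel_measurable (Pi\<^sub>M Basis (\<lambda>_. lborel))"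
    by measurable
  show "integrable lborel (\<lambda>x::real^'d. \<Prod>i\<in>UNIV. g i (x $ i))"
    unfolding lborel_eq[where 'a="real^'d"] using m m2
    by (subst integrable_distr_eq) (auto simp only: eq intro!: product_integrable_prod assms finite_Basis)
  have "(\<integral>x. (\<Prod>i\<in>UNIV. g i ((x::real^'d) $ i)) \<partial>lborel)
      = (\<integral>f. (\<Prod>b\<in>Basis. g (ix b) (f b)) \<partial>Pi\<^sub>M (Basis::(real^'d) set) (\<lambda>_. lborel))"
    unfolding lborel_eq[where 'a="real^'d"] using m m2
    by (subst integral_distr) (simp_all only: eq)
  also have "\<dots> = (\<Prod>b\<in>(Basis::(real^'d) set). \<integral>x. g (ix b) x \<partial>lborel)"
    by (rule product_integral_prod) (auto intro: assms)
  finally show "(\<integral>x. (\<Prod>i\<in>UNIV. g i ((x::real^'d) $ i)) \<partial>lborel) = (\<Prod>i\<in>UNIV. \<integral>x. g i x \<partial>lborel)"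
    by (simp add: re)
qed

text \<open>Young's inequality with a free weight \<open>c\<close> plays the role of Cauchy-Schwarz
  in L2: it involves no square roots of integrals, and a small \<open>c\<close> tames the product of
  a fixed function with a vanishing one.\<close>

lemma L2_inner_bounds:
  fixes f g :: "'a \<Rightarrow> 'b::euclidean_space"
  assumes [measurable]: "f \<in> borel_measurable N" "g \<in> borel_measurable N"
    and f: "integrable N (\<lambda>x. (norm (f x))\<^sup>2)" and g: "integrable N (\<lambda>x. (norm (g x))\<^sup>2)"
  shows L2_inner_integrable: "integrable N (\<lambda>x. f x \<bullet> g x)"
    and L2_add_integrable: "integrable N (\<lambda>x. (norm (f x + g x))\<^sup>2)"
    and L2_inner_le: "c > 0 \<Longrightarrow> \<bar>\<integral>x. f x \<bullet> g x \<partial>N\<bar> \<le> c * (\<integral>x. (norm (f x))\<^sup>2 \<partial>N) + (\<integral>x. (norm (g x))\<^sup>2 \<partial>N) / c"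
proof -
  have young: "\<bar>a \<bullet> b\<bar> \<le> c * (norm a)\<^sup>2 + (norm b)\<^sup>2 / c" if "c > 0" for a b :: 'b and c
  proof -
    have "0 \<le> (c * norm a - norm b)\<^sup>2 / c" using that by simp
    also have "\<dots> = c * (norm a)\<^sup>2 + (norm b)\<^sup>2 / c - 2 * (norm a * norm b)"
      using that by (simp add: power2_diff field_simps power2_eq_square)
    finally have "norm a * norm b + norm a * norm b \<le> c * (norm a)\<^sup>2 + (norm b)\<^sup>2 / c" by simp
    moreover have "0 \<le> norm a * norm b" by simp
    ultimately show ?thesis using Cauchy_Schwarz_ineq2[of a b] by linarith
  qed
  show i: "integrable N (\<lambda>x. f x \<bullet> g x)"
    by (rule Bochner_Integration.integrable_bound[OF Bochner_Integration.integrable_add[OF f g]])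
       (use young[of 1] in auto)
  have "integrable N (\<lambda>x. (norm (f x))\<^sup>2 + 2 * (f x \<bullet> g x) + (norm (g x))\<^sup>2)"
    by (intro Bochner_Integration.integrable_add f g integrable_mult_right i)
  then show "integrable N (\<lambda>x. (norm (f x + g x))\<^sup>2)"
    by (simp add: power2_norm_eq_inner algebra_simps inner_commute)
  assume c: "c > 0"
  have "\<bar>\<integral>x. f x \<bullet> g x \<partial>N\<bar> \<le> (\<integral>x. \<bar>f x \<bullet> g x\<bar> \<partial>N)"
    by (rule integral_abs_bound)
  also have "\<dots> \<le> (\<integral>x. c * (norm (f x))\<^sup>2 + (norm (g x))\<^sup>2 / c \<partial>N)"
    using young[OF c] f g i by (intro integral_mono) auto
  also have "\<dots> = c * (\<integral>x. (norm (f x))\<^sup>2 \<partial>N) + (\<integral>x. (norm (g x))\<^sup>2 \<partial>N) / c"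
    using f g by simp
  finally show "\<bar>\<integral>x. f x \<bullet> g x \<partial>N\<bar> \<le> c * (\<integral>x. (norm (f x))\<^sup>2 \<partial>N) + (\<integral>x. (norm (g x))\<^sup>2 \<partial>N) / c" .
qed

text \<open>Convergence of the nonnegative integrals still allows infinite values for early
  \<open>m\<close>. From some index on the distance is finite, and a single such index carries
  square integrability from \<open>fm m\<close> over to \<open>f\<close>.\<close>

lemma L2_limit:
  fixes f :: "'a \<Rightarrow> 'b::euclidean_space"
  assumes [measurable]: "\<And>m. fm m \<in> borel_measurable N" "f \<in> borel_measurable N"
    and fm: "\<And>m. integrable N (\<lambda>x. (norm (fm m x))\<^sup>2)"
    and lim: "(\<lambda>m. \<integral>\<^sup>+x. ennreal ((norm (f x - fm m x))\<^sup>2) \<partial>N) \<longlonglongrightarrow> 0"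
  shows L2_limit_integrable: "integrable N (\<lambda>x. (norm (f x))\<^sup>2)"
    and L2_limit_tendsto: "(\<lambda>m. \<integral>x. (norm (f x - fm m x))\<^sup>2 \<partial>N) \<longlonglongrightarrow> 0"
    and L2_limit_diff_integrable: "eventually (\<lambda>m. integrable N (\<lambda>x. (norm (f x - fm m x))\<^sup>2)) sequentially"
proof -
  have "eventually (\<lambda>m. (\<integral>\<^sup>+x. ennreal ((norm (f x - fm m x))\<^sup>2) \<partial>N) < 1) sequentially"
    using lim by (rule order_tendstoD) simp
  then show ev: "eventually (\<lambda>m. integrable N (\<lambda>x. (norm (f x - fm m x))\<^sup>2)) sequentially"
  proof eventually_elim
    case (elim m)
    then show ?case
      by (intro integrableI_bounded) (auto intro: order.strict_trans)
  qed
  then obtain m where "integrable N (\<lambda>x. (norm (f x - fm m x))\<^sup>2)"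
    by (meson eventually_sequentially order_refl)
  from L2_add_integrable[OF _ _ this fm[of m]] show "integrable N (\<lambda>x. (norm (f x))\<^sup>2)"
    by simp
  have "eventually (\<lambda>m. (\<integral>\<^sup>+x. ennreal ((norm (f x - fm m x))\<^sup>2) \<partial>N) = ennreal (\<integral>x. (norm (f x - fm m x))\<^sup>2 \<partial>N)) sequentially"
    using ev by eventually_elim (auto intro!: nn_integral_eq_integral)
  then have "(\<lambda>m. ennreal (\<integral>x. (norm (f x - fm m x))\<^sup>2 \<partial>N)) \<longlonglongrightarrow> ennreal 0"
    using lim by (auto simp: filterlim_cong)
  then show "(\<lambda>m. \<integral>x. (norm (f x - fm m x))\<^sup>2 \<partial>N) \<longlonglongrightarrow> 0"
    by (subst (asm) tendsto_ennreal_iff) auto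
qed

text \<open>The product of the approximations differs from \<open>f \<bullet> g\<close> by \<open>(f
  - fm) \<bullet> (g - gm) - f \<bullet> (g - gm) - g \<bullet> (f - fm)\<close>, and each term is
  controlled by Young's inequality.\<close>

lemma L2_inner_tendsto:
  fixes f g :: "'a \<Rightarrow> 'b::euclidean_space"
  assumes [measurable]: "\<And>m. fm m \<in> borel_measurable N" "f \<in> borel_measurable N"
      "\<And>m. gm m \<in> borel_measurable N" "g \<in> borel_measurable N"
    and fm: "\<And>m. integrable N (\<lambda>x. (norm (fm m x))\<^sup>2)"
    and gm: "\<And>m. integrable N (\<lambda>x. (norm (gm m x))\<^sup>2)"
    and flim: "(\<lambda>m. \<integral>\<^sup>+x. ennreal ((norm (f x - fm m x))\<^sup>2) \<partial>N) \<longlonglongrightarrow> 0"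
    and glim: "(\<lambda>m. \<integral>\<^sup>+x. ennreal ((norm (g x - gm m x))\<^sup>2) \<partial>N) \<longlonglongrightarrow> 0"
  shows "(\<lambda>m. \<integral>x. fm m x \<bullet> gm m x \<partial>N) \<longlonglongrightarrow> (\<integral>x. f x \<bullet> g x \<partial>N)"
proof -
  note F = L2_limit[OF assms(1,2) fm flim]
  note G = L2_limit[OF assms(3,4) gm glim]
  define a where "a m = (\<integral>x. (norm (f x - fm m x))\<^sup>2 \<partial>N)" for m
  define b where "b m = (\<integral>x. (norm (g x - gm m x))\<^sup>2 \<partial>N)" for m
  define A where "A = (\<integral>x. (norm (f x))\<^sup>2 \<partial>N)"
  define C where "C = (\<integral>x. (norm (g x))\<^sup>2 \<partial>N)"
  have nn: "0 \<le> A" "0 \<le> C" by (auto simp: A_def C_def)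
  have ab: "a \<longlonglongrightarrow> 0" "b \<longlonglongrightarrow> 0" using F(2) G(2) by (simp_all add: a_def[abs_def] b_def[abs_def])
  show ?thesis
  proof (rule tendstoI)
    fix e :: real assume e: "e > 0"
    define K where "K = A + C + 1"
    have K: "K > 0" using nn by (simp add: K_def)
    \<comment> \<open>Makes the contribution of the fixed functions, \<open>c * A + c * C\<close>,
      at most \<open>e / 4\<close>; for this \<open>c\<close> the remaining terms tend to 0.\<close>
    define c where "c = e / (4 * K)"
    have c: "c > 0" using e K by (simp add: c_def)
    have "(\<lambda>m. a m + b m + b m / c + a m / c) \<longlonglongrightarrow> 0 + 0 + 0 / c + 0 / c"
      using c by (intro tendsto_intros ab) auto
    then have "eventually (\<lambda>m. a m + b m + b m / c + a m / c < e / 2) sequentially"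
      using e by (intro order_tendstoD(2)) auto
    with F(3) G(3) show "eventually (\<lambda>m. dist (\<integral>x. fm m x \<bullet> gm m x \<partial>N) (\<integral>x. f x \<bullet> g x \<partial>N) < e) sequentially"
    proof eventually_elim
      case (elim m)
      note df = elim(1) and dg = elim(2)
      have i1: "integrable N (\<lambda>x. (f x - fm m x) \<bullet> (g x - gm m x))"
        using df dg by (intro L2_inner_integrable) auto
      have i2: "integrable N (\<lambda>x. f x \<bullet> (g x - gm m x))"
        using F(1) dg by (intro L2_inner_integrable) auto
      have i3: "integrable N (\<lambda>x. g x \<bullet> (f x - fm m x))"
        using G(1) df by (intro L2_inner_integrable) auto
      have i4: "integrable N (\<lambda>x. f x \<bullet> g x)"
        using F(1) G(1) by (intro L2_inner_integrable) auto
      have "(\<integral>x. fm m x \<bullet> gm m x \<partial>N) = (\<integral>x. f x \<bullet> g x + (f x - fm m x) \<bullet> (g x - gm m x)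
          - f x \<bullet> (g x - gm m x) - g x \<bullet> (f x - fm m x) \<partial>N)"
        by (intro Bochner_Integration.integral_cong) (auto simp: algebra_simps inner_commute)
      also have "\<dots> = (\<integral>x. f x \<bullet> g x \<partial>N) + (\<integral>x. (f x - fm m x) \<bullet> (g x - gm m x) \<partial>N)
          - (\<integral>x. f x \<bullet> (g x - gm m x) \<partial>N) - (\<integral>x. g x \<bullet> (f x - fm m x) \<partial>N)"
        using i1 i2 i3 i4 by simp
      finally have eq: "(\<integral>x. fm m x \<bullet> gm m x \<partial>N) = \<dots>" .
      have 1: "\<bar>\<integral>x. (f x - fm m x) \<bullet> (g x - gm m x) \<partial>N\<bar> \<le> 1 * a m + b m / 1"
        unfolding a_def b_def using df dg by (intro L2_inner_le) auto
      have 2: "\<bar>\<integral>x. f x \<bullet> (g x - gm m x) \<partial>N\<bar> \<le> c * A + b m / c"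
        unfolding A_def b_def using F(1) dg c by (intro L2_inner_le) auto
      have 3: "\<bar>\<integral>x. g x \<bullet> (f x - fm m x) \<partial>N\<bar> \<le> c * C + a m / c"
        unfolding C_def a_def using G(1) df c by (intro L2_inner_le) auto
      have "c * A + c * C \<le> c * K" using c by (simp add: K_def algebra_simps)
      also have "\<dots> = e / 4" using K by (simp add: c_def)
      finally have "c * A + c * C \<le> e / 4" .
      then show ?case
        using 1 2 3 eq elim(3) e unfolding dist_real_def by linarith
    qed
  qed
qed

section \<open>Brownian increments\<close>

lemma (in filtered_prob_space) space_F: "0 \<le> t \<Longrightarrow> space (F t) = space M"
  using subalgebra_F[of t] by (simp add: subalgebra_def)

lemma (in filtered_prob_space) measurable_F_M: "f \<in> measurable (F t) N \<Longrightarrow> 0 \<le> t \<Longrightarrow> f \<in> measurable M N"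
  using measurable_from_subalg[OF subalgebra_F] .

lemma (in filtered_prob_space) measurable_F_mono:
  assumes "f \<in> measurable (F s) N" "0 \<le> s" "s \<le> t"
  shows "f \<in> measurable (F t) N"
  using assms F_mono[of s t] space_F
  by (intro measurable_from_subalg[OF _ assms(1)]) (auto simp: subalgebra_def)

text \<open>The bound is only almost sure because solutions are \<open>[-1, 1]\<close>-valued only almost surely.\<close>

definition (in filtered_prob_space) known_bounded ::
    "real \<Rightarrow> ('a \<Rightarrow> 'b::euclidean_space) \<Rightarrow> bool" where
  "known_bounded t \<eta> \<longleftrightarrow> \<eta> \<in> borel_measurable (F t) \<and> (\<exists>C. AE \<omega> in M. norm (\<eta> \<omega>) \<le> C)"

section \<open>Calculus of bounded quantities known at a given time\<close>

context filtered_prob_space begin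

lemma known_bounded_measurable: "known_bounded t \<eta> \<Longrightarrow> \<eta> \<in> borel_measurable (F t)"
  by (simp add: known_bounded_def)

lemma known_bounded_measurable_M: "known_bounded t \<eta> \<Longrightarrow> 0 \<le> t \<Longrightarrow> \<eta> \<in> borel_measurable M"
  by (rule measurable_F_M[OF known_bounded_measurable])

lemma known_bounded_mono: "known_bounded s \<eta> \<Longrightarrow> 0 \<le> s \<Longrightarrow> s \<le> t \<Longrightarrow> known_bounded t \<eta>"
  by (auto simp: known_bounded_def intro: measurable_F_mono)

lemma known_bounded_AE_bound:
  assumes "known_bounded t \<eta>"
  obtains C where "AE \<omega> in M. norm (\<eta> \<omega>) \<le> C" "0 < C"
proof -
  obtain C where "AE \<omega> in M. norm (\<eta> \<omega>) \<le> C" using assms by (auto simp: known_bounded_def)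
  then have "AE \<omega> in M. norm (\<eta> \<omega>) \<le> max C 1" by eventually_elim auto
  then show thesis using that[of "max C 1"] by simp
qed

lemma known_bounded_const: "known_bounded t (\<lambda>_. c)"
  by (auto simp: known_bounded_def)

lemma known_bounded_inner:
  assumes "known_bounded t \<eta>" "known_bounded t \<theta>"
  shows "known_bounded t (\<lambda>\<omega>. \<eta> \<omega> \<bullet> \<theta> \<omega>)"
proof -
  obtain C D where C: "AE \<omega> in M. norm (\<eta> \<omega>) \<le> C" "0 < C" and D: "AE \<omega> in M. norm (\<theta> \<omega>) \<le> D" "0 < D"
    using assms by (metis known_bounded_AE_bound)
  have "AE \<omega> in M. norm (\<eta> \<omega> \<bullet> \<theta> \<omega>) \<le> C * D"
    using C(1) D(1)
  proof eventually_elim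
    case (elim \<omega>)
    have "\<bar>\<eta> \<omega> \<bullet> \<theta> \<omega>\<bar> \<le> norm (\<eta> \<omega>) * norm (\<theta> \<omega>)" by (rule Cauchy_Schwarz_ineq2)
    also have "\<dots> \<le> C * D" using elim C(2) by (intro mult_mono) auto
    finally show ?case by simp
  qed
  then show ?thesis using assms by (auto simp: known_bounded_def)
qed

lemma known_bounded_mult:
  fixes \<eta> \<theta> :: "'a \<Rightarrow> real"
  shows "known_bounded t \<eta> \<Longrightarrow> known_bounded t \<theta> \<Longrightarrow> known_bounded t (\<lambda>\<omega>. \<eta> \<omega> * \<theta> \<omega>)"
  using known_bounded_inner[of t \<eta> \<theta>] by simp

lemma known_bounded_scaleR:
  fixes z :: "'a \<Rightarrow> real"
  assumes "known_bounded t z" "known_bounded t \<eta>"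
  shows "known_bounded t (\<lambda>\<omega>. z \<omega> *\<^sub>R \<eta> \<omega>)"
proof -
  obtain C D where C: "AE \<omega> in M. norm (z \<omega>) \<le> C" "0 < C" and D: "AE \<omega> in M. norm (\<eta> \<omega>) \<le> D" "0 < D"
    using assms by (metis known_bounded_AE_bound)
  have "AE \<omega> in M. norm (z \<omega> *\<^sub>R \<eta> \<omega>) \<le> C * D"
    using C(1) D(1) by eventually_elim (auto intro!: mult_mono C D order.strict_implies_order[OF C(2)])
  then show ?thesis using assms by (auto simp: known_bounded_def)
qed

lemma known_bounded_nth:
  fixes \<eta> :: "'a \<Rightarrow> real^'n"
  assumes "known_bounded t \<eta>" shows "known_bounded t (\<lambda>\<omega>. \<eta> \<omega> $ i)"
  using known_bounded_inner[OF assms known_bounded_const[of t "axis i 1"]]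
  by (simp add: cart_eq_inner_axis)

lemma known_bounded_mult_integrable:
  fixes X :: "'a \<Rightarrow> real"
  assumes "known_bounded t z" "0 \<le> t" "integrable M X"
  shows "integrable M (\<lambda>\<omega>. X \<omega> * z \<omega>)"
proof -
  obtain C where C: "AE \<omega> in M. norm (z \<omega>) \<le> C" "0 < C"
    using assms by (metis known_bounded_AE_bound)
  note [measurable] = known_bounded_measurable_M[OF assms(1,2)]
  have m[measurable]: "X \<in> borel_measurable M" using assms by auto
  have "integrable M (\<lambda>\<omega>. C * X \<omega>)" using assms by simp
  then show ?thesis
  proof (rule Bochner_Integration.integrable_bound)
    show "AE \<omega> in M. norm (X \<omega> * z \<omega>) \<le> norm (C * X \<omega>)"
      using C(1) by eventually_elim (auto simp: abs_mult C(2) less_imp_le mult.commute[of C] intro!: mult_left_mono)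
  qed measurable
qed

lemma known_bounded_integrable:
  fixes z :: "'a \<Rightarrow> real"
  shows "known_bounded t z \<Longrightarrow> 0 \<le> t \<Longrightarrow> integrable M z"
  using known_bounded_mult_integrable[of t z "\<lambda>_. 1"] by simp

end

section \<open>Moments of Brownian increments and their independence of the past\<close>

context brownian_motion begin

lemma B_measurable[measurable (raw)]: "0 \<le> t \<Longrightarrow> B t \<in> borel_measurable M"
  by (rule measurable_F_M[OF B_adapted])

lemma B_measurable_F: "0 \<le> s \<Longrightarrow> s \<le> t \<Longrightarrow> B s \<in> borel_measurable (F t)"
  by (rule measurable_F_mono[OF B_adapted])

text \<open>The density of the increment is a product over the coordinates, so the moment of a
  monomial splits into one-dimensional Gaussian moments. Free exponents cover means and covariances
  at once.\<close>

lemma increment_monomial_moment: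
  assumes "0 \<le> s" "s < t"
  shows "integrable M (\<lambda>\<omega>. \<Prod>k\<in>UNIV. ((B t \<omega> - B s \<omega>) $ k) ^ e k)" (is ?I)
    and "(\<integral>\<omega>. (\<Prod>k\<in>UNIV. ((B t \<omega> - B s \<omega>) $ k) ^ e k) \<partial>M)
       = (\<Prod>k\<in>UNIV. \<integral>x. normal_density 0 (sqrt (t - s)) x * x ^ e k \<partial>lborel)" (is ?E)
proof -
  note D = B_increment_distr[OF assms]
  let ?f = "\<lambda>x::real^'d. \<Prod>i\<in>UNIV. normal_density 0 (sqrt (t - s)) (x $ i)"
  let ?g = "\<lambda>x::real^'d. \<Prod>k\<in>UNIV. (x $ k) ^ e k"
  have pos: "0 < sqrt (t - s)" using assms by simp
  have i: "integrable lborel (\<lambda>x. normal_density 0 (sqrt (t - s)) x * x ^ e k)" for k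
    using integrable_normal_moment[OF pos, of 0 "e k"] by simp
  have g: "?g \<in> borel_measurable lborel" by measurable
  have nn: "0 \<le> ?f x" for x by (intro prod_nonneg) (auto simp: normal_density_nonneg)
  have eq: "?f x * ?g x = (\<Prod>k\<in>UNIV. normal_density 0 (sqrt (t - s)) (x $ k) * (x $ k) ^ e k)" for x
    by (simp add: prod.distrib)
  show ?I
    using distributed_integrable[OF D g] nn
    integrable_lborel_vec_prod[of "\<lambda>k x. normal_density 0 (sqrt (t - s)) x * x ^ e k", OF i]
    by (simp add: eq)
  show ?E
    using distributed_integral[OF D g] nn
    integral_lborel_vec_prod[of "\<lambda>k x. normal_density 0 (sqrt (t - s)) x * x ^ e k", OF i]
    by (simp add: eq)
qed

lemma
  assumes "0 \<le> s" "s \<le> t"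
  shows increment_mean_integrable: "integrable M (\<lambda>\<omega>. (B t \<omega> - B s \<omega>) $ i)"
    and increment_mean: "(\<integral>\<omega>. (B t \<omega> - B s \<omega>) $ i \<partial>M) = 0"
    and increment_cov_integrable: "integrable M (\<lambda>\<omega>. (B t \<omega> - B s \<omega>) $ i * (B t \<omega> - B s \<omega>) $ j)"
    and increment_cov: "(\<integral>\<omega>. (B t \<omega> - B s \<omega>) $ i * (B t \<omega> - B s \<omega>) $ j \<partial>M) = (if i = j then t - s else 0)"
proof -
  have "integrable M (\<lambda>\<omega>. (B t \<omega> - B s \<omega>) $ i) \<and> (\<integral>\<omega>. (B t \<omega> - B s \<omega>) $ i \<partial>M) = 0 \<and>
    integrable M (\<lambda>\<omega>. (B t \<omega> - B s \<omega>) $ i * (B t \<omega> - B s \<omega>) $ j) \<and>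
    (\<integral>\<omega>. (B t \<omega> - B s \<omega>) $ i * (B t \<omega> - B s \<omega>) $ j \<partial>M) = (if i = j then t - s else 0)"
  proof (cases "s < t")
    case True
    have pos: "0 < sqrt (t - s)" using True by simp
    have m0: "(\<integral>x. normal_density 0 (sqrt (t - s)) x \<partial>lborel) = 1"
      using integral_normal_density[OF pos] .
    have m1: "(\<integral>x. normal_density 0 (sqrt (t - s)) x * x \<partial>lborel) = 0"
      using integral_normal_moment_nz_1[OF pos, of 0] by simp
    have m2: "(\<integral>x. normal_density 0 (sqrt (t - s)) x * x\<^sup>2 \<partial>lborel) = t - s"
      using integral_normal_moment_even[OF pos, of 0 1] True by simp
    have pw: "x ^ of_bool b = (if b then x else 1)" for x :: real and b by simp
    \<comment> \<open>Exponents built from \<open>of_bool\<close> select the coordinates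
      \<open>i\<close> and \<open>j\<close>; in \<open>p2\<close> the exponent is 2 when they
      coincide.\<close>
    have p1: "(\<Prod>k\<in>UNIV. (y $ k) ^ of_bool (k = i)) = y $ i" for y :: "real^'d"
      by (simp add: pw)
    have p2: "(\<Prod>k\<in>UNIV. (y $ k) ^ (of_bool (k = i) + of_bool (k = j))) = y $ i * y $ j" for y :: "real^'d"
      by (simp add: power_add prod.distrib pw)
    note I1 = increment_monomial_moment[OF assms(1) True, of "\<lambda>k. of_bool (k = i)", unfolded p1]
    note I2 = increment_monomial_moment[OF assms(1) True, of "\<lambda>k. of_bool (k = i) + of_bool (k = j)", unfolded p2]
    let ?m = "\<lambda>e. \<integral>x. normal_density 0 (sqrt (t - s)) x * x ^ e \<partial>lborel"
    have "?m (of_bool (i = i)) = 0" using m1 by simp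
    then have z1: "(\<Prod>k\<in>UNIV. ?m (of_bool (k = i))) = 0"
      by (intro prod_zero) auto
    have z2: "(\<Prod>k\<in>UNIV. ?m (of_bool (k = i) + of_bool (k = j))) = (if i = j then t - s else 0)"
    proof (cases "i = j")
      case True
      have "(\<Prod>k\<in>UNIV. ?m (of_bool (k = i) + of_bool (k = j))) = (\<Prod>k\<in>UNIV. if k = i then t - s else 1)"
        using True m0 m2 by (intro prod.cong) (auto simp: numeral_2_eq_2)
      then show ?thesis using True by simp
    next
      case False
      have "?m (of_bool (i = i) + of_bool (i = j)) = 0" using m1 False by simp
      then show ?thesis
        using False by (subst prod_zero) auto
    qed
    show ?thesis using I1 I2 z1 z2 by simp
  next
    case False
    then show ?thesis using assms by simp
  qed
  then show "integrable M (\<lambda>\<omega>. (B t \<omega> - B s \<omega>) $ i)" "(\<integral>\<omega>. (B t \<omega> - B s \<omega>) $ i \<partial>M) = 0"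
    "integrable M (\<lambda>\<omega>. (B t \<omega> - B s \<omega>) $ i * (B t \<omega> - B s \<omega>) $ j)"
    "(\<integral>\<omega>. (B t \<omega> - B s \<omega>) $ i * (B t \<omega> - B s \<omega>) $ j \<partial>M) = (if i = j then t - s else 0)"
    by blast+
qed

text \<open>The sigma-algebra generated by \<open>X\<close> lies in \<open>F s\<close> and the one
  generated by \<open>g\<close> of the increment lies in that of the increment, so independence is
  inherited from \<open>B_increment_indep\<close>.\<close>

lemma increment_indep_var:
  fixes X :: "'a \<Rightarrow> real" and g :: "real^'d \<Rightarrow> real"
  assumes "0 \<le> s" "s \<le> t" and X: "X \<in> borel_measurable (F s)" and [measurable]: "g \<in> borel_measurable borel"
  shows "indep_var borel X borel (\<lambda>\<omega>. g (B t \<omega> - B s \<omega>))"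
  unfolding indep_var_eq
proof (intro conjI)
  have t: "0 \<le> t" using assms by simp
  note [measurable] = B_measurable[OF t] B_measurable[OF assms(1)]
  show "random_variable borel X" using measurable_F_M[OF X assms(1)] .
  show "random_variable borel (\<lambda>\<omega>. g (B t \<omega> - B s \<omega>))" by measurable
  have 1: "sigma_sets (space M) {X -` A \<inter> space M |A. A \<in> sets borel} \<subseteq> sets (F s)"
    unfolding space_F[OF assms(1), symmetric]
    by (rule sets.sigma_sets_subset) (auto intro: measurable_sets[OF X])
  let ?V = "vimage_algebra (space M) (\<lambda>\<omega>. B t \<omega> - B s \<omega>) borel"
  have *: "(\<lambda>\<omega>. g (B t \<omega> - B s \<omega>)) -` A \<inter> space M \<in> sets ?V" if "A \<in> sets borel" for A
  proof -
    have "g -` A \<in> sets borel" using measurable_sets[OF assms(4) that] by simp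
    from in_vimage_algebra[OF this, of "\<lambda>\<omega>. B t \<omega> - B s \<omega>" "space M"] show ?thesis
      by (simp add: vimage_def)
  qed
  have 2: "sigma_sets (space M) {(\<lambda>\<omega>. g (B t \<omega> - B s \<omega>)) -` A \<inter> space M |A. A \<in> sets borel} \<subseteq> sets ?V"
  proof -
    have "sigma_sets (space ?V) {(\<lambda>\<omega>. g (B t \<omega> - B s \<omega>)) -` A \<inter> space M |A. A \<in> sets borel} \<subseteq> sets ?V"
      using * by (intro sets.sigma_sets_subset) blast
    then show ?thesis by (simp only: space_vimage_algebra)
  qed
  show "indep_set (sigma_sets (space M) {X -` A \<inter> space M |A. A \<in> sets borel})
     (sigma_sets (space M) {(\<lambda>\<omega>. g (B t \<omega> - B s \<omega>)) -` A \<inter> space M |A. A \<in> sets borel})"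
    using B_increment_indep[OF assms(1,2)] unfolding indep_set_def
    by (rule indep_sets_mono_sets) (simp only: 1 2 split: bool.split, simp)
qed

text \<open>\<open>X\<close> is merely integrable because it will be an earlier increment paired
  with its coefficient, which is unbounded. Coordinatewise the expectation factors, and one factor
  is the mean of a centred increment.\<close>

lemma
  fixes X :: "'a \<Rightarrow> real" and \<theta> :: "'a \<Rightarrow> real^'d"
  assumes st: "0 \<le> s" "s \<le> t" and X: "X \<in> borel_measurable (F s)" "integrable M X" and \<theta>: "known_bounded s \<theta>"
  shows increment_inner_integrable: "integrable M (\<lambda>\<omega>. X \<omega> * (\<theta> \<omega> \<bullet> (B t \<omega> - B s \<omega>)))"
    and increment_inner_mean: "(\<integral>\<omega>. X \<omega> * (\<theta> \<omega> \<bullet> (B t \<omega> - B s \<omega>)) \<partial>M) = 0"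
proof -
  have eq: "X \<omega> * (\<theta> \<omega> \<bullet> (B t \<omega> - B s \<omega>)) = (\<Sum>i\<in>UNIV. (X \<omega> * \<theta> \<omega> $ i) * (B t \<omega> - B s \<omega>) $ i)" for \<omega>
    by (simp add: inner_vec_def sum_distrib_left mult.assoc)
  have Xi: "integrable M (\<lambda>\<omega>. X \<omega> * \<theta> \<omega> $ i)" for i
    using known_bounded_mult_integrable[OF known_bounded_nth[OF \<theta>] st(1) X(2)] .
  have Xm: "(\<lambda>\<omega>. X \<omega> * \<theta> \<omega> $ i) \<in> borel_measurable (F s)" for i
    using X(1) known_bounded_measurable[OF known_bounded_nth[OF \<theta>]] by (rule borel_measurable_times)
  note iv = increment_indep_var[OF st Xm, of "\<lambda>x. x $ i" for i]
  have m: "(\<lambda>x::real^'d. x $ i) \<in> borel_measurable borel" for i by measurable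
  note J = indep_var_integrable[OF iv[OF m] Xi increment_mean_integrable[OF st]]
  note E = indep_var_lebesgue_integral[OF iv[OF m] Xi increment_mean_integrable[OF st]]
  show "integrable M (\<lambda>\<omega>. X \<omega> * (\<theta> \<omega> \<bullet> (B t \<omega> - B s \<omega>)))"
    unfolding eq by (intro Bochner_Integration.integrable_sum J)
  show "(\<integral>\<omega>. X \<omega> * (\<theta> \<omega> \<bullet> (B t \<omega> - B s \<omega>)) \<partial>M) = 0"
    unfolding eq by (subst Bochner_Integration.integral_sum[OF J], simp only: E increment_mean[OF st]) simp
qed

text \<open>The covariance matrix of the increment is \<open>t - s\<close> times the identity;
  independence of the coefficients therefore leaves only the diagonal terms, which reassemble to
  \<open>\<eta> \<bullet> \<theta>\<close>.\<close>

lemma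
  fixes \<eta> \<theta> :: "'a \<Rightarrow> real^'d"
  assumes st: "0 \<le> s" "s \<le> t" and \<eta>: "known_bounded s \<eta>" and \<theta>: "known_bounded s \<theta>"
  shows increment_inner2_integrable: "integrable M (\<lambda>\<omega>. (\<eta> \<omega> \<bullet> (B t \<omega> - B s \<omega>)) * (\<theta> \<omega> \<bullet> (B t \<omega> - B s \<omega>)))"
    and increment_inner2: "(\<integral>\<omega>. (\<eta> \<omega> \<bullet> (B t \<omega> - B s \<omega>)) * (\<theta> \<omega> \<bullet> (B t \<omega> - B s \<omega>)) \<partial>M)
      = (t - s) * (\<integral>\<omega>. \<eta> \<omega> \<bullet> \<theta> \<omega> \<partial>M)"
proof -
  have eq: "(\<eta> \<omega> \<bullet> (B t \<omega> - B s \<omega>)) * (\<theta> \<omega> \<bullet> (B t \<omega> - B s \<omega>))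
      = (\<Sum>i\<in>UNIV. \<Sum>j\<in>UNIV. (\<eta> \<omega> $ i * \<theta> \<omega> $ j) * ((B t \<omega> - B s \<omega>) $ i * (B t \<omega> - B s \<omega>) $ j))" for \<omega>
    by (simp add: inner_vec_def sum_product ac_simps)
  have kb: "known_bounded s (\<lambda>\<omega>. \<eta> \<omega> $ i * \<theta> \<omega> $ j)" for i j
    by (intro known_bounded_mult known_bounded_nth \<eta> \<theta>)
  note Xi = known_bounded_integrable[OF kb st(1)]
  note iv = increment_indep_var[OF st known_bounded_measurable[OF kb], of "\<lambda>x. x $ i * x $ j" for i j]
  have m: "(\<lambda>x::real^'d. x $ i * x $ j) \<in> borel_measurable borel" for i j by measurable
  note J = indep_var_integrable[OF iv[OF m] Xi increment_cov_integrable[OF st]]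
  note E = indep_var_lebesgue_integral[OF iv[OF m] Xi increment_cov_integrable[OF st]]
  show "integrable M (\<lambda>\<omega>. (\<eta> \<omega> \<bullet> (B t \<omega> - B s \<omega>)) * (\<theta> \<omega> \<bullet> (B t \<omega> - B s \<omega>)))"
    unfolding eq by (intro Bochner_Integration.integrable_sum J)
  have "(\<integral>\<omega>. (\<eta> \<omega> \<bullet> (B t \<omega> - B s \<omega>)) * (\<theta> \<omega> \<bullet> (B t \<omega> - B s \<omega>)) \<partial>M)
     = (\<Sum>i\<in>UNIV. \<Sum>j\<in>UNIV. (\<integral>\<omega>. \<eta> \<omega> $ i * \<theta> \<omega> $ j \<partial>M) * (if i = j then t - s else 0))"
    unfolding eq
    by (subst Bochner_Integration.integral_sum[OF Bochner_Integration.integrable_sum[OF J]],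
        subst Bochner_Integration.integral_sum[OF J], simp only: E increment_cov[OF st])
  also have "\<dots> = (t - s) * (\<Sum>i\<in>UNIV. \<integral>\<omega>. \<eta> \<omega> $ i * \<theta> \<omega> $ i \<partial>M)"
    by (simp add: sum_distrib_left mult.commute[of "t - s"] if_distrib[of "(*) _"] cong: if_cong)
  also have "(\<Sum>i\<in>UNIV. \<integral>\<omega>. \<eta> \<omega> $ i * \<theta> \<omega> $ i \<partial>M) = (\<integral>\<omega>. \<eta> \<omega> \<bullet> \<theta> \<omega> \<partial>M)"
    unfolding inner_vec_def inner_real_def using Xi by (subst Bochner_Integration.integral_sum) auto
  finally show "(\<integral>\<omega>. (\<eta> \<omega> \<bullet> (B t \<omega> - B s \<omega>)) * (\<theta> \<omega> \<bullet> (B t \<omega> - B s \<omega>)) \<partial>M)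
      = (t - s) * (\<integral>\<omega>. \<eta> \<omega> \<bullet> \<theta> \<omega> \<partial>M)" .
qed

end

section \<open>The isometry for elementary integrands\<close>

lemma (in pair_sigma_finite)
  fixes f g :: "_ \<Rightarrow> real"
  assumes f: "integrable M1 f" and g: "integrable M2 g"
  shows integrable_pair_times: "integrable (M1 \<Otimes>\<^sub>M M2) (\<lambda>(x, y). f x * g y)"
    and integral_pair_times: "(\<integral>(x, y). f x * g y \<partial>(M1 \<Otimes>\<^sub>M M2)) = (\<integral>x. f x \<partial>M1) * (\<integral>y. g y \<partial>M2)"
proof -
  have [measurable]: "f \<in> borel_measurable M1" "g \<in> borel_measurable M2" using f g by auto
  show *: "integrable (M1 \<Otimes>\<^sub>M M2) (\<lambda>(x, y). f x * g y)"
  proof (rule Fubini_integrable)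
    show "integrable M1 (\<lambda>x. \<integral>y. norm (case (x, y) of (x, y) \<Rightarrow> f x * g y) \<partial>M2)"
      using f by (simp add: abs_mult)
    show "AE x in M1. integrable M2 (\<lambda>y. case (x, y) of (x, y) \<Rightarrow> f x * g y)"
      using g by simp
  qed measurable
  show "(\<integral>(x, y). f x * g y \<partial>(M1 \<Otimes>\<^sub>M M2)) = (\<integral>x. f x \<partial>M1) * (\<integral>y. g y \<partial>M2)"
    using integral_fst[OF *] by simp
qed

text \<open>Integrands become elements of L2 over this single measure space, so that the Ito
  isometry is an equality of two L2 inner products and passes to limits by
  \<open>L2_inner_tendsto\<close>.\<close>

definition (in filtered_prob_space) time_prod :: "real \<Rightarrow> (real \<times> 'a) measure" where
  "time_prod t = restrict_space lborel {0..t} \<Otimes>\<^sub>M M"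

lemma (in filtered_prob_space) pair_sigma_finite_time:
  "pair_sigma_finite (restrict_space lborel {0..t::real}) M"
proof -
  interpret A: sigma_finite_measure "restrict_space lborel {0..t::real}"
    by (rule sigma_finite_measure_restrict_space) (auto intro: sigma_finite_lborel)
  show ?thesis ..
qed

lemma (in filtered_prob_space) nn_integral_time_prod:
  assumes "f \<in> borel_measurable (time_prod t)"
  shows "(\<integral>\<^sup>+x. f x \<partial>time_prod t) = (\<integral>\<^sup>+\<omega>. (\<integral>\<^sup>+s\<in>{0..t}. f (s, \<omega>) \<partial>lborel) \<partial>M)"
proof -
  interpret P: pair_sigma_finite "restrict_space lborel {0..t}" M by (rule pair_sigma_finite_time)
  show ?thesis
    using P.nn_integral_snd[of f] assms by (simp add: time_prod_def nn_integral_restrict_space)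
qed

lemma (in filtered_prob_space) measurable_time_prod_eq:
  "borel_measurable (restrict_space borel {0..t} \<Otimes>\<^sub>M M) = borel_measurable (time_prod t)"
  unfolding time_prod_def
  by (intro measurable_cong_sets sets_pair_measure_cong sets_restrict_space_cong) auto

lemma (in filtered_prob_space) measurable_time_prod_fst:
  "f \<in> borel_measurable borel \<Longrightarrow> (\<lambda>x. f (fst x)) \<in> borel_measurable (time_prod t)"
  unfolding time_prod_def
  by (rule measurable_compose[OF measurable_fst], rule measurable_restrict_space1) simp

lemma (in filtered_prob_space) measurable_time_prod_snd:
  "f \<in> borel_measurable M \<Longrightarrow> (\<lambda>x. f (snd x)) \<in> borel_measurable (time_prod t)"
  unfolding time_prod_def by (rule measurable_compose[OF measurable_snd])

context brownian_motion begin

lemma increment_inner_has_integral: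
  fixes \<theta> :: "'a \<Rightarrow> real^'d"
  assumes "0 \<le> s" "s \<le> t" "known_bounded s \<theta>"
  shows "has_bochner_integral M (\<lambda>\<omega>. \<theta> \<omega> \<bullet> (B t \<omega> - B s \<omega>)) 0"
  using increment_inner_integrable[OF assms(1,2) borel_measurable_const integrable_const assms(3), of 1]
    increment_inner_mean[OF assms(1,2) borel_measurable_const integrable_const assms(3), of 1]
  unfolding mult_1_left has_bochner_integral_iff by blast

text \<open>The longer increment is split at \<open>c\<close> and \<open>d\<close>. Its part before
  \<open>c\<close> is known when the short increment starts, and its part after \<open>d\<close> is
  centred given everything else, so only the common interval contributes.\<close>

lemma pair_covariance_nested:
  fixes \<eta> \<theta> :: "'a \<Rightarrow> real^'d"
  assumes o: "0 \<le> a" "a \<le> c" "c \<le> d" "d \<le> b" and \<eta>: "known_bounded a \<eta>" and \<theta>: "known_bounded c \<theta>"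
  shows "has_bochner_integral M (\<lambda>\<omega>. (\<eta> \<omega> \<bullet> (B b \<omega> - B a \<omega>)) * (\<theta> \<omega> \<bullet> (B d \<omega> - B c \<omega>)))
    ((d - c) * (\<integral>\<omega>. \<eta> \<omega> \<bullet> \<theta> \<omega> \<partial>M))"
proof -
  have nn: "0 \<le> c" "0 \<le> d" "0 \<le> b" using o by auto
  have \<eta>c: "known_bounded c \<eta>" by (rule known_bounded_mono[OF \<eta>]) (use o in auto)
  have \<eta>d: "known_bounded d \<eta>" by (rule known_bounded_mono[OF \<eta>]) (use o in auto)
  have \<theta>d: "known_bounded d \<theta>" by (rule known_bounded_mono[OF \<theta>]) (use o in auto)
  have m1: "(\<lambda>\<omega>. \<eta> \<omega> \<bullet> (B c \<omega> - B a \<omega>)) \<in> borel_measurable (F c)"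
    by (intro borel_measurable_inner borel_measurable_diff known_bounded_measurable[OF \<eta>c] B_measurable_F) (use o nn in auto)
  have i1: "integrable M (\<lambda>\<omega>. \<eta> \<omega> \<bullet> (B c \<omega> - B a \<omega>))"
    using increment_inner_has_integral[OF o(1,2) \<eta>] by (rule integrable.intros)
  have m2: "(\<lambda>\<omega>. \<theta> \<omega> \<bullet> (B d \<omega> - B c \<omega>)) \<in> borel_measurable (F d)"
    by (intro borel_measurable_inner borel_measurable_diff known_bounded_measurable[OF \<theta>d] B_measurable_F) (use o nn in auto)
  have i2: "integrable M (\<lambda>\<omega>. \<theta> \<omega> \<bullet> (B d \<omega> - B c \<omega>))"
    using increment_inner_has_integral[OF nn(1) o(3) \<theta>] by (rule integrable.intros)
  have 1: "has_bochner_integral M (\<lambda>\<omega>. (\<eta> \<omega> \<bullet> (B c \<omega> - B a \<omega>)) * (\<theta> \<omega> \<bullet> (B d \<omega> - B c \<omega>))) 0"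
    using increment_inner_integrable[OF nn(1) o(3) m1 i1 \<theta>] increment_inner_mean[OF nn(1) o(3) m1 i1 \<theta>]
    by (simp add: has_bochner_integral_iff)
  have 2: "has_bochner_integral M (\<lambda>\<omega>. (\<eta> \<omega> \<bullet> (B d \<omega> - B c \<omega>)) * (\<theta> \<omega> \<bullet> (B d \<omega> - B c \<omega>)))
      ((d - c) * (\<integral>\<omega>. \<eta> \<omega> \<bullet> \<theta> \<omega> \<partial>M))"
    using increment_inner2_integrable[OF nn(1) o(3) \<eta>c \<theta>] increment_inner2[OF nn(1) o(3) \<eta>c \<theta>]
    by (simp add: has_bochner_integral_iff)
  have 3: "has_bochner_integral M (\<lambda>\<omega>. (\<theta> \<omega> \<bullet> (B d \<omega> - B c \<omega>)) * (\<eta> \<omega> \<bullet> (B b \<omega> - B d \<omega>))) 0"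
    using increment_inner_integrable[OF nn(2) o(4) m2 i2 \<eta>d] increment_inner_mean[OF nn(2) o(4) m2 i2 \<eta>d]
    by (simp add: has_bochner_integral_iff)
  have "\<eta> \<omega> \<bullet> (B b \<omega> - B a \<omega>) = \<eta> \<omega> \<bullet> (B c \<omega> - B a \<omega>) + \<eta> \<omega> \<bullet> (B d \<omega> - B c \<omega>) + \<eta> \<omega> \<bullet> (B b \<omega> - B d \<omega>)" for \<omega>
    by (simp add: inner_diff_right)
  then have eq: "(\<eta> \<omega> \<bullet> (B b \<omega> - B a \<omega>)) * (\<theta> \<omega> \<bullet> (B d \<omega> - B c \<omega>))
    = (\<eta> \<omega> \<bullet> (B c \<omega> - B a \<omega>)) * (\<theta> \<omega> \<bullet> (B d \<omega> - B c \<omega>))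
      + (\<eta> \<omega> \<bullet> (B d \<omega> - B c \<omega>)) * (\<theta> \<omega> \<bullet> (B d \<omega> - B c \<omega>))
      + (\<theta> \<omega> \<bullet> (B d \<omega> - B c \<omega>)) * (\<eta> \<omega> \<bullet> (B b \<omega> - B d \<omega>))" for \<omega>
    by (simp only: distrib_right mult.commute[of "\<theta> \<omega> \<bullet> (B d \<omega> - B c \<omega>)" "\<eta> \<omega> \<bullet> (B b \<omega> - B d \<omega>)"])
  show ?thesis
    unfolding eq using has_bochner_integral_add[OF has_bochner_integral_add[OF 1 2] 3] by simp
qed

text \<open>If the intervals overlap without nesting, the second increment is cut at
  \<open>b\<close>: the piece up to \<open>b\<close> is nested in the first interval, and the piece
  after \<open>b\<close> is orthogonal to all that is known at \<open>b\<close>.\<close>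

lemma pair_covariance_ordered:
  fixes \<eta> \<theta> :: "'a \<Rightarrow> real^'d"
  assumes o: "0 \<le> a" "a \<le> b" "a \<le> c" "c \<le> d" and \<eta>: "known_bounded a \<eta>" and \<theta>: "known_bounded c \<theta>"
  shows "has_bochner_integral M (\<lambda>\<omega>. (\<eta> \<omega> \<bullet> (B b \<omega> - B a \<omega>)) * (\<theta> \<omega> \<bullet> (B d \<omega> - B c \<omega>)))
    (measure lborel ({a<..b} \<inter> {c<..d}) * (\<integral>\<omega>. \<eta> \<omega> \<bullet> \<theta> \<omega> \<partial>M))"
proof -
  have nn: "0 \<le> c" "0 \<le> d" "0 \<le> b" using o by auto
  have later: "has_bochner_integral M (\<lambda>\<omega>. (\<eta> \<omega> \<bullet> (B b \<omega> - B a \<omega>)) * (\<theta> \<omega> \<bullet> (B d \<omega> - B e \<omega>))) 0"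
    if e: "b \<le> e" "c \<le> e" "e \<le> d" for e
  proof -
    have e0: "0 \<le> e" using nn e by simp
    have \<theta>e: "known_bounded e \<theta>" by (rule known_bounded_mono[OF \<theta>]) (use nn e in auto)
    have \<eta>e: "known_bounded e \<eta>" by (rule known_bounded_mono[OF \<eta>]) (use o e in auto)
    have m: "(\<lambda>\<omega>. \<eta> \<omega> \<bullet> (B b \<omega> - B a \<omega>)) \<in> borel_measurable (F e)"
      by (intro borel_measurable_inner borel_measurable_diff known_bounded_measurable[OF \<eta>e] B_measurable_F) (use o nn e in auto)
    have i: "integrable M (\<lambda>\<omega>. \<eta> \<omega> \<bullet> (B b \<omega> - B a \<omega>))"
      using increment_inner_has_integral[OF o(1,2) \<eta>] by (rule integrable.intros)
    show ?thesis
      using increment_inner_integrable[OF e0 e(3) m i \<theta>e] increment_inner_mean[OF e0 e(3) m i \<theta>e]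
      by (simp add: has_bochner_integral_iff)
  qed
  consider "d \<le> b" | "c \<le> b" "b \<le> d" | "b < c" by linarith
  then show ?thesis
  proof cases
    case 1
    then have "{a<..b} \<inter> {c<..d} = {c<..d}" using o by auto
    then show ?thesis using pair_covariance_nested[OF o(1,3,4) 1 \<eta> \<theta>] o by simp
  next
    case 2
    have *: "has_bochner_integral M (\<lambda>\<omega>. (\<eta> \<omega> \<bullet> (B b \<omega> - B a \<omega>)) * (\<theta> \<omega> \<bullet> (B b \<omega> - B c \<omega>)))
      ((b - c) * (\<integral>\<omega>. \<eta> \<omega> \<bullet> \<theta> \<omega> \<partial>M))"
      by (rule pair_covariance_nested[OF o(1,3) 2(1) order_refl \<eta> \<theta>])
    have "{a<..b} \<inter> {c<..d} = {c<..b}" using o 2 by auto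
    moreover have "\<theta> \<omega> \<bullet> (B d \<omega> - B c \<omega>) = \<theta> \<omega> \<bullet> (B b \<omega> - B c \<omega>) + \<theta> \<omega> \<bullet> (B d \<omega> - B b \<omega>)" for \<omega>
      by (simp add: inner_diff_right)
    ultimately show ?thesis
      using has_bochner_integral_add[OF * later[of b]] 2 by (simp add: distrib_left)
  next
    case 3
    then have "{a<..b} \<inter> {c<..d} = {}" by auto
    then show ?thesis using later[of c] 3 o by simp
  qed
qed

lemma pair_covariance:
  fixes \<eta> \<theta> :: "'a \<Rightarrow> real^'d"
  assumes o: "0 \<le> a" "a \<le> b" "0 \<le> c" "c \<le> d" and \<eta>: "known_bounded a \<eta>" and \<theta>: "known_bounded c \<theta>"
  shows "has_bochner_integral M (\<lambda>\<omega>. (\<eta> \<omega> \<bullet> (B b \<omega> - B a \<omega>)) * (\<theta> \<omega> \<bullet> (B d \<omega> - B c \<omega>)))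
    (measure lborel ({a<..b} \<inter> {c<..d}) * (\<integral>\<omega>. \<eta> \<omega> \<bullet> \<theta> \<omega> \<partial>M))"
proof (cases "a \<le> c")
  case True
  then show ?thesis using pair_covariance_ordered[OF o(1,2) True o(4) \<eta> \<theta>] by simp
next
  case False
  then have "c \<le> a" by simp
  from pair_covariance_ordered[OF o(3,4) this o(2) \<theta> \<eta>] show ?thesis
    by (simp add: mult.commute inner_commute Int_commute)
qed

text \<open>
  Elementary integrands are lists of intervals with coefficients. The intervals may overlap: the isometry is
  checked pairwise, so no common refinement of partitions is needed and sums are just appended lists.
\<close>

definition elem_integral :: "(real \<times> real \<times> ('a \<Rightarrow> real^'d)) list \<Rightarrow> 'a \<Rightarrow> real" where
  "elem_integral L \<omega> = (\<Sum>(a, b, \<eta>)\<leftarrow>L. \<eta> \<omega> \<bullet> (B b \<omega> - B a \<omega>))"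

definition elem_process :: "(real \<times> real \<times> ('a \<Rightarrow> real^'d)) list \<Rightarrow> real \<times> 'a \<Rightarrow> real^'d" where
  "elem_process L x = (\<Sum>(a, b, \<eta>)\<leftarrow>L. indicator {a<..b} (fst x) *\<^sub>R \<eta> (snd x))"

definition elementary :: "real \<Rightarrow> real \<Rightarrow> (real \<times> real \<times> ('a \<Rightarrow> real^'d)) list \<Rightarrow> bool" where
  "elementary s t L \<longleftrightarrow> (\<forall>(a, b, \<eta>)\<in>set L. s \<le> a \<and> a \<le> b \<and> b \<le> t \<and> known_bounded a \<eta>)"

lemma elem_Nil[simp]: "elem_integral [] \<omega> = 0" "elem_process [] x = 0" "elementary s t []"
  by (auto simp: elem_integral_def elem_process_def elementary_def)

lemma elem_Cons[simp]:
  "elem_integral ((a, b, \<eta>) # L) \<omega> = \<eta> \<omega> \<bullet> (B b \<omega> - B a \<omega>) + elem_integral L \<omega>"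
  "elem_process ((a, b, \<eta>) # L) x = indicator {a<..b} (fst x) *\<^sub>R \<eta> (snd x) + elem_process L x"
  "elementary s t ((a, b, \<eta>) # L) \<longleftrightarrow> s \<le> a \<and> a \<le> b \<and> b \<le> t \<and> known_bounded a \<eta> \<and> elementary s t L"
  by (auto simp: elem_integral_def elem_process_def elementary_def)

lemma elem_append:
  "elem_integral (L @ L') \<omega> = elem_integral L \<omega> + elem_integral L' \<omega>"
  "elem_process (L @ L') x = elem_process L x + elem_process L' x"
  "elementary s t (L @ L') \<longleftrightarrow> elementary s t L \<and> elementary s t L'"
  by (simp_all add: elem_integral_def elem_process_def elementary_def ball_Un)

lemma elementary_mono: "elementary s t L \<Longrightarrow> s' \<le> s \<Longrightarrow> t \<le> t' \<Longrightarrow> elementary s' t' L"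
  by (induction L) auto

lemma elem_integral_measurable: "elementary s t L \<Longrightarrow> 0 \<le> s \<Longrightarrow> elem_integral L \<in> borel_measurable M"
proof (induction L)
  case Nil
  then show ?case unfolding elem_integral_def by simp
next
  case (Cons x L)
  obtain a b \<eta> where x: "x = (a, b, \<eta>)" by (cases x)
  have o: "0 \<le> a" "0 \<le> b" "known_bounded a \<eta>" "elementary s t L" using Cons x by auto
  note [measurable] = known_bounded_measurable_M[OF o(3,1)] B_measurable[OF o(1)] B_measurable[OF o(2)]
    Cons.IH[OF o(4) Cons.prems(2)]
  have "(\<lambda>\<omega>. \<eta> \<omega> \<bullet> (B b \<omega> - B a \<omega>) + elem_integral L \<omega>) \<in> borel_measurable M" by measurable
  moreover have "elem_integral (x # L) = (\<lambda>\<omega>. \<eta> \<omega> \<bullet> (B b \<omega> - B a \<omega>) + elem_integral L \<omega>)"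
    by (simp add: x fun_eq_iff)
  ultimately show ?case by simp
qed

lemma elem_process_measurable: "elementary s t L \<Longrightarrow> 0 \<le> s \<Longrightarrow> elem_process L \<in> borel_measurable (time_prod T)"
proof (induction L)
  case Nil
  then show ?case unfolding elem_process_def by simp
next
  case (Cons x L)
  obtain a b \<eta> where x: "x = (a, b, \<eta>)" by (cases x)
  have o: "0 \<le> a" "0 \<le> b" "known_bounded a \<eta>" "elementary s t L" using Cons x by auto
  have i: "(indicator {a<..b} :: real \<Rightarrow> real) \<in> borel_measurable borel" by simp
  note [measurable] = measurable_time_prod_fst[OF i, of T] Cons.IH[OF o(4) Cons.prems(2)]
    measurable_time_prod_snd[OF known_bounded_measurable_M[OF o(3,1)], of T]
  have "(\<lambda>x. indicator {a<..b} (fst x) *\<^sub>R \<eta> (snd x) + elem_process L x) \<in> borel_measurable (time_prod T)"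
    by measurable
  moreover have "elem_process (x # L) = (\<lambda>x. indicator {a<..b} (fst x) *\<^sub>R \<eta> (snd x) + elem_process L x)"
    by (simp add: x fun_eq_iff)
  ultimately show ?case by simp
qed

text \<open>Both integrals equal the length of the overlap times the expectation of
  \<open>\<eta> \<bullet> \<theta>\<close>, on the probability space by
  \<open>pair_covariance\<close> and on the product space by Fubini.\<close>

lemma elementary_pair_isometry:
  fixes \<eta> \<theta> :: "'a \<Rightarrow> real^'d"
  assumes o: "0 \<le> a" "a \<le> b" "b \<le> t" "0 \<le> c" "c \<le> d" "d \<le> t"
    and \<eta>: "known_bounded a \<eta>" and \<theta>: "known_bounded c \<theta>"
  shows "\<exists>I. has_bochner_integral M (\<lambda>\<omega>. (\<eta> \<omega> \<bullet> (B b \<omega> - B a \<omega>)) * (\<theta> \<omega> \<bullet> (B d \<omega> - B c \<omega>))) I \<and>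
    has_bochner_integral (time_prod t) (\<lambda>x. (indicator {a<..b} (fst x) *\<^sub>R \<eta> (snd x)) \<bullet> (indicator {c<..d} (fst x) *\<^sub>R \<theta> (snd x))) I"
proof (intro exI conjI)
  show "has_bochner_integral M (\<lambda>\<omega>. (\<eta> \<omega> \<bullet> (B b \<omega> - B a \<omega>)) * (\<theta> \<omega> \<bullet> (B d \<omega> - B c \<omega>)))
    (measure lborel ({a<..b} \<inter> {c<..d}) * (\<integral>\<omega>. \<eta> \<omega> \<bullet> \<theta> \<omega> \<partial>M))"
    by (rule pair_covariance[OF o(1,2,4,5) \<eta> \<theta>])
  interpret P: pair_sigma_finite "restrict_space lborel {0..t}" M by (rule pair_sigma_finite_time)
  define S where "S = {a<..b} \<inter> {c<..d}"
  have S: "S \<subseteq> {0..t}" "S \<in> sets borel" using o by (auto simp: S_def)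
  have fin: "emeasure lborel S < \<infinity>"
  proof -
    have "emeasure lborel S \<le> emeasure lborel {0..t}"
      using S by (intro emeasure_mono) auto
    also have "\<dots> < \<infinity>" using o by simp
    finally show ?thesis .
  qed
  have ind: "indicator {0..t} x *\<^sub>R indicator S x = (indicator S x :: real)" for x
    using S by (auto simp: indicator_def)
  have i1: "integrable (restrict_space lborel {0..t}) (indicator S :: real \<Rightarrow> real)"
    using fin S by (subst integrable_restrict_space) (simp_all only: ind, auto)
  have v1: "(\<integral>x. indicator S x \<partial>restrict_space lborel {0..t}) = measure lborel S"
    using S by (subst integral_restrict_space) (simp_all only: ind, auto)
  \<comment> \<open>The coefficients are known at different times; at \<open>max a c\<close> both
    are.\<close>
  have i2: "integrable M (\<lambda>\<omega>. \<eta> \<omega> \<bullet> \<theta> \<omega>)"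
    using known_bounded_inner[OF known_bounded_mono[OF \<eta> o(1), of "max a c"] known_bounded_mono[OF \<theta> o(4), of "max a c"]]
    by (rule known_bounded_integrable) (use o in auto)
  have eq: "(indicator {a<..b} (fst x) *\<^sub>R \<eta> (snd x)) \<bullet> (indicator {c<..d} (fst x) *\<^sub>R \<theta> (snd x))
      = (case x of (r, \<omega>) \<Rightarrow> indicator S r * (\<eta> \<omega> \<bullet> \<theta> \<omega>))" for x
    by (auto simp: indicator_def S_def split: prod.split)
  show "has_bochner_integral (time_prod t) (\<lambda>x. (indicator {a<..b} (fst x) *\<^sub>R \<eta> (snd x)) \<bullet> (indicator {c<..d} (fst x) *\<^sub>R \<theta> (snd x)))
    (measure lborel ({a<..b} \<inter> {c<..d}) * (\<integral>\<omega>. \<eta> \<omega> \<bullet> \<theta> \<omega> \<partial>M))"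
    unfolding eq has_bochner_integral_iff time_prod_def
    using P.integrable_pair_times[OF i1 i2] P.integral_pair_times[OF i1 i2] v1 by (simp add: S_def)
qed

text \<open>Naming the common value \<open>I\<close> lets integrability and equality travel together
  through the double induction, which is just bilinearity over pairs of intervals.\<close>

lemma elementary_isometry_ex:
  assumes "elementary 0 t L" "elementary 0 t L'"
  shows "\<exists>I. has_bochner_integral M (\<lambda>\<omega>. elem_integral L \<omega> * elem_integral L' \<omega>) I \<and>
    has_bochner_integral (time_prod t) (\<lambda>x. elem_process L x \<bullet> elem_process L' x) I"
  using assms(1)
proof (induction L)
  case Nil
  then show ?case by (auto simp: has_bochner_integral_zero)
next
  case (Cons x L)
  obtain a b \<eta> where x: "x = (a, b, \<eta>)" by (cases x)
  have o: "0 \<le> a" "a \<le> b" "b \<le> t" "known_bounded a \<eta>" "elementary 0 t L" using Cons x by auto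
  have "\<exists>I. has_bochner_integral M (\<lambda>\<omega>. (\<eta> \<omega> \<bullet> (B b \<omega> - B a \<omega>)) * elem_integral L' \<omega>) I \<and>
    has_bochner_integral (time_prod t) (\<lambda>x. (indicator {a<..b} (fst x) *\<^sub>R \<eta> (snd x)) \<bullet> elem_process L' x) I"
    using assms(2)
  proof (induction L')
    case Nil
    then show ?case by (auto simp: has_bochner_integral_zero)
  next
    case (Cons y L')
    obtain c d \<theta> where y: "y = (c, d, \<theta>)" by (cases y)
    have o': "0 \<le> c" "c \<le> d" "d \<le> t" "known_bounded c \<theta>" "elementary 0 t L'" using Cons y by auto
    obtain I J where I: "has_bochner_integral M (\<lambda>\<omega>. (\<eta> \<omega> \<bullet> (B b \<omega> - B a \<omega>)) * (\<theta> \<omega> \<bullet> (B d \<omega> - B c \<omega>))) I"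
      "has_bochner_integral (time_prod t) (\<lambda>x. (indicator {a<..b} (fst x) *\<^sub>R \<eta> (snd x)) \<bullet> (indicator {c<..d} (fst x) *\<^sub>R \<theta> (snd x))) I"
      and J: "has_bochner_integral M (\<lambda>\<omega>. (\<eta> \<omega> \<bullet> (B b \<omega> - B a \<omega>)) * elem_integral L' \<omega>) J"
      "has_bochner_integral (time_prod t) (\<lambda>x. (indicator {a<..b} (fst x) *\<^sub>R \<eta> (snd x)) \<bullet> elem_process L' x) J"
      using elementary_pair_isometry[OF o(1,2,3) o'(1,2,3) o(4) o'(4)] Cons.IH[OF o'(5)] by blast
    show ?case
      unfolding y elem_Cons distrib_left inner_add_right
      using has_bochner_integral_add[OF I(1) J(1)] has_bochner_integral_add[OF I(2) J(2)] by blast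
  qed
  then obtain I J where I: "has_bochner_integral M (\<lambda>\<omega>. (\<eta> \<omega> \<bullet> (B b \<omega> - B a \<omega>)) * elem_integral L' \<omega>) I"
    "has_bochner_integral (time_prod t) (\<lambda>x. (indicator {a<..b} (fst x) *\<^sub>R \<eta> (snd x)) \<bullet> elem_process L' x) I"
    and J: "has_bochner_integral M (\<lambda>\<omega>. elem_integral L \<omega> * elem_integral L' \<omega>) J"
    "has_bochner_integral (time_prod t) (\<lambda>x. elem_process L x \<bullet> elem_process L' x) J"
    using Cons.IH[OF o(5)] by blast
  show ?case
    unfolding x elem_Cons distrib_right inner_add_left
    using has_bochner_integral_add[OF I(1) J(1)] has_bochner_integral_add[OF I(2) J(2)] by blast
qed

lemma
  assumes "elementary 0 t L" "elementary 0 t L'"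
  shows elem_integral_mult_integrable: "integrable M (\<lambda>\<omega>. elem_integral L \<omega> * elem_integral L' \<omega>)"
    and elem_process_inner_integrable: "integrable (time_prod t) (\<lambda>x. elem_process L x \<bullet> elem_process L' x)"
    and elementary_isometry: "(\<integral>\<omega>. elem_integral L \<omega> * elem_integral L' \<omega> \<partial>M)
      = (\<integral>x. elem_process L x \<bullet> elem_process L' x \<partial>time_prod t)"
  using elementary_isometry_ex[OF assms] by (auto simp: has_bochner_integral_iff)

lemma elementary_nn_isometry:
  assumes "elementary 0 t L"
  shows "(\<integral>\<^sup>+\<omega>. ennreal ((elem_integral L \<omega>)\<^sup>2) \<partial>M) = (\<integral>\<^sup>+x. ennreal ((norm (elem_process L x))\<^sup>2) \<partial>time_prod t)"
  using elem_integral_mult_integrable[OF assms assms] elem_process_inner_integrable[OF assms assms]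
    elementary_isometry[OF assms assms]
  unfolding power2_norm_eq_inner power2_eq_square[of "elem_integral L _"]
  by (subst (1 2) nn_integral_eq_integral) auto

lemma elem_integral_mean:
  assumes "elementary s t L" "0 \<le> s"
  shows "has_bochner_integral M (elem_integral L) 0"
  using assms(1)
proof (induction L)
  case Nil
  then show ?case by (simp add: has_bochner_integral_zero elem_integral_def)
next
  case (Cons x L)
  obtain a b \<eta> where x: "x = (a, b, \<eta>)" by (cases x)
  have o: "0 \<le> a" "a \<le> b" "known_bounded a \<eta>" "elementary s t L" using Cons assms x by auto
  have "has_bochner_integral M (\<lambda>\<omega>. \<eta> \<omega> \<bullet> (B b \<omega> - B a \<omega>)) 0"
    by (rule increment_inner_has_integral[OF o(1-3)])
  moreover have "elem_integral (x # L) = (\<lambda>\<omega>. \<eta> \<omega> \<bullet> (B b \<omega> - B a \<omega>) + elem_integral L \<omega>)"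
    by (simp add: x fun_eq_iff)
  ultimately show ?case
    using has_bochner_integral_add[OF _ Cons.IH[OF o(4)]] by fastforce
qed

text \<open>Restricts a process to times after \<open>s\<close>. Intervals lying before
  \<open>s\<close> are not removed but collapse to \<open>{s<..s}\<close>, which is empty, so the
  list keeps its shape.\<close>

definition elem_cut :: "real \<Rightarrow> (real \<times> real \<times> ('a \<Rightarrow> real^'d)) list \<Rightarrow> (real \<times> real \<times> ('a \<Rightarrow> real^'d)) list" where
  "elem_cut s L = map (\<lambda>(a, b, \<eta>). (max s a, max s b, \<eta>)) L"

definition elem_scale :: "('a \<Rightarrow> real) \<Rightarrow> (real \<times> real \<times> ('a \<Rightarrow> real^'d)) list \<Rightarrow> (real \<times> real \<times> ('a \<Rightarrow> real^'d)) list" where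
  "elem_scale z L = map (\<lambda>(a, b, \<eta>). (a, b, \<lambda>\<omega>. z \<omega> *\<^sub>R \<eta> \<omega>)) L"

lemma elementary_cut: "elementary 0 t L \<Longrightarrow> 0 \<le> s \<Longrightarrow> s \<le> t \<Longrightarrow> elementary s t (elem_cut s L)"
proof (induction L)
  case (Cons x L)
  obtain a b \<eta> where x: "x = (a, b, \<eta>)" by (cases x)
  have "known_bounded (max s a) \<eta>"
    by (rule known_bounded_mono[where s = a]) (use Cons.prems x in auto)
  then show ?case using Cons x by (auto simp: elem_cut_def max.coboundedI2)
qed (simp add: elem_cut_def)

lemma elem_process_cut: "elem_process (elem_cut s L) x = indicator {s<..} (fst x) *\<^sub>R elem_process L x"
proof (induction L)
  case (Cons x L)
  then show ?case by (cases x) (auto simp: elem_cut_def indicator_def scaleR_add_right)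
qed (simp add: elem_cut_def)

lemma elementary_scale: "elementary s t L \<Longrightarrow> known_bounded s z \<Longrightarrow> 0 \<le> s \<Longrightarrow> elementary s t (elem_scale z L)"
  by (induction L) (auto simp: elem_scale_def intro!: known_bounded_scaleR intro: known_bounded_mono)

lemma elem_integral_scale: "elem_integral (elem_scale z L) \<omega> = z \<omega> * elem_integral L \<omega>"
  by (induction L) (auto simp: elem_scale_def algebra_simps)

lemma elem_process_scale: "elem_process (elem_scale z L) x = z (snd x) *\<^sub>R elem_process L x"
  by (induction L) (auto simp: elem_scale_def algebra_simps)

lemma elem_process_eq_0:
  assumes "elementary 0 s L" "s < fst x"
  shows "elem_process L x = 0"
  using assms by (induction L) (auto simp: indicator_def)

text \<open>From here on a simple integrand is only a list of intervals; the ordering of its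
  partition serves to orient each interval and to place it inside \<open>[0, t]\<close>.\<close>

lemma simple_integrand_elementary:
  assumes "simple_integrand F t n \<tau> \<eta>"
  shows "\<exists>L. elementary 0 t L \<and> elem_integral L = simple_ito_integral B n \<tau> \<eta> \<and>
    (\<forall>s \<omega>. elem_process L (s, \<omega>) = simple_process n \<tau> \<eta> s \<omega>)"
proof (intro exI conjI)
  let ?L = "map (\<lambda>k. (\<tau> k, \<tau> (Suc k), \<eta> k)) [0..<n]"
  have mono: "\<tau> i \<le> \<tau> j" if "i \<le> j" "j \<le> n" for i j
    using that
  proof (induction j rule: dec_induct)
    case (step k)
    have "\<tau> k \<le> \<tau> (Suc k)" using assms step by (simp add: simple_integrand_def)
    then show ?case using step by simp
  qed simp
  have nn: "0 \<le> \<tau> k" if "k \<le> n" for k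
    using mono[of 0 k] that assms by (simp add: simple_integrand_def)
  have le: "\<tau> k \<le> t" if "k \<le> n" for k
    using mono[of k n] that assms by (simp add: simple_integrand_def)
  have "known_bounded (\<tau> k) (\<eta> k)" if kn: "k < n" for k
  proof -
    obtain C where "\<eta> k \<in> borel_measurable (F (\<tau> k))" "\<forall>\<omega>\<in>space (F (\<tau> k)). norm (\<eta> k \<omega>) \<le> C"
      using assms kn unfolding simple_integrand_def by blast
    moreover have "space (F (\<tau> k)) = space M" using nn[of k] that by (intro space_F) auto
    ultimately show ?thesis by (auto simp: known_bounded_def intro!: exI[of _ C] AE_I2)
  qed
  then show "elementary 0 t ?L"
    using nn le mono[of k "Suc k" for k] by (auto simp: elementary_def)
  show "elem_integral ?L = simple_ito_integral B n \<tau> \<eta>"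
    by (auto simp: fun_eq_iff elem_integral_def simple_ito_integral_def interv_sum_list_conv_sum_set_nat
        comp_def atLeast0LessThan)
  show "\<forall>s \<omega>. elem_process ?L (s, \<omega>) = simple_process n \<tau> \<eta> s \<omega>"
    by (auto simp: elem_process_def simple_process_def interv_sum_list_conv_sum_set_nat
        comp_def atLeast0LessThan)
qed

end

section \<open>Increments of It\^o integrals\<close>

lemma L2_scale_tendsto:
  fixes f :: "'a \<Rightarrow> 'b::euclidean_space"
  assumes "\<And>x. x \<in> space N \<Longrightarrow> \<bar>z x\<bar> \<le> C"
    and [measurable]: "\<And>m. fm m \<in> borel_measurable N" "f \<in> borel_measurable N"
    and lim: "(\<lambda>m. \<integral>\<^sup>+x. ennreal ((norm (f x - fm m x))\<^sup>2) \<partial>N) \<longlonglongrightarrow> 0"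
  shows "(\<lambda>m. \<integral>\<^sup>+x. ennreal ((norm (z x *\<^sub>R f x - z x *\<^sub>R fm m x))\<^sup>2) \<partial>N) \<longlonglongrightarrow> 0"
proof (rule tendsto_sandwich[OF _ _ tendsto_const])
  show "(\<lambda>m. ennreal (C\<^sup>2) * (\<integral>\<^sup>+x. ennreal ((norm (f x - fm m x))\<^sup>2) \<partial>N)) \<longlonglongrightarrow> 0"
    using ennreal_tendsto_cmult[OF _ lim, of "ennreal (C\<^sup>2)"] by simp
  have "(norm (z x *\<^sub>R f x - z x *\<^sub>R fm m x))\<^sup>2 \<le> C\<^sup>2 * (norm (f x - fm m x))\<^sup>2" if "x \<in> space N" for x m
  proof -
    have "(norm (z x *\<^sub>R f x - z x *\<^sub>R fm m x))\<^sup>2 = \<bar>z x\<bar>\<^sup>2 * (norm (f x - fm m x))\<^sup>2"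
      by (simp add: scaleR_diff_right[symmetric] power_mult_distrib)
    also have "\<dots> \<le> C\<^sup>2 * (norm (f x - fm m x))\<^sup>2"
      using assms(1)[OF that] by (intro mult_right_mono power_mono) auto
    finally show ?thesis .
  qed
  then have "(\<integral>\<^sup>+x. ennreal ((norm (z x *\<^sub>R f x - z x *\<^sub>R fm m x))\<^sup>2) \<partial>N)
      \<le> (\<integral>\<^sup>+x. ennreal (C\<^sup>2) * ennreal ((norm (f x - fm m x))\<^sup>2) \<partial>N)" for m
    by (intro nn_integral_mono) (auto simp: ennreal_mult[symmetric] intro!: ennreal_leI)
  then show "eventually (\<lambda>m. (\<integral>\<^sup>+x. ennreal ((norm (z x *\<^sub>R f x - z x *\<^sub>R fm m x))\<^sup>2) \<partial>N)
      \<le> ennreal (C\<^sup>2) * (\<integral>\<^sup>+x. ennreal ((norm (f x - fm m x))\<^sup>2) \<partial>N)) sequentially"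
    by (simp add: nn_integral_cmult)
qed simp

context brownian_motion begin

lemma elem_integral_sq_integrable:
  assumes "elementary s t L" "0 \<le> s"
  shows "integrable M (\<lambda>\<omega>. (norm (elem_integral L \<omega>))\<^sup>2)"
proof -
  note L = elementary_mono[OF assms(1) assms(2) order_refl]
  show ?thesis using elem_integral_mult_integrable[OF L L] by (simp add: power2_eq_square)
qed

lemma elem_process_sq_integrable:
  assumes "elementary s t L" "0 \<le> s"
  shows "integrable (time_prod t) (\<lambda>x. (norm (elem_process L x))\<^sup>2)"
proof -
  note L = elementary_mono[OF assms(1) assms(2) order_refl]
  show ?thesis using elem_process_inner_integrable[OF L L] by (simp add: power2_norm_eq_inner)
qed

lemma ito_integral_elementary_approx:
  assumes I: "has_ito_integral M F B H t I"
  shows "\<exists>L. (\<forall>m. elementary 0 t (L m)) \<and>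
    (\<lambda>x. H (fst x) (snd x)) \<in> borel_measurable (time_prod t) \<and> I \<in> borel_measurable M \<and>
    (\<lambda>m. \<integral>\<^sup>+\<omega>. (\<integral>\<^sup>+s\<in>{0..t}. ennreal ((norm (H s \<omega> - elem_process (L m) (s, \<omega>)))\<^sup>2) \<partial>lborel) \<partial>M) \<longlonglongrightarrow> 0 \<and>
    (\<lambda>m. \<integral>\<^sup>+\<omega>. ennreal ((I \<omega> - elem_integral (L m) \<omega>)\<^sup>2) \<partial>M) \<longlonglongrightarrow> 0"
proof -
  from I obtain n \<tau> \<eta> where simp: "\<And>m. simple_integrand F t (n m) (\<tau> m) (\<eta> m)"
    and lims: "(\<lambda>m. \<integral>\<^sup>+\<omega>. (\<integral>\<^sup>+s\<in>{0..t}.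
            ennreal ((norm (H s \<omega> - simple_process (n m) (\<tau> m) (\<eta> m) s \<omega>))\<^sup>2) \<partial>lborel) \<partial>M) \<longlonglongrightarrow> 0"
      "(\<lambda>m. \<integral>\<^sup>+\<omega>. ennreal ((I \<omega> - simple_ito_integral B (n m) (\<tau> m) (\<eta> m) \<omega>)\<^sup>2) \<partial>M) \<longlonglongrightarrow> 0"
    unfolding has_ito_integral_def by blast
  have "\<forall>m. \<exists>L. elementary 0 t L \<and> elem_integral L = simple_ito_integral B (n m) (\<tau> m) (\<eta> m) \<and>
    (\<forall>s \<omega>. elem_process L (s, \<omega>) = simple_process (n m) (\<tau> m) (\<eta> m) s \<omega>)"
    using simple_integrand_elementary[OF simp] by blast
  then obtain L where L: "\<And>m. elementary 0 t (L m)"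
    "\<And>m. elem_integral (L m) = simple_ito_integral B (n m) (\<tau> m) (\<eta> m)"
    "\<And>m s \<omega>. elem_process (L m) (s, \<omega>) = simple_process (n m) (\<tau> m) (\<eta> m) s \<omega>"
    by metis
  have "(\<lambda>(s, \<omega>). H s \<omega>) \<in> borel_measurable (time_prod t)" "I \<in> borel_measurable M"
    using I unfolding has_ito_integral_def ito_integrand_def measurable_time_prod_eq by blast+
  with L lims show ?thesis by (intro exI[of _ L]) (auto simp: case_prod_beta')
qed

text \<open>The two integrals come with unrelated approximating sequences on \<open>[0, t]\<close>
  and \<open>[0, s]\<close>. Cutting the first sequence at \<open>s\<close> approximates the
  increment, because on \<open>[0, s]\<close> both sequences are close to \<open>H\<close> and
  hence, by the isometry, have close integrals.\<close>

lemma ito_increment_approx: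
  assumes I: "has_ito_integral M F B H t I" and J: "has_ito_integral M F B H s J" and st: "0 \<le> s" "s \<le> t"
  shows "\<exists>L. (\<forall>m. elementary s t (L m)) \<and>
    (\<lambda>m. \<integral>\<^sup>+x. ennreal ((norm (indicator {s<..} (fst x) *\<^sub>R H (fst x) (snd x) - elem_process (L m) x))\<^sup>2) \<partial>time_prod t) \<longlonglongrightarrow> 0 \<and>
    (\<lambda>m. \<integral>\<^sup>+\<omega>. ennreal ((norm (I \<omega> - J \<omega> - elem_integral (L m) \<omega>))\<^sup>2) \<partial>M) \<longlonglongrightarrow> 0"
proof -
  obtain L where L: "\<And>m. elementary 0 t (L m)"
    and Hm[measurable]: "(\<lambda>x. H (fst x) (snd x)) \<in> borel_measurable (time_prod t)" and Im[measurable]: "I \<in> borel_measurable M"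
    and Lp: "(\<lambda>m. \<integral>\<^sup>+\<omega>. (\<integral>\<^sup>+s\<in>{0..t}. ennreal ((norm (H s \<omega> - elem_process (L m) (s, \<omega>)))\<^sup>2) \<partial>lborel) \<partial>M) \<longlonglongrightarrow> 0"
    and Li: "(\<lambda>m. \<integral>\<^sup>+\<omega>. ennreal ((I \<omega> - elem_integral (L m) \<omega>)\<^sup>2) \<partial>M) \<longlonglongrightarrow> 0"
    using ito_integral_elementary_approx[OF I] by blast
  obtain K where K: "\<And>m. elementary 0 s (K m)"
    and "(\<lambda>x. H (fst x) (snd x)) \<in> borel_measurable (time_prod s)" and Jm[measurable]: "J \<in> borel_measurable M"
    and Kp: "(\<lambda>m. \<integral>\<^sup>+\<omega>. (\<integral>\<^sup>+r\<in>{0..s}. ennreal ((norm (H r \<omega> - elem_process (K m) (r, \<omega>)))\<^sup>2) \<partial>lborel) \<partial>M) \<longlonglongrightarrow> 0"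
    and Ki: "(\<lambda>m. \<integral>\<^sup>+\<omega>. ennreal ((J \<omega> - elem_integral (K m) \<omega>)\<^sup>2) \<partial>M) \<longlonglongrightarrow> 0"
    using ito_integral_elementary_approx[OF J] by blast
  define HH where "HH x = H (fst x) (snd x)" for x
  define R where "R m = elem_cut s (L m)" for m
  \<comment> \<open>This is \<open>L m\<close> minus \<open>K m\<close> minus \<open>R m\<close>:
    its process is the difference of the two approximations up to time \<open>s\<close> and vanishes
    afterwards.\<close>
  define D where "D m = L m @ elem_scale (\<lambda>_. -1) (K m) @ elem_scale (\<lambda>_. -1) (R m)" for m
  have HHm[measurable]: "HH \<in> borel_measurable (time_prod t)" using Hm by (simp add: HH_def[abs_def])
  have R: "elementary s t (R m)" for m
    unfolding R_def by (rule elementary_cut[OF L st])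
  have K': "elementary 0 t (K m)" for m
    using elementary_mono[OF K order_refl st(2)] .
  have R': "elementary 0 t (R m)" for m
    using elementary_mono[OF R st(1) order_refl] .
  have D: "elementary 0 t (D m)" for m
    unfolding D_def elem_append by (intro conjI L elementary_scale K' R' known_bounded_const) auto
  note [measurable] = elem_process_measurable[OF L order_refl, where T=t] elem_process_measurable[OF K' order_refl, where T=t]
    elem_integral_measurable[OF L order_refl] elem_integral_measurable[OF K' order_refl] elem_integral_measurable[OF R' order_refl]
    elem_integral_measurable[OF D order_refl]
  have ms: "(\<lambda>x. indicator A (fst x) :: real) \<in> borel_measurable (time_prod t)" if "A \<in> sets borel" for A
    using that by (intro measurable_time_prod_fst) auto
  have ms1[measurable]: "(\<lambda>x. indicator {..s} (fst x) :: real) \<in> borel_measurable (time_prod t)" by (rule ms) simp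
  have HI: "(\<lambda>m. \<integral>\<^sup>+x. ennreal ((norm (HH x - elem_process (L m) x))\<^sup>2) \<partial>time_prod t) \<longlonglongrightarrow> 0" (is "?a \<longlonglongrightarrow> 0")
  proof -
    have "?a = (\<lambda>m. \<integral>\<^sup>+\<omega>. (\<integral>\<^sup>+s\<in>{0..t}. ennreal ((norm (H s \<omega> - elem_process (L m) (s, \<omega>)))\<^sup>2) \<partial>lborel) \<partial>M)"
      by (rule ext, subst nn_integral_time_prod) (measurable, simp add: HH_def)
    with Lp show ?thesis by simp
  qed
  have HJ: "(\<lambda>m. \<integral>\<^sup>+x. ennreal ((norm (indicator {..s} (fst x) *\<^sub>R (HH x - elem_process (K m) x)))\<^sup>2) \<partial>time_prod t) \<longlonglongrightarrow> 0" (is "?b \<longlonglongrightarrow> 0")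
  proof -
    have "?b m = (\<integral>\<^sup>+\<omega>. (\<integral>\<^sup>+r\<in>{0..s}. ennreal ((norm (H r \<omega> - elem_process (K m) (r, \<omega>)))\<^sup>2) \<partial>lborel) \<partial>M)" for m
      using st by (subst nn_integral_time_prod, measurable)
        (auto simp: HH_def indicator_def intro!: nn_integral_cong)
    with Kp show ?thesis by simp
  qed
  have DP: "(norm (elem_process (D m) x))\<^sup>2 \<le> 2 * (norm (HH x - elem_process (L m) x))\<^sup>2
      + 2 * (norm (indicator {..s} (fst x) *\<^sub>R (HH x - elem_process (K m) x)))\<^sup>2" for m x
  proof (cases "fst x \<le> s")
    case True
    define p where "p = HH x - elem_process (L m) x"
    define q where "q = HH x - elem_process (K m) x"
    have "elem_process (D m) x = q - p"
      using True by (simp add: D_def elem_append elem_process_scale R_def elem_process_cut p_def q_def)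
    moreover have "(norm (q - p))\<^sup>2 \<le> 2 * (norm p)\<^sup>2 + 2 * (norm q)\<^sup>2"
    proof -
      have "(norm (q - p))\<^sup>2 + (norm (q + p))\<^sup>2 = 2 * (norm p)\<^sup>2 + 2 * (norm q)\<^sup>2"
        by (simp add: power2_norm_eq_inner algebra_simps inner_commute)
      then show ?thesis using zero_le_power2[of "norm (q + p)"] by linarith
    qed
    ultimately show ?thesis using True by (simp add: p_def q_def)
  next
    case False
    have "elem_process (K m) x = 0" by (rule elem_process_eq_0[OF K]) (use False in simp)
    then have "elem_process (D m) x = 0"
      using False by (simp add: D_def elem_append elem_process_scale R_def elem_process_cut)
    then show ?thesis by simp
  qed
  have DI: "(\<integral>\<^sup>+\<omega>. ennreal ((elem_integral (D m) \<omega>)\<^sup>2) \<partial>M) \<le> 2 * ?a m + 2 * ?b m" for m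
  proof -
    have "(\<integral>\<^sup>+\<omega>. ennreal ((elem_integral (D m) \<omega>)\<^sup>2) \<partial>M) = (\<integral>\<^sup>+x. ennreal ((norm (elem_process (D m) x))\<^sup>2) \<partial>time_prod t)"
      by (rule elementary_nn_isometry[OF D])
    also have "\<dots> \<le> (\<integral>\<^sup>+x. 2 * ennreal ((norm (HH x - elem_process (L m) x))\<^sup>2)
      + 2 * ennreal ((norm (indicator {..s} (fst x) *\<^sub>R (HH x - elem_process (K m) x)))\<^sup>2) \<partial>time_prod t)"
    proof (rule nn_integral_mono)
      fix x
      show "ennreal ((norm (elem_process (D m) x))\<^sup>2) \<le> 2 * ennreal ((norm (HH x - elem_process (L m) x))\<^sup>2)
      + 2 * ennreal ((norm (indicator {..s} (fst x) *\<^sub>R (HH x - elem_process (K m) x)))\<^sup>2)"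
        using ennreal_leI[OF DP[of m x]]
        by (simp add: ennreal_plus ennreal_mult del: norm_scaleR)
    qed
    also have "\<dots> = 2 * ?a m + 2 * ?b m"
      by (subst nn_integral_add) (measurable, simp add: nn_integral_cmult del: norm_scaleR)
    finally show ?thesis .
  qed
  let ?c = "\<lambda>m. \<integral>\<^sup>+\<omega>. ennreal ((I \<omega> - elem_integral (L m) \<omega>)\<^sup>2) \<partial>M"
  let ?d = "\<lambda>m. \<integral>\<^sup>+\<omega>. ennreal ((J \<omega> - elem_integral (K m) \<omega>)\<^sup>2) \<partial>M"
  \<comment> \<open>In terms of the integrals, \<open>I - J - R = (I - L) - (J - K) + D\<close>, and
    the square of a sum of three terms is at most three times the sum of their squares.\<close>
  have fin: "(\<integral>\<^sup>+\<omega>. ennreal ((norm (I \<omega> - J \<omega> - elem_integral (R m) \<omega>))\<^sup>2) \<partial>M)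
      \<le> 3 * ?c m + 3 * ?d m + 3 * (2 * ?a m + 2 * ?b m)" for m
  proof -
    have pt: "(norm (I \<omega> - J \<omega> - elem_integral (R m) \<omega>))\<^sup>2 \<le> 3 * (I \<omega> - elem_integral (L m) \<omega>)\<^sup>2
        + 3 * (J \<omega> - elem_integral (K m) \<omega>)\<^sup>2 + 3 * (elem_integral (D m) \<omega>)\<^sup>2" for \<omega>
    proof -
      define x where "x = I \<omega> - elem_integral (L m) \<omega>"
      define y where "y = J \<omega> - elem_integral (K m) \<omega>"
      define z where "z = elem_integral (D m) \<omega>"
      have eqn: "I \<omega> - J \<omega> - elem_integral (R m) \<omega> = x - y + z"
        by (simp add: x_def y_def z_def D_def elem_append elem_integral_scale)
      have le: "(x - y + z)\<^sup>2 \<le> 3 * x\<^sup>2 + 3 * y\<^sup>2 + 3 * z\<^sup>2"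
      proof -
        have "3 * x\<^sup>2 + 3 * y\<^sup>2 + 3 * z\<^sup>2 - (x - y + z)\<^sup>2 = (x + y)\<^sup>2 + (x - z)\<^sup>2 + (y + z)\<^sup>2"
          by (simp add: power2_eq_square algebra_simps)
        then show ?thesis
          using zero_le_power2[of "x + y"] zero_le_power2[of "x - z"] zero_le_power2[of "y + z"] by linarith
      qed
      show ?thesis
        unfolding real_norm_def power2_abs eqn x_def[symmetric] y_def[symmetric] z_def[symmetric] by (rule le)
    qed
    have "(\<integral>\<^sup>+\<omega>. ennreal ((norm (I \<omega> - J \<omega> - elem_integral (R m) \<omega>))\<^sup>2) \<partial>M)
      \<le> (\<integral>\<^sup>+\<omega>. 3 * ennreal ((I \<omega> - elem_integral (L m) \<omega>)\<^sup>2) + 3 * ennreal ((J \<omega> - elem_integral (K m) \<omega>)\<^sup>2)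
          + 3 * ennreal ((elem_integral (D m) \<omega>)\<^sup>2) \<partial>M)"
    proof (rule nn_integral_mono)
      fix \<omega>
      show "ennreal ((norm (I \<omega> - J \<omega> - elem_integral (R m) \<omega>))\<^sup>2) \<le> 3 * ennreal ((I \<omega> - elem_integral (L m) \<omega>)\<^sup>2)
        + 3 * ennreal ((J \<omega> - elem_integral (K m) \<omega>)\<^sup>2) + 3 * ennreal ((elem_integral (D m) \<omega>)\<^sup>2)"
        using ennreal_leI[OF pt[of \<omega>]] by (simp add: ennreal_plus ennreal_mult)
    qed
    also have "\<dots> = 3 * ?c m + 3 * ?d m + 3 * (\<integral>\<^sup>+\<omega>. ennreal ((elem_integral (D m) \<omega>)\<^sup>2) \<partial>M)"
      by (simp add: nn_integral_add nn_integral_cmult)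
    also have "\<dots> \<le> 3 * ?c m + 3 * ?d m + 3 * (2 * ?a m + 2 * ?b m)"
      by (intro add_left_mono mult_left_mono DI) auto
    finally show ?thesis .
  qed
  have "(\<lambda>m. 3 * ?c m + 3 * ?d m + 3 * (2 * ?a m + 2 * ?b m)) \<longlonglongrightarrow> 3 * 0 + 3 * 0 + 3 * (2 * 0 + 2 * 0)"
    by (intro tendsto_add ennreal_tendsto_cmult HI HJ Li Ki) auto
  then have up: "(\<lambda>m. 3 * ?c m + 3 * ?d m + 3 * (2 * ?a m + 2 * ?b m)) \<longlonglongrightarrow> 0"
    by (simp only: mult_zero_right add_0_left)
  have lim1: "(\<lambda>m. \<integral>\<^sup>+\<omega>. ennreal ((norm (I \<omega> - J \<omega> - elem_integral (R m) \<omega>))\<^sup>2) \<partial>M) \<longlonglongrightarrow> 0"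
    by (rule tendsto_sandwich[OF always_eventually always_eventually tendsto_const up])
       (use fin zero_le in blast)+
  have "(\<lambda>m. \<integral>\<^sup>+x. ennreal ((norm (indicator {s<..} (fst x) *\<^sub>R HH x - indicator {s<..} (fst x) *\<^sub>R elem_process (L m) x))\<^sup>2) \<partial>time_prod t) \<longlonglongrightarrow> 0"
    by (rule L2_scale_tendsto[where C=1, OF _ _ _ HI]) (auto simp: indicator_def)
  then have lim2: "(\<lambda>m. \<integral>\<^sup>+x. ennreal ((norm (indicator {s<..} (fst x) *\<^sub>R H (fst x) (snd x) - elem_process (R m) x))\<^sup>2) \<partial>time_prod t) \<longlonglongrightarrow> 0"
    by (simp add: R_def elem_process_cut HH_def)
  show ?thesis using R lim1 lim2 by blast
qed

text \<open>A factor known at \<open>s\<close> times an elementary integrand on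
  \<open>(s, t]\<close> is again elementary, so every approximation has mean zero; the limit may be
  taken because \<open>Z\<close> is square integrable.\<close>

lemma ito_increment_mean:
  assumes I: "has_ito_integral M F B H t I" and J: "has_ito_integral M F B H s J" and st: "0 \<le> s" "s \<le> t"
    and Z: "known_bounded s Z"
  shows "(\<integral>\<omega>. Z \<omega> * (I \<omega> - J \<omega>) \<partial>M) = 0"
proof -
  obtain L where L: "\<And>m. elementary s t (L m)"
    and "(\<lambda>m. \<integral>\<^sup>+x. ennreal ((norm (indicator {s<..} (fst x) *\<^sub>R H (fst x) (snd x) - elem_process (L m) x))\<^sup>2) \<partial>time_prod t) \<longlonglongrightarrow> 0"
    and lim: "(\<lambda>m. \<integral>\<^sup>+\<omega>. ennreal ((norm (I \<omega> - J \<omega> - elem_integral (L m) \<omega>))\<^sup>2) \<partial>M) \<longlonglongrightarrow> 0"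
    using ito_increment_approx[OF I J st] by blast
  have [measurable]: "I \<in> borel_measurable M" "J \<in> borel_measurable M"
    using I J by (auto simp: has_ito_integral_def)
  note [measurable] = known_bounded_measurable_M[OF Z st(1)] elem_integral_measurable[OF L st(1)]
  have Z2: "integrable M (\<lambda>\<omega>. (norm (Z \<omega>))\<^sup>2)"
    using known_bounded_integrable[OF known_bounded_mult[OF Z Z] st(1)] by (simp add: power2_eq_square)
  have "(\<lambda>m. \<integral>\<omega>. Z \<omega> \<bullet> elem_integral (L m) \<omega> \<partial>M) \<longlonglongrightarrow> (\<integral>\<omega>. Z \<omega> \<bullet> (I \<omega> - J \<omega>) \<partial>M)"
    by (rule L2_inner_tendsto[OF _ _ _ _ Z2 elem_integral_sq_integrable[OF L st(1)] _ lim]) auto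
  moreover have "(\<integral>\<omega>. Z \<omega> \<bullet> elem_integral (L m) \<omega> \<partial>M) = 0" for m
    using has_bochner_integral_integral_eq[OF elem_integral_mean[OF elementary_scale[OF L Z st(1)] st(1)]]
    by (simp add: elem_integral_scale[abs_def])
  ultimately show ?thesis by (simp add: LIMSEQ_const_iff)
qed

text \<open>The weight \<open>Z\<close> is absorbed into the first integrand, which stays elementary
  after time \<open>s\<close>, and the isometry is passed to the limit. The bound on
  \<open>Z\<close> is asked for at every point because \<open>L2_scale_tendsto\<close> works
  pointwise.\<close>

lemma ito_increment_covariance:
  assumes I: "has_ito_integral M F B H t I" and J: "has_ito_integral M F B H s J"
    and I': "has_ito_integral M F B H' t I'" and J': "has_ito_integral M F B H' s J'"
    and st: "0 \<le> s" "s \<le> t"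
    and Z: "Z \<in> borel_measurable (F s)" and C: "\<And>\<omega>. \<omega> \<in> space M \<Longrightarrow> \<bar>Z \<omega>\<bar> \<le> C"
  shows "(\<integral>\<omega>. Z \<omega> * ((I \<omega> - J \<omega>) * (I' \<omega> - J' \<omega>)) \<partial>M)
    = (\<integral>x. indicator {s<..} (fst x) * (Z (snd x) * (H (fst x) (snd x) \<bullet> H' (fst x) (snd x))) \<partial>time_prod t)"
    and "integrable (time_prod t) (\<lambda>x. indicator {s<..} (fst x) * (Z (snd x) * (H (fst x) (snd x) \<bullet> H' (fst x) (snd x))))"
proof -
  have Zk: "known_bounded s Z"
    using Z C by (auto simp: known_bounded_def intro!: exI[of _ C] AE_I2)
  obtain L where L: "\<And>m. elementary s t (L m)"
    and limP: "(\<lambda>m. \<integral>\<^sup>+x. ennreal ((norm (indicator {s<..} (fst x) *\<^sub>R H (fst x) (snd x) - elem_process (L m) x))\<^sup>2) \<partial>time_prod t) \<longlonglongrightarrow> 0"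
    and limI: "(\<lambda>m. \<integral>\<^sup>+\<omega>. ennreal ((norm (I \<omega> - J \<omega> - elem_integral (L m) \<omega>))\<^sup>2) \<partial>M) \<longlonglongrightarrow> 0"
    using ito_increment_approx[OF I J st] by blast
  obtain K where K: "\<And>m. elementary s t (K m)"
    and lim'P: "(\<lambda>m. \<integral>\<^sup>+x. ennreal ((norm (indicator {s<..} (fst x) *\<^sub>R H' (fst x) (snd x) - elem_process (K m) x))\<^sup>2) \<partial>time_prod t) \<longlonglongrightarrow> 0"
    and lim'I: "(\<lambda>m. \<integral>\<^sup>+\<omega>. ennreal ((norm (I' \<omega> - J' \<omega> - elem_integral (K m) \<omega>))\<^sup>2) \<partial>M) \<longlonglongrightarrow> 0"
    using ito_increment_approx[OF I' J' st] by blast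
  have [measurable]: "I \<in> borel_measurable M" "J \<in> borel_measurable M" "I' \<in> borel_measurable M" "J' \<in> borel_measurable M"
    using I J I' J' by (auto simp: has_ito_integral_def)
  have "(\<lambda>(s, \<omega>). H s \<omega>) \<in> borel_measurable (time_prod t)" "(\<lambda>(s, \<omega>). H' s \<omega>) \<in> borel_measurable (time_prod t)"
    using I I' unfolding has_ito_integral_def ito_integrand_def measurable_time_prod_eq by blast+
  then have [measurable]: "(\<lambda>x. H (fst x) (snd x)) \<in> borel_measurable (time_prod t)"
    "(\<lambda>x. H' (fst x) (snd x)) \<in> borel_measurable (time_prod t)"
    by (simp_all add: case_prod_beta')
  have ms[measurable]: "(\<lambda>x. indicator {s<..} (fst x) :: real) \<in> borel_measurable (time_prod t)"
    by (intro measurable_time_prod_fst) auto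
  note ZL = elementary_scale[OF L Zk st(1)]
  note [measurable] = known_bounded_measurable_M[OF Zk st(1)] elem_integral_measurable[OF L st(1)]
    elem_integral_measurable[OF K st(1)] elem_process_measurable[OF L st(1), where T=t]
    elem_process_measurable[OF K st(1), where T=t]
    measurable_time_prod_snd[OF known_bounded_measurable_M[OF Zk st(1)], where t=t]
    elem_integral_measurable[OF ZL st(1)] elem_process_measurable[OF ZL st(1), where T=t]
  have sp: "snd x \<in> space M" if "x \<in> space (time_prod t)" for x
    using that by (auto simp: time_prod_def space_pair_measure)
  have l1: "(\<lambda>m. \<integral>\<^sup>+\<omega>. ennreal ((norm (Z \<omega> *\<^sub>R (I \<omega> - J \<omega>) - elem_integral (elem_scale Z (L m)) \<omega>))\<^sup>2) \<partial>M) \<longlonglongrightarrow> 0"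
    using L2_scale_tendsto[OF C _ _ limI] by (simp add: elem_integral_scale)
  have l2: "(\<lambda>m. \<integral>\<^sup>+x. ennreal ((norm (Z (snd x) *\<^sub>R (indicator {s<..} (fst x) *\<^sub>R H (fst x) (snd x)) - elem_process (elem_scale Z (L m)) x))\<^sup>2) \<partial>time_prod t) \<longlonglongrightarrow> 0"
    unfolding elem_process_scale
    by (rule L2_scale_tendsto[OF _ _ _ limP, where C=C]) (auto intro: C sp)
  note A = L2_inner_tendsto[OF _ _ _ _ elem_integral_sq_integrable[OF ZL st(1)] elem_integral_sq_integrable[OF K st(1)] l1 lim'I]
  note P = L2_inner_tendsto[OF _ _ _ _ elem_process_sq_integrable[OF ZL st(1)] elem_process_sq_integrable[OF K st(1)] l2 lim'P]
  have "(\<lambda>m. \<integral>\<omega>. elem_integral (elem_scale Z (L m)) \<omega> \<bullet> elem_integral (K m) \<omega> \<partial>M)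
      \<longlonglongrightarrow> (\<integral>\<omega>. (Z \<omega> *\<^sub>R (I \<omega> - J \<omega>)) \<bullet> (I' \<omega> - J' \<omega>) \<partial>M)"
    by (rule A) measurable
  moreover have "(\<lambda>m. \<integral>x. elem_process (elem_scale Z (L m)) x \<bullet> elem_process (K m) x \<partial>time_prod t)
      \<longlonglongrightarrow> (\<integral>x. (Z (snd x) *\<^sub>R (indicator {s<..} (fst x) *\<^sub>R H (fst x) (snd x))) \<bullet> (indicator {s<..} (fst x) *\<^sub>R H' (fst x) (snd x)) \<partial>time_prod t)"
    by (rule P) measurable
  moreover have "(\<integral>\<omega>. elem_integral (elem_scale Z (L m)) \<omega> \<bullet> elem_integral (K m) \<omega> \<partial>M)
    = (\<integral>x. elem_process (elem_scale Z (L m)) x \<bullet> elem_process (K m) x \<partial>time_prod t)" for m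
    using elementary_isometry[OF elementary_mono[OF ZL st(1) order_refl] elementary_mono[OF K st(1) order_refl]]
    by simp
  ultimately have "(\<integral>\<omega>. (Z \<omega> *\<^sub>R (I \<omega> - J \<omega>)) \<bullet> (I' \<omega> - J' \<omega>) \<partial>M)
    = (\<integral>x. (Z (snd x) *\<^sub>R (indicator {s<..} (fst x) *\<^sub>R H (fst x) (snd x))) \<bullet> (indicator {s<..} (fst x) *\<^sub>R H' (fst x) (snd x)) \<partial>time_prod t)"
    using LIMSEQ_unique by simp
  moreover have eq: "(Z (snd x) *\<^sub>R (indicator {s<..} (fst x) *\<^sub>R H (fst x) (snd x))) \<bullet> (indicator {s<..} (fst x) *\<^sub>R H' (fst x) (snd x))
      = indicator {s<..} (fst x) * (Z (snd x) * (H (fst x) (snd x) \<bullet> H' (fst x) (snd x)))" for x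
    by (auto simp: indicator_def)
  ultimately have "(\<integral>\<omega>. (Z \<omega> *\<^sub>R (I \<omega> - J \<omega>)) \<bullet> (I' \<omega> - J' \<omega>) \<partial>M)
    = (\<integral>x. indicator {s<..} (fst x) * (Z (snd x) * (H (fst x) (snd x) \<bullet> H' (fst x) (snd x))) \<partial>time_prod t)"
    unfolding eq by blast
  then show "(\<integral>\<omega>. Z \<omega> * ((I \<omega> - J \<omega>) * (I' \<omega> - J' \<omega>)) \<partial>M)
    = (\<integral>x. indicator {s<..} (fst x) * (Z (snd x) * (H (fst x) (snd x) \<bullet> H' (fst x) (snd x))) \<partial>time_prod t)"
    by (simp add: mult.assoc)
  show "integrable (time_prod t) (\<lambda>x. indicator {s<..} (fst x) * (Z (snd x) * (H (fst x) (snd x) \<bullet> H' (fst x) (snd x))))"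
    unfolding eq[symmetric]
    by (rule L2_inner_integrable[OF _ _ L2_limit_integrable[OF _ _ elem_process_sq_integrable[OF ZL st(1)] l2]
      L2_limit_integrable[OF _ _ elem_process_sq_integrable[OF K st(1)] lim'P]]) measurable
qed

end

section \<open>Increments of solutions\<close>

text \<open>Collects the path properties behind every limit taken below: on a compact set continuous
  observables are bounded, so dominated convergence runs with constant dominating functions.\<close>

definition (in prob_space) compact_process :: "'b set \<Rightarrow> (real \<Rightarrow> 'a \<Rightarrow> 'b::euclidean_space) \<Rightarrow> bool" where
  "compact_process S P \<longleftrightarrow> compact S \<and> (\<forall>t\<ge>0. P t \<in> borel_measurable M) \<and>
    (AE \<omega> in M. continuous_on {0..} (\<lambda>t. P t \<omega>)) \<and> (AE \<omega> in M. \<forall>t\<ge>0. P t \<omega> \<in> S)"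

lemma compact_continuous_bound:
  fixes g :: "'b::topological_space \<Rightarrow> real"
  assumes "compact S" "continuous_on S g"
  obtains K where "0 < K" "\<And>p. p \<in> S \<Longrightarrow> \<bar>g p\<bar> \<le> K"
proof -
  have "bounded (g ` S)" using compact_continuous_image[OF assms(2,1)] by (rule compact_imp_bounded)
  then obtain K where "\<And>p. p \<in> S \<Longrightarrow> \<bar>g p\<bar> \<le> K" by (auto simp: bounded_iff)
  then have "\<And>p. p \<in> S \<Longrightarrow> \<bar>g p\<bar> \<le> max K 1" by (meson max.coboundedI1)
  then show thesis by (intro that[of "max K 1"]) auto
qed

context prob_space begin

lemma compact_process_integrable:
  assumes P: "compact_process S P" and [measurable]: "g \<in> borel_measurable borel" and g: "continuous_on S g" and t: "0 \<le> t"
  shows "integrable M (\<lambda>\<omega>. g (P t \<omega>) :: real)"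
proof -
  obtain K where "0 < K" and K: "\<And>p. p \<in> S \<Longrightarrow> \<bar>g p\<bar> \<le> K"
    using compact_continuous_bound[of S g] P g by (auto simp: compact_process_def)
  have [measurable]: "P t \<in> borel_measurable M" using P t by (auto simp: compact_process_def)
  have "AE \<omega> in M. \<forall>t\<ge>0. P t \<omega> \<in> S" using P by (simp add: compact_process_def)
  then have "AE \<omega> in M. norm (g (P t \<omega>)) \<le> K"
    by eventually_elim (use t K in auto)
  then show ?thesis by (intro integrable_const_bound[of _ K]) auto
qed

text \<open>Uniform continuity of each path on \<open>[0, T]\<close> and dominated convergence. Both
  times move, so that a uniform modulus of continuity in L1 can be extracted by
  contradiction.\<close>

lemma compact_process_L1_tendsto:
  assumes P: "compact_process S P" and [measurable]: "g \<in> borel_measurable borel" and g: "continuous_on S g"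
    and rs: "\<And>m::nat. r m \<in> {0..T}" "\<And>m. s m \<in> {0..T}" "(\<lambda>m. r m - s m) \<longlonglongrightarrow> 0"
  shows "(\<lambda>m. \<integral>\<omega>. \<bar>g (P (r m) \<omega>) - g (P (s m) \<omega>)\<bar> \<partial>M) \<longlonglongrightarrow> (0::real)"
proof -
  obtain K where "0 < K" and K: "\<And>p. p \<in> S \<Longrightarrow> \<bar>g p\<bar> \<le> K"
    using compact_continuous_bound[of S g] P g by (auto simp: compact_process_def)
  have [measurable]: "P t \<in> borel_measurable M" if "0 \<le> t" for t using P that by (auto simp: compact_process_def)
  have rs0: "0 \<le> r m" "0 \<le> s m" for m using rs(1,2)[of m] by auto
  note [measurable] = \<open>\<And>t. 0 \<le> t \<Longrightarrow> P t \<in> borel_measurable M\<close>[OF rs0(1)] \<open>\<And>t. 0 \<le> t \<Longrightarrow> P t \<in> borel_measurable M\<close>[OF rs0(2)]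
  have AS: "AE \<omega> in M. \<forall>t\<ge>0. P t \<omega> \<in> S" and AC: "AE \<omega> in M. continuous_on {0..} (\<lambda>t. P t \<omega>)"
    using P by (auto simp: compact_process_def)
  have "(\<lambda>m. \<integral>\<omega>. \<bar>g (P (r m) \<omega>) - g (P (s m) \<omega>)\<bar> \<partial>M) \<longlonglongrightarrow> (\<integral>\<omega>. 0 \<partial>M)"
  proof (rule integral_dominated_convergence[where w="\<lambda>_. 2 * K"])
    show "AE \<omega> in M. (\<lambda>m. \<bar>g (P (r m) \<omega>) - g (P (s m) \<omega>)\<bar>) \<longlonglongrightarrow> 0"
      using AS AC
    proof eventually_elim
      case (elim \<omega>)
      have "continuous_on {0..T} (\<lambda>t. g (P t \<omega>))"
        by (rule continuous_on_compose2[OF g continuous_on_subset[OF elim(2)]]) (use elim(1) in auto)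
      then have u: "uniformly_continuous_on {0..T} (\<lambda>t. g (P t \<omega>))"
        by (rule compact_uniformly_continuous) simp
      have "(\<lambda>m. dist (r m) (s m)) \<longlonglongrightarrow> 0" using tendsto_rabs_zero[OF rs(3)] by (simp add: dist_real_def)
      then have "(\<lambda>m. dist (g (P (r m) \<omega>)) (g (P (s m) \<omega>))) \<longlonglongrightarrow> 0"
        using u rs(1,2) unfolding uniformly_continuous_on_sequentially by blast
      then show ?case by (simp add: dist_real_def)
    qed
    show "AE \<omega> in M. norm \<bar>g (P (r m) \<omega>) - g (P (s m) \<omega>)\<bar> \<le> 2 * K" for m
      using AS
    proof eventually_elim
      case (elim \<omega>)
      then have "\<bar>g (P (r m) \<omega>)\<bar> \<le> K" "\<bar>g (P (s m) \<omega>)\<bar> \<le> K" using rs0 K by auto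
      then show ?case by simp
    qed
  qed measurable
  then show ?thesis by simp
qed

lemma compact_process_L1_uniform:
  assumes P: "compact_process S P" and g: "g \<in> borel_measurable borel" "continuous_on S g" and e: "0 < (e::real)"
  shows "\<exists>d>0. \<forall>r\<in>{0..T}. \<forall>s\<in>{0..T}. \<bar>r - s\<bar> < d \<longrightarrow> (\<integral>\<omega>. \<bar>g (P r \<omega>) - g (P s \<omega>)\<bar> \<partial>M) < e"
proof (rule ccontr)
  assume no: "\<not> ?thesis"
  have "\<exists>q. fst q \<in> {0..T} \<and> snd q \<in> {0..T} \<and> \<bar>fst q - snd q\<bar> < inverse (real (Suc m)) \<and>
     \<not> (\<integral>\<omega>. \<bar>g (P (fst q) \<omega>) - g (P (snd q) \<omega>)\<bar> \<partial>M) < e" for m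
  proof -
    have "0 < inverse (real (Suc m))" by simp
    with no have "\<exists>r\<in>{0..T}. \<exists>s\<in>{0..T}. \<bar>r - s\<bar> < inverse (real (Suc m)) \<and> \<not> (\<integral>\<omega>. \<bar>g (P r \<omega>) - g (P s \<omega>)\<bar> \<partial>M) < e"
      by blast
    then show ?thesis unfolding split_paired_Ex fst_conv snd_conv by blast
  qed
  then have "\<exists>q. \<forall>m. fst (q m) \<in> {0..T} \<and> snd (q m) \<in> {0..T} \<and> \<bar>fst (q m) - snd (q m)\<bar> < inverse (real (Suc m)) \<and>
     \<not> (\<integral>\<omega>. \<bar>g (P (fst (q m)) \<omega>) - g (P (snd (q m)) \<omega>)\<bar> \<partial>M) < e"
    by (intro choice allI)
  then obtain q where q: "\<And>m. fst (q m) \<in> {0..T} \<and> snd (q m) \<in> {0..T} \<and> \<bar>fst (q m) - snd (q m)\<bar> < inverse (real (Suc m)) \<and>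
     \<not> (\<integral>\<omega>. \<bar>g (P (fst (q m)) \<omega>) - g (P (snd (q m)) \<omega>)\<bar> \<partial>M) < e" by blast
  define r where "r m = fst (q m)" for m
  define s where "s m = snd (q m)" for m
  have rs: "\<And>m. r m \<in> {0..T}" "\<And>m. s m \<in> {0..T}" "\<And>m. \<bar>r m - s m\<bar> < inverse (real (Suc m))"
     "\<And>m. \<not> (\<integral>\<omega>. \<bar>g (P (r m) \<omega>) - g (P (s m) \<omega>)\<bar> \<partial>M) < e"
    using q unfolding r_def s_def by blast+
  have "(\<lambda>m. r m - s m) \<longlonglongrightarrow> 0"
    by (rule Lim_null_comparison[OF _ LIMSEQ_inverse_real_of_nat]) (use rs(3) in \<open>auto intro!: always_eventually less_imp_le\<close>)
  from order_tendstoD(2)[OF compact_process_L1_tendsto[OF P g rs(1,2) this] e] show False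
    using rs(4) by (auto dest: eventually_happens)
qed

lemma compact_process_continuous:
  assumes P: "compact_process S P" and g: "g \<in> borel_measurable borel" "continuous_on S g"
    and Z[measurable]: "Z \<in> borel_measurable M" and C: "AE \<omega> in M. \<bar>Z \<omega>\<bar> \<le> C"
  shows "continuous_on {0..T} (\<lambda>r. \<integral>\<omega>. Z \<omega> * g (P r \<omega>) \<partial>M :: real)"
  unfolding continuous_on_iff
proof (intro ballI allI impI)
  fix s e :: real assume s: "s \<in> {0..T}" and e: "0 < e"
  define D where "D = max C 1"
  have D: "D > 0" by (simp add: D_def)
  have eD: "0 < e / D" using e D by simp
  obtain d where d: "0 < d" "\<And>r s. r \<in> {0..T} \<Longrightarrow> s \<in> {0..T} \<Longrightarrow> \<bar>r - s\<bar> < d \<Longrightarrow>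
    (\<integral>\<omega>. \<bar>g (P r \<omega>) - g (P s \<omega>)\<bar> \<partial>M) < e / D"
    using compact_process_L1_uniform[OF P g eD, of T] by blast
  have i: "integrable M (\<lambda>\<omega>. g (P t \<omega>))" if "t \<in> {0..T}" for t
    using that by (intro compact_process_integrable[OF P g]) auto
  have iZ: "integrable M (\<lambda>\<omega>. Z \<omega> * g (P t \<omega>))" if "t \<in> {0..T}" for t
  proof (rule Bochner_Integration.integrable_bound[OF integrable_mult_right[OF i[OF that], of D]])
    show "(\<lambda>\<omega>. Z \<omega> * g (P t \<omega>)) \<in> borel_measurable M"
      using borel_measurable_integrable[OF i[OF that]] by measurable
    show "AE \<omega> in M. norm (Z \<omega> * g (P t \<omega>)) \<le> norm (D * g (P t \<omega>))"
      using C by eventually_elim (auto simp: abs_mult D_def intro!: mult_right_mono)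
  qed
  show "\<exists>d>0. \<forall>r\<in>{0..T}. dist r s < d \<longrightarrow> dist (\<integral>\<omega>. Z \<omega> * g (P r \<omega>) \<partial>M) (\<integral>\<omega>. Z \<omega> * g (P s \<omega>) \<partial>M) < e"
  proof (intro exI[of _ d] conjI d ballI impI)
    fix r assume r: "r \<in> {0..T}" and rd: "dist r s < d"
    have "dist (\<integral>\<omega>. Z \<omega> * g (P r \<omega>) \<partial>M) (\<integral>\<omega>. Z \<omega> * g (P s \<omega>) \<partial>M)
      = \<bar>\<integral>\<omega>. Z \<omega> * g (P r \<omega>) - Z \<omega> * g (P s \<omega>) \<partial>M\<bar>"
      using iZ[OF r] iZ[OF s] by (simp add: dist_real_def)
    also have "\<dots> \<le> (\<integral>\<omega>. \<bar>Z \<omega> * g (P r \<omega>) - Z \<omega> * g (P s \<omega>)\<bar> \<partial>M)"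
      by (rule integral_abs_bound)
    also have "\<dots> \<le> (\<integral>\<omega>. D * \<bar>g (P r \<omega>) - g (P s \<omega>)\<bar> \<partial>M)"
    proof (rule integral_mono_AE)
      show "AE \<omega> in M. \<bar>Z \<omega> * g (P r \<omega>) - Z \<omega> * g (P s \<omega>)\<bar> \<le> D * \<bar>g (P r \<omega>) - g (P s \<omega>)\<bar>"
        using C
      proof eventually_elim
        case (elim \<omega>)
        have "\<bar>Z \<omega> * g (P r \<omega>) - Z \<omega> * g (P s \<omega>)\<bar> = \<bar>Z \<omega>\<bar> * \<bar>g (P r \<omega>) - g (P s \<omega>)\<bar>"
          by (simp add: abs_mult[symmetric] right_diff_distrib)
        also have "\<dots> \<le> D * \<bar>g (P r \<omega>) - g (P s \<omega>)\<bar>"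
          using elim by (intro mult_right_mono) (auto simp: D_def)
        finally show ?case .
      qed
    qed (use iZ[OF r] iZ[OF s] i[OF r] i[OF s] in auto)
    also have "\<dots> = D * (\<integral>\<omega>. \<bar>g (P r \<omega>) - g (P s \<omega>)\<bar> \<partial>M)" by simp
    also have "\<dots> < D * (e / D)"
      using d(2)[OF r s] rd D by (intro mult_strict_left_mono) (auto simp: dist_real_def)
    also have "\<dots> = e" using D by simp
    finally show "dist (\<integral>\<omega>. Z \<omega> * g (P r \<omega>) \<partial>M) (\<integral>\<omega>. Z \<omega> * g (P s \<omega>) \<partial>M) < e" .
  qed
qed

end

context brownian_motion begin

lemma sde_adapted: "sde_solution M F B D a u x X \<Longrightarrow> 0 \<le> t \<Longrightarrow> X t \<in> borel_measurable (F t)"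
  by (simp add: sde_solution_def)

lemma sde_measurable: "sde_solution M F B D a u x X \<Longrightarrow> 0 \<le> t \<Longrightarrow> X t \<in> borel_measurable M"
  by (rule measurable_F_M[OF sde_adapted])

lemma sde_compact_process_pair:
  assumes X: "sde_solution M F B D a u x X" and Y: "sde_solution M F B D a v y Y" and D: "compact D"
  shows "compact_process (D \<times> D) (\<lambda>t \<omega>. (X t \<omega>, Y t \<omega>))"
  unfolding compact_process_def
proof (intro conjI allI impI)
  fix t :: real assume t: "0 \<le> t"
  note [measurable] = sde_measurable[OF X t] sde_measurable[OF Y t]
  show "(\<lambda>\<omega>. (X t \<omega>, Y t \<omega>)) \<in> borel_measurable M" by measurable
next
  show "compact (D \<times> D)" by (intro compact_Times D)
  have "AE \<omega> in M. continuous_on {0..} (\<lambda>t. X t \<omega>)" "AE \<omega> in M. continuous_on {0..} (\<lambda>t. Y t \<omega>)"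
    using X Y by (auto simp: sde_solution_def)
  then show "AE \<omega> in M. continuous_on {0..} (\<lambda>t. (X t \<omega>, Y t \<omega>))"
    by eventually_elim (rule continuous_on_Pair)
  have "AE \<omega> in M. \<forall>t\<ge>0. X t \<omega> \<in> D" "AE \<omega> in M. \<forall>t\<ge>0. Y t \<omega> \<in> D"
    using X Y by (auto simp: sde_solution_def)
  then show "AE \<omega> in M. \<forall>t\<ge>0. (X t \<omega>, Y t \<omega>) \<in> D \<times> D"
    by eventually_elim auto
qed

lemma sde_increment_mean:
  assumes X: "sde_solution M F B D a u x X" and st: "0 \<le> s" "s \<le> t" and Z: "known_bounded s Z"
  shows "(\<integral>\<omega>. Z \<omega> * (X t \<omega> - X s \<omega>) \<partial>M) = 0"
proof -
  have "has_ito_integral M F B (\<lambda>s \<omega>. a (X s \<omega>) *\<^sub>R u) t (\<lambda>\<omega>. X t \<omega> - X 0 \<omega>)"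
    "has_ito_integral M F B (\<lambda>s \<omega>. a (X s \<omega>) *\<^sub>R u) s (\<lambda>\<omega>. X s \<omega> - X 0 \<omega>)"
    using X st by (auto simp: sde_solution_def)
  from ito_increment_mean[OF this st Z] show ?thesis by simp
qed

text \<open>The isometry yields an integral over \<open>time_prod t\<close>. Fubini turns it into a
  time integral of an expectation, and since that expectation is continuous in time the result is an
  ordinary integral over \<open>[s, t]\<close>.\<close>

lemma sde_increment_covariance:
  assumes X: "sde_solution M F B D a u x X" and Y: "sde_solution M F B D a v y Y"
    and D: "compact D" and a[measurable]: "a \<in> borel_measurable borel" and ac: "continuous_on D a"
    and st: "0 \<le> s" "s \<le> t" and Z: "known_bounded s Z"
  shows "(\<integral>\<omega>. Z \<omega> * ((X t \<omega> - X s \<omega>) * (Y t \<omega> - Y s \<omega>)) \<partial>M)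
    = (u \<bullet> v) * integral {s..t} (\<lambda>r. \<integral>\<omega>. Z \<omega> * (a (X r \<omega>) * a (Y r \<omega>)) \<partial>M)"
proof -
  obtain C where C: "AE \<omega> in M. norm (Z \<omega>) \<le> C" "0 < C" by (rule known_bounded_AE_bound[OF Z])
  \<comment> \<open>Clamping changes \<open>Z\<close> only on a null set and supplies the everywhere
    bound that \<open>ito_increment_covariance\<close> asks for.\<close>
  define Z' where "Z' \<omega> = max (- C) (min C (Z \<omega>))" for \<omega>
  have Z'm: "Z' \<in> borel_measurable (F s)"
    unfolding Z'_def[abs_def] using known_bounded_measurable[OF Z] by measurable
  have Z'M[measurable]: "Z' \<in> borel_measurable M" by (rule measurable_F_M[OF Z'm st(1)])
  have ZM[measurable]: "Z \<in> borel_measurable M" by (rule known_bounded_measurable_M[OF Z st(1)])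
  have Z'C: "\<bar>Z' \<omega>\<bar> \<le> C" for \<omega> using C(2) by (auto simp: Z'_def)
  have eqAE: "AE \<omega> in M. Z \<omega> = Z' \<omega>"
    using C(1) by eventually_elim (auto simp: Z'_def)
  have t: "0 \<le> t" using st by simp
  have IX: "has_ito_integral M F B (\<lambda>s \<omega>. a (X s \<omega>) *\<^sub>R u) t (\<lambda>\<omega>. X t \<omega> - X 0 \<omega>)"
    "has_ito_integral M F B (\<lambda>s \<omega>. a (X s \<omega>) *\<^sub>R u) s (\<lambda>\<omega>. X s \<omega> - X 0 \<omega>)"
    and IY: "has_ito_integral M F B (\<lambda>s \<omega>. a (Y s \<omega>) *\<^sub>R v) t (\<lambda>\<omega>. Y t \<omega> - Y 0 \<omega>)"
    "has_ito_integral M F B (\<lambda>s \<omega>. a (Y s \<omega>) *\<^sub>R v) s (\<lambda>\<omega>. Y s \<omega> - Y 0 \<omega>)"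
    using X Y st t by (auto simp: sde_solution_def)
  note cov = ito_increment_covariance[OF IX IY st Z'm Z'C]
  interpret P: pair_sigma_finite "restrict_space lborel {0..t}" M by (rule pair_sigma_finite_time)
  define e where "e r = (\<integral>\<omega>. Z' \<omega> * (a (X r \<omega>) * a (Y r \<omega>)) \<partial>M)" for r
  have "continuous_on {0..t} (\<lambda>r. \<integral>\<omega>. Z' \<omega> * (case (X r \<omega>, Y r \<omega>) of (x, y) \<Rightarrow> a x * a y) \<partial>M)"
  proof (rule compact_process_continuous[OF sde_compact_process_pair[OF X Y D]])
    show "(\<lambda>(x, y). a x * a y) \<in> borel_measurable borel"
      by (simp add: borel_prod[symmetric])
    show "continuous_on (D \<times> D) (\<lambda>(x, y). a x * a y)"
      unfolding case_prod_beta
      by (intro continuous_intros continuous_on_compose2[OF ac]) auto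
    show "AE \<omega> in M. \<bar>Z' \<omega>\<bar> \<le> C" using Z'C by simp
  qed measurable
  then have ec: "continuous_on {0..t} e" by (simp add: e_def[abs_def])
  have "(\<integral>x. indicator {s<..} (fst x) * (Z' (snd x) * ((a (X (fst x) (snd x)) *\<^sub>R u) \<bullet> (a (Y (fst x) (snd x)) *\<^sub>R v))) \<partial>time_prod t)
    = (\<integral>r. (\<integral>\<omega>. indicator {s<..} r * (Z' \<omega> * ((a (X r \<omega>) *\<^sub>R u) \<bullet> (a (Y r \<omega>) *\<^sub>R v))) \<partial>M) \<partial>restrict_space lborel {0..t})"
    using P.integral_fst'[OF cov(2)[unfolded time_prod_def]] by (simp add: time_prod_def)
  also have "\<dots> = (\<integral>r. indicator {s<..} r * ((u \<bullet> v) * e r) \<partial>restrict_space lborel {0..t})"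
    unfolding e_def by (simp add: ac_simps flip: integral_mult_right_zero)
  also have "\<dots> = (\<integral>r. indicator {0..t} r *\<^sub>R (indicator {s<..} r * ((u \<bullet> v) * e r)) \<partial>lborel)"
    by (subst integral_restrict_space) auto
  also have "\<dots> = (\<integral>r. (u \<bullet> v) * (indicator {s..t} r *\<^sub>R e r) \<partial>lborel)"
  proof (rule integral_cong_AE)
    \<comment> \<open>The function \<open>e\<close> is known to be continuous, and hence measurable,
      only on \<open>[0, t]\<close>; measurability on the whole line has to go through the
      indicator.\<close>
    have em: "(\<lambda>r. indicator {0..t} r *\<^sub>R e r) \<in> borel_measurable lborel"
      using borel_measurable_continuous_on_indicator[OF _ ec] by simp
    have eq1: "indicator {0..t} r *\<^sub>R (indicator {s<..} r * ((u \<bullet> v) * e r)) = indicator {s<..} r * ((u \<bullet> v) * (indicator {0..t} r *\<^sub>R e r))" for r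
      by simp
    show "(\<lambda>r. indicator {0..t} r *\<^sub>R (indicator {s<..} r * ((u \<bullet> v) * e r))) \<in> borel_measurable lborel"
      unfolding eq1 using em by measurable
    have eq2: "(u \<bullet> v) * (indicator {s..t} r *\<^sub>R e r) = (u \<bullet> v) * (indicator {s..t} r * (indicator {0..t} r *\<^sub>R e r))" for r
      using st by (auto simp: indicator_def)
    show "(\<lambda>r. (u \<bullet> v) * (indicator {s..t} r *\<^sub>R e r)) \<in> borel_measurable lborel"
      unfolding eq2 using em by measurable
    show "AE r in lborel. indicator {0..t} r *\<^sub>R (indicator {s<..} r * ((u \<bullet> v) * e r)) = (u \<bullet> v) * (indicator {s..t} r *\<^sub>R e r)"
      using AE_lborel_singleton[of s] by eventually_elim (use st in \<open>auto simp: indicator_def\<close>)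
  qed
  also have "\<dots> = (u \<bullet> v) * (LINT r:{s..t}|lborel. e r)"
    by (simp add: set_lebesgue_integral_def)
  also have "(LINT r:{s..t}|lborel. e r) = integral {s..t} e"
    by (intro set_borel_integral_eq_integral borel_integrable_atLeastAtMost' continuous_on_subset[OF ec]) (use st in auto)
  also have "integral {s..t} e = integral {s..t} (\<lambda>r. \<integral>\<omega>. Z \<omega> * (a (X r \<omega>) * a (Y r \<omega>)) \<partial>M)"
  proof (rule integral_cong)
    fix r assume "r \<in> {s..t}"
    then have r: "0 \<le> r" using st by simp
    note [measurable] = sde_measurable[OF X r] sde_measurable[OF Y r]
    show "e r = (\<integral>\<omega>. Z \<omega> * (a (X r \<omega>) * a (Y r \<omega>)) \<partial>M)"
      unfolding e_def by (rule integral_cong_AE) (use eqAE in auto)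
  qed
  finally have "(\<integral>\<omega>. Z' \<omega> * ((X t \<omega> - X s \<omega>) * (Y t \<omega> - Y s \<omega>)) \<partial>M)
    = (u \<bullet> v) * integral {s..t} (\<lambda>r. \<integral>\<omega>. Z \<omega> * (a (X r \<omega>) * a (Y r \<omega>)) \<partial>M)"
    using cov(1) by simp
  moreover have "(\<integral>\<omega>. Z' \<omega> * ((X t \<omega> - X s \<omega>) * (Y t \<omega> - Y s \<omega>)) \<partial>M) = (\<integral>\<omega>. Z \<omega> * ((X t \<omega> - X s \<omega>) * (Y t \<omega> - Y s \<omega>)) \<partial>M)"
  proof (rule integral_cong_AE)
    note [measurable] = sde_measurable[OF X t] sde_measurable[OF Y t] sde_measurable[OF X st(1)] sde_measurable[OF Y st(1)]
    show "(\<lambda>\<omega>. Z' \<omega> * ((X t \<omega> - X s \<omega>) * (Y t \<omega> - Y s \<omega>))) \<in> borel_measurable M" by measurable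
    show "(\<lambda>\<omega>. Z \<omega> * ((X t \<omega> - X s \<omega>) * (Y t \<omega> - Y s \<omega>))) \<in> borel_measurable M" by measurable
    show "AE \<omega> in M. Z' \<omega> * ((X t \<omega> - X s \<omega>) * (Y t \<omega> - Y s \<omega>)) = Z \<omega> * ((X t \<omega> - X s \<omega>) * (Y t \<omega> - Y s \<omega>))"
      using eqAE by eventually_elim simp
  qed
  ultimately show ?thesis by simp
qed

end

section \<open>Quadratic and cubic variation\<close>

context filtered_prob_space begin

lemma known_bounded_add:
  assumes "known_bounded t \<eta>" "known_bounded t \<theta>"
  shows "known_bounded t (\<lambda>\<omega>. \<eta> \<omega> + \<theta> \<omega>)"
proof -
  obtain C D where C: "AE \<omega> in M. norm (\<eta> \<omega>) \<le> C" and D: "AE \<omega> in M. norm (\<theta> \<omega>) \<le> D"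
    using assms unfolding known_bounded_def by blast
  have "AE \<omega> in M. norm (\<eta> \<omega> + \<theta> \<omega>) \<le> C + D"
    using C D by eventually_elim (rule norm_triangle_mono)
  then show ?thesis using assms by (auto simp: known_bounded_def)
qed

lemma known_bounded_uminus: "known_bounded t \<eta> \<Longrightarrow> known_bounded t (\<lambda>\<omega>. - \<eta> \<omega>)"
  by (auto simp: known_bounded_def)

lemma known_bounded_diff:
  "known_bounded t \<eta> \<Longrightarrow> known_bounded t \<theta> \<Longrightarrow> known_bounded t (\<lambda>\<omega>. \<eta> \<omega> - \<theta> \<omega>)"
  using known_bounded_add[OF _ known_bounded_uminus, of t \<eta> \<theta>] by simp

lemma known_bounded_power:
  fixes \<eta> :: "'a \<Rightarrow> real"
  shows "known_bounded t \<eta> \<Longrightarrow> known_bounded t (\<lambda>\<omega>. \<eta> \<omega> ^ n)"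
  by (induction n) (auto intro: known_bounded_const known_bounded_mult)

lemma known_bounded_abs:
  fixes \<eta> :: "'a \<Rightarrow> real"
  shows "known_bounded t \<eta> \<Longrightarrow> known_bounded t (\<lambda>\<omega>. \<bar>\<eta> \<omega>\<bar>)"
  by (auto simp: known_bounded_def)

lemma known_bounded_sum:
  "(\<And>i. i \<in> A \<Longrightarrow> known_bounded t (\<eta> i)) \<Longrightarrow> known_bounded t (\<lambda>\<omega>. \<Sum>i\<in>A. \<eta> i \<omega>)"
  by (induction A rule: infinite_finite_induct) (auto intro: known_bounded_const known_bounded_add)

end

context brownian_motion begin

lemma sde_known_bounded:
  assumes X: "sde_solution M F B {-1..1} a u x X" and "0 \<le> s" "s \<le> t"
  shows "known_bounded t (X s)"
proof -
  have "AE \<omega> in M. \<forall>t\<ge>0. X t \<omega> \<in> {-1..1}" using X by (simp add: sde_solution_def)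
  then have "AE \<omega> in M. norm (X s \<omega>) \<le> 1" by eventually_elim (use assms in auto)
  then show ?thesis
    using measurable_F_mono[OF sde_adapted[OF X assms(2)] assms(2,3)] by (auto simp: known_bounded_def)
qed

text \<open>The integrands differ by \<open>Z * (- 2 * X s) * (X t - X s)\<close>, whose mean is 0
  because the first two factors are known at time \<open>s\<close>.\<close>

lemma sde_increment_square:
  assumes X: "sde_solution M F B {-1..1} a u x X" and st: "0 \<le> s" "s \<le> t" and Z: "known_bounded s Z"
  shows "(\<integral>\<omega>. Z \<omega> * (X t \<omega> - X s \<omega>)\<^sup>2 \<partial>M) = (\<integral>\<omega>. Z \<omega> * ((X t \<omega>)\<^sup>2 - (X s \<omega>)\<^sup>2) \<partial>M)"
proof -
  have t: "0 \<le> t" using st by simp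
  note kX = sde_known_bounded[OF X st] sde_known_bounded[OF X t order_refl] known_bounded_mono[OF Z st]
  note Xs = sde_known_bounded[OF X st(1) order_refl]
  have 0: "(\<integral>\<omega>. (Z \<omega> * (- 2 * X s \<omega>)) * (X t \<omega> - X s \<omega>) \<partial>M) = 0"
    by (rule sde_increment_mean[OF X st]) (intro known_bounded_mult Z Xs known_bounded_const)
  have i1: "integrable M (\<lambda>\<omega>. Z \<omega> * ((X t \<omega>)\<^sup>2 - (X s \<omega>)\<^sup>2))"
    by (rule known_bounded_integrable[OF _ t]) (intro known_bounded_mult known_bounded_diff known_bounded_power kX)
  have i2: "integrable M (\<lambda>\<omega>. (Z \<omega> * (- 2 * X s \<omega>)) * (X t \<omega> - X s \<omega>))"
    by (rule known_bounded_integrable[OF _ t]) (intro known_bounded_mult known_bounded_diff known_bounded_power kX known_bounded_const)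
  have eq: "Z \<omega> * (X t \<omega> - X s \<omega>)\<^sup>2 = Z \<omega> * ((X t \<omega>)\<^sup>2 - (X s \<omega>)\<^sup>2) + (Z \<omega> * (- 2 * X s \<omega>)) * (X t \<omega> - X s \<omega>)" for \<omega>
    by (simp add: power2_eq_square algebra_simps)
  show ?thesis
    unfolding eq by (subst Bochner_Integration.integral_add[OF i1 i2]) (simp only: 0 add_0_right)
qed

text \<open>Idea: \<open>Q\<^sup>2 + 2 Q (1 - X\<^sup>2) - 6 X\<^sup>2\<close> is a supermartingale, where \<open>Q\<close> is the discrete quadratic variation.\<close>

lemma quadratic_variation_L2:
  assumes X: "sde_solution M F B {-1..1} a u x X" and t0: "0 \<le> t 0" and t: "\<And>k. t k \<le> t (Suc k)"
  shows "(\<integral>\<omega>. (\<Sum>k<n. (X (t (Suc k)) \<omega> - X (t k) \<omega>)\<^sup>2)\<^sup>2 \<partial>M) \<le> 6"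
proof -
  define Q where "Q n \<omega> = (\<Sum>k<n. (X (t (Suc k)) \<omega> - X (t k) \<omega>)\<^sup>2)" for n \<omega>
  have mono: "t i \<le> t j" if "i \<le> j" for i j using lift_Suc_mono_le[of t, OF t that] .
  have nn: "0 \<le> t k" for k using mono[of 0 k] t0 by simp
  have kX: "known_bounded (t j) (X (t i))" if "i \<le> j" for i j
    by (rule sde_known_bounded[OF X nn mono[OF that]])
  have kQ: "known_bounded (t j) (Q n)" if "n \<le> j" for n j
    unfolding Q_def[abs_def] using that
    by (intro known_bounded_sum known_bounded_power known_bounded_diff kX) auto
  have "AE \<omega> in M. \<forall>t\<ge>0. X t \<omega> \<in> {-1..1}" using X by (simp add: sde_solution_def)
  then have AX: "AE \<omega> in M. \<forall>k. \<bar>X (t k) \<omega>\<bar> \<le> 1"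
    by eventually_elim (use nn in \<open>auto simp: abs_le_iff minus_le_iff\<close>)
  note I = known_bounded_integrable[OF _ nn]
  have main: "(\<integral>\<omega>. (Q n \<omega>)\<^sup>2 + 2 * Q n \<omega> * (1 - (X (t n) \<omega>)\<^sup>2) \<partial>M) \<le> 6 * (\<integral>\<omega>. (X (t n) \<omega>)\<^sup>2 \<partial>M)" for n
  proof (induction n)
    case 0
    then show ?case by (simp add: Q_def)
  next
    case (Suc n)
    define d where "d \<omega> = X (t (Suc n)) \<omega> - X (t n) \<omega>" for \<omega>
    have kd: "known_bounded (t (Suc n)) d"
      unfolding d_def[abs_def] by (intro known_bounded_diff kX) auto
    have QS: "Q (Suc n) \<omega> = Q n \<omega> + (d \<omega>)\<^sup>2" for \<omega> by (simp add: Q_def d_def)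
    let ?A = "\<lambda>\<omega>. (Q n \<omega>)\<^sup>2 + 2 * Q n \<omega> * (1 - (X (t n) \<omega>)\<^sup>2)"
    let ?B = "\<lambda>\<omega>. (2 * Q n \<omega>) * (d \<omega>)\<^sup>2"
    let ?C = "\<lambda>\<omega>. (2 * Q n \<omega>) * ((X (t (Suc n)) \<omega>)\<^sup>2 - (X (t n) \<omega>)\<^sup>2)"
    let ?D = "\<lambda>\<omega>. (d \<omega>)^4 + 2 * (d \<omega>)\<^sup>2 * (1 - (X (t (Suc n)) \<omega>)\<^sup>2)"
    note kb = known_bounded_add known_bounded_diff known_bounded_mult known_bounded_power known_bounded_const kd
      kX[of n "Suc n"] kX[of "Suc n" "Suc n"] kQ[of n "Suc n"]
    have iA: "integrable M ?A" by (rule I[of "Suc n"], intro kb) auto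
    have iB: "integrable M ?B" by (rule I[of "Suc n"], intro kb) auto
    have iC: "integrable M ?C" by (rule I[of "Suc n"], intro kb) auto
    have iD: "integrable M ?D" by (rule I[of "Suc n"], intro kb) auto
    have id: "integrable M (\<lambda>\<omega>. 6 * (d \<omega>)\<^sup>2)" by (rule I[of "Suc n"], intro kb)
    have ix: "integrable M (\<lambda>\<omega>. (X (t k) \<omega>)\<^sup>2)" if "k \<le> Suc n" for k
      by (rule I[of "Suc n"], intro known_bounded_power kX that)
    have "(\<integral>\<omega>. (Q (Suc n) \<omega>)\<^sup>2 + 2 * Q (Suc n) \<omega> * (1 - (X (t (Suc n)) \<omega>)\<^sup>2) \<partial>M)
      = (\<integral>\<omega>. ?A \<omega> + ?B \<omega> - ?C \<omega> + ?D \<omega> \<partial>M)"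
      unfolding QS by (intro Bochner_Integration.integral_cong) (auto simp: power2_eq_square power4_eq_xxxx algebra_simps)
    also have "\<dots> = (\<integral>\<omega>. ?A \<omega> \<partial>M) + (\<integral>\<omega>. ?B \<omega> \<partial>M) - (\<integral>\<omega>. ?C \<omega> \<partial>M) + (\<integral>\<omega>. ?D \<omega> \<partial>M)"
      using iA iB iC iD by simp
    \<comment> \<open>The growth of \<open>Q n\<close> against \<open>d\<close> is exactly
      compensated by the decrease of \<open>1 - X\<^sup>2\<close>, by the martingale identity for
      squares.\<close>
    also have "(\<integral>\<omega>. ?B \<omega> \<partial>M) = (\<integral>\<omega>. ?C \<omega> \<partial>M)"
      unfolding d_def by (rule sde_increment_square[OF X nn t]) (intro known_bounded_mult known_bounded_const kQ order_refl)
    \<comment> \<open>Origin of the 6: increments are at most 2, so \<open>d^4\<close> is at most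
      \<open>4 d^2\<close>, and the second summand contributes at most \<open>2 d^2\<close>.\<close>
    also have "(\<integral>\<omega>. ?D \<omega> \<partial>M) \<le> (\<integral>\<omega>. 6 * (d \<omega>)\<^sup>2 \<partial>M)"
    proof (rule integral_mono_AE[OF iD id])
      show "AE \<omega> in M. ?D \<omega> \<le> 6 * (d \<omega>)\<^sup>2"
        using AX
      proof eventually_elim
        case (elim \<omega>)
        have "\<bar>d \<omega>\<bar> \<le> 2" using elim[rule_format, of n] elim[rule_format, of "Suc n"] by (simp add: d_def)
        then have "\<bar>d \<omega>\<bar>\<^sup>2 \<le> 2\<^sup>2" by (intro power_mono) auto
        then have "(d \<omega>)\<^sup>2 * (d \<omega>)\<^sup>2 \<le> 4 * (d \<omega>)\<^sup>2" by (intro mult_right_mono) auto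
        moreover have "(d \<omega>)\<^sup>2 * (1 - (X (t (Suc n)) \<omega>)\<^sup>2) \<le> (d \<omega>)\<^sup>2 * 1"
          by (intro mult_left_mono) auto
        ultimately show ?case by (simp add: power4_eq_xxxx power2_eq_square mult.assoc)
      qed
    qed
    also have "(\<integral>\<omega>. 6 * (d \<omega>)\<^sup>2 \<partial>M) = 6 * (\<integral>\<omega>. 1 * (d \<omega>)\<^sup>2 \<partial>M)" by simp
    also have "(\<integral>\<omega>. 1 * (d \<omega>)\<^sup>2 \<partial>M) = (\<integral>\<omega>. 1 * ((X (t (Suc n)) \<omega>)\<^sup>2 - (X (t n) \<omega>)\<^sup>2) \<partial>M)"
      unfolding d_def by (rule sde_increment_square[OF X nn t known_bounded_const])
    also have "\<dots> = (\<integral>\<omega>. (X (t (Suc n)) \<omega>)\<^sup>2 \<partial>M) - (\<integral>\<omega>. (X (t n) \<omega>)\<^sup>2 \<partial>M)"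
      using ix[of n] ix[of "Suc n"] by simp
    finally show ?case using Suc.IH by simp
  qed
  have "(\<integral>\<omega>. (Q n \<omega>)\<^sup>2 \<partial>M) \<le> (\<integral>\<omega>. (Q n \<omega>)\<^sup>2 + 2 * Q n \<omega> * (1 - (X (t n) \<omega>)\<^sup>2) \<partial>M)"
  proof (rule integral_mono_AE)
    show "integrable M (\<lambda>\<omega>. (Q n \<omega>)\<^sup>2)" by (rule I[of n], intro known_bounded_power kQ order_refl)
    show "integrable M (\<lambda>\<omega>. (Q n \<omega>)\<^sup>2 + 2 * Q n \<omega> * (1 - (X (t n) \<omega>)\<^sup>2))"
      by (rule I[of n], intro known_bounded_power kQ known_bounded_add known_bounded_mult known_bounded_diff known_bounded_const kX order_refl)
    show "AE \<omega> in M. (Q n \<omega>)\<^sup>2 \<le> (Q n \<omega>)\<^sup>2 + 2 * Q n \<omega> * (1 - (X (t n) \<omega>)\<^sup>2)"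
      using AX
    proof eventually_elim
      case (elim \<omega>)
      have "0 \<le> Q n \<omega>" by (auto simp: Q_def intro: sum_nonneg)
      moreover have "(X (t n) \<omega>)\<^sup>2 \<le> 1" using elim by (simp add: abs_square_le_1)
      ultimately show ?case by simp
    qed
  qed
  also note main
  also have "6 * (\<integral>\<omega>. (X (t n) \<omega>)\<^sup>2 \<partial>M) \<le> 6 * (\<integral>\<omega>. 1 \<partial>M)"
  proof (intro mult_left_mono integral_mono_AE)
    show "integrable M (\<lambda>\<omega>. (X (t n) \<omega>)\<^sup>2)" by (rule I[of n], intro known_bounded_power kX order_refl)
    show "AE \<omega> in M. (X (t n) \<omega>)\<^sup>2 \<le> 1" using AX by eventually_elim (simp add: abs_square_le_1)
  qed auto
  finally show ?thesis by (simp add: Q_def prob_space)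
qed

text \<open>With \<open>V\<close> the largest increment and \<open>Q\<close> the quadratic
  variation, the cubic sum is at most \<open>V Q\<close>, hence at most
  \<open>\<delta> Q^2 + V^2 / \<delta>\<close>. The mean of \<open>Q^2\<close> is at most 6 and the
  mean of \<open>V^2\<close> tends to 0 by continuity of the paths.\<close>

lemma cubic_variation_tendsto_0:
  assumes X: "sde_solution M F B {-1..1} a u x X" and T: "0 \<le> T"
  shows "(\<lambda>m. \<Sum>k<Suc m. \<integral>\<omega>. \<bar>X (T * real (Suc k) / real (Suc m)) \<omega> - X (T * real k / real (Suc m)) \<omega>\<bar>^3 \<partial>M) \<longlonglongrightarrow> 0"
proof -
  define t where "t m k = T * real k / real (Suc m)" for m k
  define d where "d m k \<omega> = X (t m (Suc k)) \<omega> - X (t m k) \<omega>" for m k \<omega>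
  define Q where "Q m \<omega> = (\<Sum>k<Suc m. (d m k \<omega>)\<^sup>2)" for m \<omega>
  define V where "V m \<omega> = Max ((\<lambda>k. \<bar>d m k \<omega>\<bar>) ` {..<Suc m})" for m \<omega>
  have tn: "0 \<le> t m k" for m k using T by (simp add: t_def)
  have tm: "t m k \<le> t m (Suc k)" for m k using T by (simp add: t_def divide_right_mono mult_left_mono)
  have tT: "t m k \<le> T" if "k \<le> Suc m" for m k
  proof -
    have "T * real k \<le> T * real (Suc m)" using that T by (intro mult_left_mono) auto
    then show ?thesis by (simp add: t_def divide_le_eq)
  qed
  have dt: "t m (Suc k) - t m k = T / real (Suc m)" for m k
    by (simp add: t_def diff_divide_distrib[symmetric] right_diff_distrib[symmetric])
  have kd: "known_bounded T (d m k)" if "k < Suc m" for m k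
    unfolding d_def[abs_def] using that by (intro known_bounded_diff sde_known_bounded[OF X] tn tT) auto
  have kQ: "known_bounded T (Q m)" for m
    unfolding Q_def[abs_def] by (intro known_bounded_sum known_bounded_power kd) auto
  have AXs: "AE \<omega> in M. \<forall>t\<ge>0. X t \<omega> \<in> {-1..1}" and AC: "AE \<omega> in M. continuous_on {0..} (\<lambda>t. X t \<omega>)"
    using X by (auto simp: sde_solution_def)
  have Ad: "AE \<omega> in M. \<forall>m k. \<bar>d m k \<omega>\<bar> \<le> 2"
    using AXs
  proof eventually_elim
    case (elim \<omega>)
    show ?case
    proof (intro allI)
      fix m k
      have "X (t m (Suc k)) \<omega> \<in> {-1..1}" "X (t m k) \<omega> \<in> {-1..1}" using elim tn by auto
      then show "\<bar>d m k \<omega>\<bar> \<le> 2" unfolding d_def by auto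
    qed
  qed
  have Vin: "V m \<omega> \<in> (\<lambda>k. \<bar>d m k \<omega>\<bar>) ` {..<Suc m}" for m \<omega>
    unfolding V_def by (rule Max_in) auto
  have Vge: "\<bar>d m k \<omega>\<bar> \<le> V m \<omega>" if "k < Suc m" for m k \<omega>
    unfolding V_def using that by (intro Max_ge) auto
  have V0: "0 \<le> V m \<omega>" for m \<omega> using Vge[of 0 m \<omega>] by (meson abs_ge_zero order_trans zero_less_Suc)
  have Vm[measurable]: "V m \<in> borel_measurable M" for m
    unfolding V_def[abs_def]
    by (intro borel_measurable_Max borel_measurable_abs known_bounded_measurable_M[OF kd T]) auto
  have V2: "AE \<omega> in M. norm ((V m \<omega>)\<^sup>2) \<le> 4" for m
    using Ad
  proof eventually_elim
    case (elim \<omega>)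
    have "V m \<omega> \<le> 2" using Vin[of m \<omega>] elim by auto
    then have "(V m \<omega>)\<^sup>2 \<le> 2\<^sup>2" using V0 by (intro power_mono) auto
    then show ?case by simp
  qed
  have iV: "integrable M (\<lambda>\<omega>. (V m \<omega>)\<^sup>2)" for m
    by (rule integrable_const_bound[OF V2]) measurable
  have Vlim: "(\<lambda>m. \<integral>\<omega>. (V m \<omega>)\<^sup>2 \<partial>M) \<longlonglongrightarrow> (\<integral>\<omega>. 0 \<partial>M)"
  proof (rule integral_dominated_convergence[where w="\<lambda>_. 4"])
    show "AE \<omega> in M. (\<lambda>m. (V m \<omega>)\<^sup>2) \<longlonglongrightarrow> 0"
      using AC
    proof eventually_elim
      case (elim \<omega>)
      have "uniformly_continuous_on {0..T} (\<lambda>t. X t \<omega>)"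
        by (rule compact_uniformly_continuous[OF continuous_on_subset[OF elim]]) auto
      then have uc: "\<And>e. e > 0 \<Longrightarrow> \<exists>\<delta>>0. \<forall>s\<in>{0..T}. \<forall>r\<in>{0..T}. dist r s < \<delta> \<longrightarrow> dist (X r \<omega>) (X s \<omega>) < e"
        unfolding uniformly_continuous_on_def by blast
      have "(\<lambda>m. V m \<omega>) \<longlonglongrightarrow> 0"
      proof (rule LIMSEQ_I)
        fix e :: real assume "0 < e"
        from uc[OF this] obtain \<delta> where \<delta>: "\<delta> > 0"
          "\<And>r s. s \<in> {0..T} \<Longrightarrow> r \<in> {0..T} \<Longrightarrow> dist r s < \<delta> \<Longrightarrow> dist (X r \<omega>) (X s \<omega>) < e" by blast
        have "(\<lambda>m. T * inverse (real (Suc m))) \<longlonglongrightarrow> T * 0"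
          by (intro tendsto_mult tendsto_const LIMSEQ_inverse_real_of_nat)
        then have "eventually (\<lambda>m. T * inverse (real (Suc m)) < \<delta>) sequentially"
          using \<delta>(1) by (intro order_tendstoD(2)) auto
        then obtain m0 where m0: "\<And>m. m \<ge> m0 \<Longrightarrow> T / real (Suc m) < \<delta>"
          unfolding eventually_sequentially by (auto simp: divide_inverse)
        show "\<exists>no. \<forall>n\<ge>no. norm (V n \<omega> - 0) < e"
        proof (intro exI[of _ m0] allI impI)
          fix m assume m: "m0 \<le> m"
          obtain k where k: "k < Suc m" "V m \<omega> = \<bar>d m k \<omega>\<bar>" using Vin[of m \<omega>] by auto
          have "dist (t m (Suc k)) (t m k) < \<delta>"
            using m0[OF m] dt[of m k] T by (simp add: dist_real_def)
          then have "dist (X (t m (Suc k)) \<omega>) (X (t m k) \<omega>) < e"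
            using k(1) tn tT[of k m] tT[of "Suc k" m] by (intro \<delta>(2)) auto
          then show "norm (V m \<omega> - 0) < e" by (simp add: k(2) d_def dist_real_def)
        qed
      qed
      from tendsto_power[OF this, of 2] show ?case by simp
    qed
  qed (use V2 in auto)
  have bound: "(\<Sum>k<Suc m. \<integral>\<omega>. \<bar>d m k \<omega>\<bar>^3 \<partial>M) \<le> \<delta> * 6 + (\<integral>\<omega>. (V m \<omega>)\<^sup>2 \<partial>M) / \<delta>" if \<delta>: "0 < \<delta>" for \<delta> m
  proof -
    have i3: "integrable M (\<lambda>\<omega>. \<bar>d m k \<omega>\<bar>^3)" if "k < Suc m" for k
      by (rule known_bounded_integrable[OF _ T]) (intro known_bounded_power known_bounded_abs kd that)
    have iQ: "integrable M (\<lambda>\<omega>. (Q m \<omega>)\<^sup>2)"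
      by (rule known_bounded_integrable[OF _ T]) (intro known_bounded_power kQ)
    have "(\<Sum>k<Suc m. \<integral>\<omega>. \<bar>d m k \<omega>\<bar>^3 \<partial>M) = (\<integral>\<omega>. (\<Sum>k<Suc m. \<bar>d m k \<omega>\<bar>^3) \<partial>M)"
      by (subst Bochner_Integration.integral_sum) (auto intro!: i3)
    also have "\<dots> \<le> (\<integral>\<omega>. \<delta> * (Q m \<omega>)\<^sup>2 + (V m \<omega>)\<^sup>2 / \<delta> \<partial>M)"
    proof (rule integral_mono)
      show "integrable M (\<lambda>\<omega>. \<Sum>k<Suc m. \<bar>d m k \<omega>\<bar>^3)"
        by (intro Bochner_Integration.integrable_sum i3) auto
      show "integrable M (\<lambda>\<omega>. \<delta> * (Q m \<omega>)\<^sup>2 + (V m \<omega>)\<^sup>2 / \<delta>)" using iQ iV by auto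
      fix \<omega>
      have "(\<Sum>k<Suc m. \<bar>d m k \<omega>\<bar>^3) \<le> (\<Sum>k<Suc m. V m \<omega> * (d m k \<omega>)\<^sup>2)"
      proof (rule sum_mono)
        fix k assume "k \<in> {..<Suc m}"
        then have "\<bar>d m k \<omega>\<bar> * (d m k \<omega>)\<^sup>2 \<le> V m \<omega> * (d m k \<omega>)\<^sup>2"
          by (intro mult_right_mono Vge) auto
        then show "\<bar>d m k \<omega>\<bar>^3 \<le> V m \<omega> * (d m k \<omega>)\<^sup>2" by (simp add: power3_eq_cube power2_eq_square abs_mult_self_eq mult.assoc)
      qed
      also have "\<dots> = V m \<omega> * Q m \<omega>" by (simp only: Q_def sum_distrib_left)
      also have "\<dots> \<le> \<delta> * (Q m \<omega>)\<^sup>2 + (V m \<omega>)\<^sup>2 / \<delta>"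
      proof -
        have "0 \<le> Q m \<omega>" unfolding Q_def by (intro sum_nonneg) auto
        then have nn: "0 \<le> V m \<omega> * Q m \<omega>" using V0 by simp
        have "0 \<le> (\<delta> * Q m \<omega> - V m \<omega>)\<^sup>2 / \<delta>" using \<delta> by simp
        also have "\<dots> = \<delta> * (Q m \<omega>)\<^sup>2 + (V m \<omega>)\<^sup>2 / \<delta> - 2 * (V m \<omega> * Q m \<omega>)"
          using \<delta> by (simp add: power2_diff field_simps power2_eq_square)
        finally show ?thesis using nn by simp
      qed
      finally show "(\<Sum>k<Suc m. \<bar>d m k \<omega>\<bar>^3) \<le> \<delta> * (Q m \<omega>)\<^sup>2 + (V m \<omega>)\<^sup>2 / \<delta>" .
    qed
    also have "\<dots> = \<delta> * (\<integral>\<omega>. (Q m \<omega>)\<^sup>2 \<partial>M) + (\<integral>\<omega>. (V m \<omega>)\<^sup>2 \<partial>M) / \<delta>"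
      using iQ iV by simp
    also have "(\<integral>\<omega>. (Q m \<omega>)\<^sup>2 \<partial>M) \<le> 6"
      unfolding Q_def d_def by (rule quadratic_variation_L2[OF X, where t="t m"]) (rule tn tm)+
    finally show ?thesis using \<delta> by (simp add: mult_left_mono)
  qed
  have nn: "0 \<le> (\<Sum>k<Suc m. \<integral>\<omega>. \<bar>d m k \<omega>\<bar>^3 \<partial>M)" for m
    by (intro sum_nonneg Bochner_Integration.integral_nonneg) auto
  have "(\<lambda>m. \<Sum>k<Suc m. \<integral>\<omega>. \<bar>d m k \<omega>\<bar>^3 \<partial>M) \<longlonglongrightarrow> 0"
  proof (rule tendstoI)
    fix e :: real assume e: "0 < e"
    \<comment> \<open>With the bound 6 on the mean of \<open>Q^2\<close> the first summand becomes
      \<open>e / 2\<close>.\<close>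
    define \<delta> where "\<delta> = e / 12"
    have \<delta>: "0 < \<delta>" using e by (simp add: \<delta>_def)
    have "(\<lambda>m. (\<integral>\<omega>. (V m \<omega>)\<^sup>2 \<partial>M) / \<delta>) \<longlonglongrightarrow> 0 / \<delta>"
      using Vlim \<delta> by (intro tendsto_divide tendsto_const) auto
    then have "eventually (\<lambda>m. (\<integral>\<omega>. (V m \<omega>)\<^sup>2 \<partial>M) / \<delta> < e / 2) sequentially"
      using e by (intro order_tendstoD(2)) auto
    then show "eventually (\<lambda>m. dist (\<Sum>k<Suc m. \<integral>\<omega>. \<bar>d m k \<omega>\<bar>^3 \<partial>M) 0 < e) sequentially"
    proof eventually_elim
      case (elim m)
      have "\<delta> * 6 = e / 2" by (simp add: \<delta>_def)
      with elim bound[OF \<delta>, of m] nn[of m] show ?case unfolding dist_real_def by linarith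
    qed
  qed
  then show ?thesis unfolding d_def t_def .
qed

end

section \<open>The Dynkin formula\<close>

lemma
  fixes f :: "real \<Rightarrow> real"
  assumes "f \<in> borel_measurable borel"
  shows borel_measurable_fst_compose: "(\<lambda>z::real \<times> real. f (fst z)) \<in> borel_measurable borel"
    and borel_measurable_snd_compose: "(\<lambda>z::real \<times> real. f (snd z)) \<in> borel_measurable borel"
  by (rule measurable_compose[OF borel_measurable_continuous_onI assms]; intro continuous_intros)+

lemma
  fixes f :: "real \<Rightarrow> real"
  assumes "continuous_on S f"
  shows continuous_on_fst_compose: "continuous_on (S \<times> T) (\<lambda>z. f (fst z))"
    and continuous_on_snd_compose: "continuous_on (T \<times> S) (\<lambda>z. f (snd z))"
  by (rule continuous_on_compose2[OF assms]; auto intro: continuous_intros)+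

text \<open>Multiplying the two second-order expansions and subtracting all terms up to order two
  leaves only products of total order at least three. As the increments are at most 2, higher orders
  are absorbed into cubes.\<close>

lemma product_taylor_bound:
  fixes D E :: real
  assumes a: "\<bar>p' - p - p1 * D - p2 / 2 * D\<^sup>2\<bar> \<le> K * \<bar>D\<bar>^3"
    and b: "\<bar>q' - q - q1 * E - q2 / 2 * E\<^sup>2\<bar> \<le> K * \<bar>E\<bar>^3"
    and D: "\<bar>D\<bar> \<le> 2" and E: "\<bar>E\<bar> \<le> 2" and K: "0 \<le> K" and N: "0 \<le> N"
    and bd: "\<bar>p\<bar> \<le> N" "\<bar>p1\<bar> \<le> N" "\<bar>p2\<bar> \<le> N" "\<bar>q\<bar> \<le> N" "\<bar>q1\<bar> \<le> N" "\<bar>q2\<bar> \<le> N"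
  shows "\<bar>p' * q' - p * q - (p1 * q * D + p * q1 * E + p2 * q / 2 * D\<^sup>2 + p * q2 / 2 * E\<^sup>2 + p1 * q1 * (D * E))\<bar>
    \<le> (K * N + (N / 2 + 2 * K) * (2 * N + 4 * K) + N * (N / 2 + 2 * K)) * (\<bar>D\<bar>^3 + \<bar>E\<bar>^3)"
proof -
  define R where "R = p' - p - p1 * D - p2 / 2 * D\<^sup>2"
  define S where "S = q' - q - q1 * E - q2 / 2 * E\<^sup>2"
  \<comment> \<open>\<open>A * D\<^sup>2\<close> bounds the expansion of \<open>p\<close> beyond
    first order and \<open>L * \<bar>E\<bar>\<close> bounds the whole increment of \<open>q\<close>;
    \<open>L\<close> is \<open>2 * A + N\<close>, the 2 being the bound on the increments.\<close>
  define A where "A = N / 2 + 2 * K"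
  define L where "L = 2 * N + 4 * K"
  have pos: "0 \<le> A" "0 \<le> L" using K N by (auto simp: A_def L_def)
  have sec: "\<bar>p2 / 2 * D\<^sup>2 + R\<bar> \<le> A * D\<^sup>2" if "\<bar>R\<bar> \<le> K * \<bar>D\<bar>^3" "\<bar>D\<bar> \<le> 2" "\<bar>p2\<bar> \<le> N" for R D p2 :: real
  proof -
    have "K * \<bar>D\<bar>^3 = K * \<bar>D\<bar> * D\<^sup>2" by (simp add: power3_eq_cube power2_eq_square abs_mult_self_eq mult.assoc)
    also have "\<dots> \<le> K * 2 * D\<^sup>2" using K that by (intro mult_right_mono mult_left_mono) auto
    finally have "\<bar>R\<bar> \<le> 2 * K * D\<^sup>2" using that by (simp add: ac_simps)
    moreover have "\<bar>p2 / 2 * D\<^sup>2\<bar> \<le> N / 2 * D\<^sup>2"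
      using that by (auto simp: abs_mult intro!: mult_right_mono)
    ultimately show ?thesis by (simp add: A_def algebra_simps)
  qed
  have sp: "\<bar>p2 / 2 * D\<^sup>2 + R\<bar> \<le> A * D\<^sup>2" by (rule sec) (use a D bd in \<open>auto simp: R_def\<close>)
  have sq: "\<bar>q2 / 2 * E\<^sup>2 + S\<bar> \<le> A * E\<^sup>2" by (rule sec) (use b E bd in \<open>auto simp: S_def\<close>)
  have lb: "\<bar>q1 * E + (q2 / 2 * E\<^sup>2 + S)\<bar> \<le> L * \<bar>E\<bar>"
  proof -
    have "A * E\<^sup>2 = A * \<bar>E\<bar> * \<bar>E\<bar>" by (simp add: power2_eq_square abs_mult_self_eq mult.assoc)
    also have "\<dots> \<le> A * 2 * \<bar>E\<bar>" using pos E by (intro mult_right_mono mult_left_mono) auto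
    finally have "A * E\<^sup>2 \<le> 2 * A * \<bar>E\<bar>" by simp
    moreover have "\<bar>q1 * E\<bar> \<le> N * \<bar>E\<bar>" using bd by (auto simp: abs_mult intro!: mult_right_mono)
    moreover have "L * \<bar>E\<bar> = 2 * A * \<bar>E\<bar> + N * \<bar>E\<bar>" by (simp add: L_def A_def algebra_simps)
    ultimately show ?thesis using sq by linarith
  qed
  \<comment> \<open>Mixed cubic products are reduced to pure cubes, because only the cubic variation
    of each single solution is controlled.\<close>
  have cub: "x\<^sup>2 * y \<le> x^3 + y^3" if "0 \<le> x" "0 \<le> y" for x y :: real
  proof (cases "x \<le> y")
    case True
    have "x\<^sup>2 * y \<le> y\<^sup>2 * y" using True that by (intro mult_right_mono power_mono) auto
    then show ?thesis using that by (simp add: power3_eq_cube power2_eq_square add_increasing)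
  next
    case False
    have "x\<^sup>2 * y \<le> x\<^sup>2 * x" using False that by (intro mult_left_mono) auto
    then show ?thesis using that by (simp add: power3_eq_cube power2_eq_square add_increasing2)
  qed
  have eq: "p' * q' - p * q - (p1 * q * D + p * q1 * E + p2 * q / 2 * D\<^sup>2 + p * q2 / 2 * E\<^sup>2 + p1 * q1 * (D * E))
    = R * q + p * S + (p2 / 2 * D\<^sup>2 + R) * (q1 * E + (q2 / 2 * E\<^sup>2 + S)) + p1 * D * (q2 / 2 * E\<^sup>2 + S)"
    by (simp add: R_def S_def algebra_simps)
  have 1: "\<bar>R * q\<bar> \<le> K * \<bar>D\<bar>^3 * N" unfolding abs_mult using a bd K by (intro mult_mono) (auto simp: R_def)
  have 2: "\<bar>p * S\<bar> \<le> N * (K * \<bar>E\<bar>^3)" unfolding abs_mult using b bd N by (intro mult_mono) (auto simp: S_def)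
  have "\<bar>(p2 / 2 * D\<^sup>2 + R) * (q1 * E + (q2 / 2 * E\<^sup>2 + S))\<bar> \<le> (A * D\<^sup>2) * (L * \<bar>E\<bar>)"
    unfolding abs_mult[of "p2 / 2 * D\<^sup>2 + R"] using sp lb pos by (intro mult_mono) auto
  also have "\<dots> = A * L * (\<bar>D\<bar>\<^sup>2 * \<bar>E\<bar>)" by simp
  also have "\<dots> \<le> A * L * (\<bar>D\<bar>^3 + \<bar>E\<bar>^3)" using pos by (intro mult_left_mono cub) auto
  finally have 3: "\<bar>(p2 / 2 * D\<^sup>2 + R) * (q1 * E + (q2 / 2 * E\<^sup>2 + S))\<bar> \<le> A * L * (\<bar>D\<bar>^3 + \<bar>E\<bar>^3)" .
  have "\<bar>p1 * D * (q2 / 2 * E\<^sup>2 + S)\<bar> \<le> (N * \<bar>D\<bar>) * (A * E\<^sup>2)"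
    unfolding abs_mult using bd sq N by (intro mult_mono) auto
  also have "\<dots> = N * A * (\<bar>E\<bar>\<^sup>2 * \<bar>D\<bar>)" by simp
  also have "\<dots> \<le> N * A * (\<bar>E\<bar>^3 + \<bar>D\<bar>^3)" using pos N by (intro mult_left_mono cub) auto
  finally have 4: "\<bar>p1 * D * (q2 / 2 * E\<^sup>2 + S)\<bar> \<le> N * A * (\<bar>E\<bar>^3 + \<bar>D\<bar>^3)" .
  have tri: "\<bar>w + x + y + z\<bar> \<le> a + b + c + d" if "\<bar>w\<bar> \<le> a" "\<bar>x\<bar> \<le> b" "\<bar>y\<bar> \<le> c" "\<bar>z\<bar> \<le> d" for w x y z a b c d :: real
    using that by linarith
  have "(K * N + A * L + N * A) * (\<bar>D\<bar>^3 + \<bar>E\<bar>^3)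
      = K * \<bar>D\<bar>^3 * N + N * (K * \<bar>E\<bar>^3) + A * L * (\<bar>D\<bar>^3 + \<bar>E\<bar>^3) + N * A * (\<bar>E\<bar>^3 + \<bar>D\<bar>^3)"
    by (simp add: algebra_simps)
  then show ?thesis
    unfolding eq A_def[symmetric] L_def[symmetric] using tri[OF 1 2 3 4] by (simp only:)
qed

text \<open>On one partition interval the martingale argument freezes the second-order coefficients
  at the left endpoint; this is the price of letting them move with time, in terms of their L1
  modulus of continuity.\<close>

lemma (in prob_space) frozen_integral_bound:
  assumes P: "compact_process S P" and g: "g \<in> borel_measurable borel" "continuous_on S g"
    and w: "w \<in> borel_measurable borel" "continuous_on S w" and A: "\<And>p. p \<in> S \<Longrightarrow> \<bar>w p\<bar> \<le> A" "0 \<le> A"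
    and st: "0 \<le> s" "s \<le> t" and e: "\<And>r. r \<in> {s..t} \<Longrightarrow> (\<integral>\<omega>. \<bar>g (P s \<omega>) - g (P r \<omega>)\<bar> \<partial>M) \<le> e"
  shows "\<bar>integral {s..t} (\<lambda>r. \<integral>\<omega>. g (P s \<omega>) * w (P r \<omega>) \<partial>M) - integral {s..t} (\<lambda>r. \<integral>\<omega>. g (P r \<omega>) * w (P r \<omega>) \<partial>M)\<bar>
    \<le> A * e * (t - s)"
proof -
  obtain K where K: "0 < K" "\<And>p. p \<in> S \<Longrightarrow> \<bar>g p\<bar> \<le> K"
    using compact_continuous_bound[of S g] P g by (auto simp: compact_process_def)
  have AS: "AE \<omega> in M. \<forall>t\<ge>0. P t \<omega> \<in> S" using P by (auto simp: compact_process_def)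
  have Pm: "P r \<in> borel_measurable M" if "0 \<le> r" for r using P that by (auto simp: compact_process_def)
  note [measurable] = g(1) w(1) Pm[OF st(1)]
  have bg: "AE \<omega> in M. \<bar>g (P s \<omega>)\<bar> \<le> K" using AS by eventually_elim (use K st in auto)
  have c1: "continuous_on {0..t} (\<lambda>r. \<integral>\<omega>. g (P s \<omega>) * w (P r \<omega>) \<partial>M)"
    by (rule compact_process_continuous[OF P w _ bg]) measurable
  have c2: "continuous_on {0..t} (\<lambda>r. \<integral>\<omega>. 1 * (g (P r \<omega>) * w (P r \<omega>)) \<partial>M)"
    by (rule compact_process_continuous[OF P, where C=1]) (use g w in \<open>auto intro!: continuous_intros\<close>)
  have sub: "{s..t} \<subseteq> {0..t}" using st by auto
  note c1' = continuous_on_subset[OF c1 sub] and c2' = continuous_on_subset[OF c2 sub, simplified]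
  have ptw: "norm ((\<integral>\<omega>. g (P s \<omega>) * w (P r \<omega>) \<partial>M) - (\<integral>\<omega>. g (P r \<omega>) * w (P r \<omega>) \<partial>M)) \<le> A * e" if r: "r \<in> {s..t}" for r
  proof -
    have r0: "0 \<le> r" using r st by auto
    note [measurable] = Pm[OF r0]
    have i1: "integrable M (\<lambda>\<omega>. g (P r \<omega>) * w (P r \<omega>))"
      by (rule compact_process_integrable[OF P _ _ r0]) (use g w in \<open>auto intro!: continuous_intros\<close>)
    have i2: "integrable M (\<lambda>\<omega>. g (P s \<omega>) * w (P r \<omega>))"
    proof (rule integrable_const_bound[where B="K * A"])
      show "AE \<omega> in M. norm (g (P s \<omega>) * w (P r \<omega>)) \<le> K * A"
        using AS by eventually_elim (use K A r0 st in \<open>auto simp: abs_mult intro!: mult_mono\<close>)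
    qed measurable
    have ig: "integrable M (\<lambda>\<omega>. \<bar>g (P s \<omega>) - g (P r \<omega>)\<bar>)"
      using compact_process_integrable[OF P g st(1)] compact_process_integrable[OF P g r0] by auto
    have "norm ((\<integral>\<omega>. g (P s \<omega>) * w (P r \<omega>) \<partial>M) - (\<integral>\<omega>. g (P r \<omega>) * w (P r \<omega>) \<partial>M))
      = \<bar>\<integral>\<omega>. g (P s \<omega>) * w (P r \<omega>) - g (P r \<omega>) * w (P r \<omega>) \<partial>M\<bar>"
      using i1 i2 by simp
    also have "\<dots> \<le> (\<integral>\<omega>. \<bar>g (P s \<omega>) * w (P r \<omega>) - g (P r \<omega>) * w (P r \<omega>)\<bar> \<partial>M)"
      by (rule integral_abs_bound)
    also have "\<dots> \<le> (\<integral>\<omega>. A * \<bar>g (P s \<omega>) - g (P r \<omega>)\<bar> \<partial>M)"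
    proof (rule integral_mono_AE)
      show "AE \<omega> in M. \<bar>g (P s \<omega>) * w (P r \<omega>) - g (P r \<omega>) * w (P r \<omega>)\<bar> \<le> A * \<bar>g (P s \<omega>) - g (P r \<omega>)\<bar>"
        using AS
      proof eventually_elim
        case (elim \<omega>)
        have "\<bar>g (P s \<omega>) * w (P r \<omega>) - g (P r \<omega>) * w (P r \<omega>)\<bar> = \<bar>w (P r \<omega>)\<bar> * \<bar>g (P s \<omega>) - g (P r \<omega>)\<bar>"
          by (simp add: abs_mult[symmetric] algebra_simps)
        also have "\<dots> \<le> A * \<bar>g (P s \<omega>) - g (P r \<omega>)\<bar>" using elim r0 A by (intro mult_right_mono) auto
        finally show ?case .
      qed
    qed (use i1 i2 ig in auto)
    also have "\<dots> = A * (\<integral>\<omega>. \<bar>g (P s \<omega>) - g (P r \<omega>)\<bar> \<partial>M)" by simp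
    also have "\<dots> \<le> A * e" using e[OF r] A by (intro mult_left_mono) auto
    finally show ?thesis .
  qed
  have "integral {s..t} (\<lambda>r. \<integral>\<omega>. g (P s \<omega>) * w (P r \<omega>) \<partial>M) - integral {s..t} (\<lambda>r. \<integral>\<omega>. g (P r \<omega>) * w (P r \<omega>) \<partial>M)
    = integral {s..t} (\<lambda>r. (\<integral>\<omega>. g (P s \<omega>) * w (P r \<omega>) \<partial>M) - (\<integral>\<omega>. g (P r \<omega>) * w (P r \<omega>) \<partial>M))"
    by (rule Henstock_Kurzweil_Integration.integral_diff[symmetric]) (intro integrable_continuous_real c1' c2')+
  moreover have "norm (integral {s..t} (\<lambda>r. (\<integral>\<omega>. g (P s \<omega>) * w (P r \<omega>) \<partial>M) - (\<integral>\<omega>. g (P r \<omega>) * w (P r \<omega>) \<partial>M))) \<le> A * e * (t - s)"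
    by (rule integral_bound[OF st(2) continuous_on_diff[OF c1' c2'] ptw])
  ultimately show ?thesis by simp
qed

lemma integral_partition_sum:
  fixes f :: "real \<Rightarrow> real"
  assumes f: "continuous_on {0..T} f" and t: "t 0 = 0" "\<And>k. t k \<le> t (Suc k)" "t n \<le> T"
  shows "(\<Sum>k<n. integral {t k..t (Suc k)} f) = integral {0..t n} f"
  using t(3)
proof (induction n)
  case (Suc n)
  have mono: "t i \<le> t j" if "i \<le> j" for i j using lift_Suc_mono_le[of t, OF t(2) that] .
  have "f integrable_on {0..t (Suc n)}"
    by (rule integrable_continuous_real[OF continuous_on_subset[OF f]]) (use Suc in auto)
  moreover have "0 \<le> t n" "t n \<le> t (Suc n)" using mono[of 0 n] t by auto
  ultimately have "integral {0..t n} f + integral {t n..t (Suc n)} f = integral {0..t (Suc n)} f"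
    by (intro Henstock_Kurzweil_Integration.integral_combine) auto
  moreover have "t n \<le> T" using t(2)[of n] Suc.prems by simp
  ultimately show ?case using Suc by simp
qed (simp add: t)

context brownian_motion begin

text \<open>Derivatives enter only as functions \<open>p1\<close>, \<open>p2\<close>,
  \<open>q1\<close>, \<open>q2\<close> satisfying a Taylor estimate. First-order terms have mean
  zero, second-order terms are evaluated by \<open>sde_increment_covariance\<close>, and the Taylor
  remainder leaves third absolute moments.\<close>

lemma dynkin_step:
  assumes X: "sde_solution M F B {-1..1} a u x X" and Y: "sde_solution M F B {-1..1} a v y Y"
    and a: "a \<in> borel_measurable borel" "continuous_on {-1..1} a"
    and pm: "p \<in> borel_measurable borel" "p1 \<in> borel_measurable borel" "p2 \<in> borel_measurable borel"
    and qm: "q \<in> borel_measurable borel" "q1 \<in> borel_measurable borel" "q2 \<in> borel_measurable borel"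
    and bd: "\<And>x. x \<in> {-1..1} \<Longrightarrow> \<bar>p x\<bar> \<le> N \<and> \<bar>p1 x\<bar> \<le> N \<and> \<bar>p2 x\<bar> \<le> N \<and> \<bar>q x\<bar> \<le> N \<and> \<bar>q1 x\<bar> \<le> N \<and> \<bar>q2 x\<bar> \<le> N"
    and pT: "\<And>x x'. x \<in> {-1..1} \<Longrightarrow> x' \<in> {-1..1} \<Longrightarrow> \<bar>p x' - p x - p1 x * (x' - x) - p2 x / 2 * (x' - x)\<^sup>2\<bar> \<le> K * \<bar>x' - x\<bar>^3"
    and qT: "\<And>x x'. x \<in> {-1..1} \<Longrightarrow> x' \<in> {-1..1} \<Longrightarrow> \<bar>q x' - q x - q1 x * (x' - x) - q2 x / 2 * (x' - x)\<^sup>2\<bar> \<le> K * \<bar>x' - x\<bar>^3"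
    and K: "0 \<le> K" and st: "0 \<le> s" "s \<le> t"
  shows "\<bar>(\<integral>\<omega>. p (X t \<omega>) * q (Y t \<omega>) \<partial>M) - (\<integral>\<omega>. p (X s \<omega>) * q (Y s \<omega>) \<partial>M)
      - ((u \<bullet> u) * integral {s..t} (\<lambda>r. \<integral>\<omega>. (p2 (X s \<omega>) * q (Y s \<omega>) / 2) * (a (X r \<omega>) * a (X r \<omega>)) \<partial>M)
       + (v \<bullet> v) * integral {s..t} (\<lambda>r. \<integral>\<omega>. (p (X s \<omega>) * q2 (Y s \<omega>) / 2) * (a (Y r \<omega>) * a (Y r \<omega>)) \<partial>M)
       + (u \<bullet> v) * integral {s..t} (\<lambda>r. \<integral>\<omega>. (p1 (X s \<omega>) * q1 (Y s \<omega>)) * (a (X r \<omega>) * a (Y r \<omega>)) \<partial>M))\<bar>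
    \<le> (K * N + (N / 2 + 2 * K) * (2 * N + 4 * K) + N * (N / 2 + 2 * K)) *
      ((\<integral>\<omega>. \<bar>X t \<omega> - X s \<omega>\<bar>^3 \<partial>M) + (\<integral>\<omega>. \<bar>Y t \<omega> - Y s \<omega>\<bar>^3 \<partial>M))"
proof -
  have t: "0 \<le> t" using st by simp
  have N: "0 \<le> N" using bd[of 0] by (meson abs_ge_zero atLeastAtMost_iff le_minus_one_simps(1) order_trans zero_le_one)
  have AX: "AE \<omega> in M. \<forall>t\<ge>0. X t \<omega> \<in> {-1..1}" and AY: "AE \<omega> in M. \<forall>t\<ge>0. Y t \<omega> \<in> {-1..1}"
    using X Y by (auto simp: sde_solution_def)
  have kf: "known_bounded r (\<lambda>\<omega>. f (X r \<omega>))" if "f \<in> borel_measurable borel" "\<And>x. x \<in> {-1..1} \<Longrightarrow> \<bar>f x\<bar> \<le> N" "0 \<le> r" for f r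
  proof -
    have "AE \<omega> in M. norm (f (X r \<omega>)) \<le> N" using AX by eventually_elim (use that in auto)
    then show ?thesis
      using measurable_compose[OF sde_adapted[OF X that(3)] that(1)] by (auto simp: known_bounded_def)
  qed
  have kg: "known_bounded r (\<lambda>\<omega>. f (Y r \<omega>))" if "f \<in> borel_measurable borel" "\<And>x. x \<in> {-1..1} \<Longrightarrow> \<bar>f x\<bar> \<le> N" "0 \<le> r" for f r
  proof -
    have "AE \<omega> in M. norm (f (Y r \<omega>)) \<le> N" using AY by eventually_elim (use that in auto)
    then show ?thesis
      using measurable_compose[OF sde_adapted[OF Y that(3)] that(1)] by (auto simp: known_bounded_def)
  qed
  have kp: "known_bounded s (\<lambda>\<omega>. p (X s \<omega>))" "known_bounded s (\<lambda>\<omega>. p1 (X s \<omega>))" "known_bounded s (\<lambda>\<omega>. p2 (X s \<omega>))"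
    "known_bounded t (\<lambda>\<omega>. p (X t \<omega>))"
    using bd st t by (auto intro!: kf pm)
  have kq: "known_bounded s (\<lambda>\<omega>. q (Y s \<omega>))" "known_bounded s (\<lambda>\<omega>. q1 (Y s \<omega>))" "known_bounded s (\<lambda>\<omega>. q2 (Y s \<omega>))"
    "known_bounded t (\<lambda>\<omega>. q (Y t \<omega>))"
    using bd st t by (auto intro!: kg qm)
  note up = known_bounded_mono[OF _ st]
  have kd: "known_bounded t (\<lambda>\<omega>. X t \<omega> - X s \<omega>)" "known_bounded t (\<lambda>\<omega>. Y t \<omega> - Y s \<omega>)"
    using st t by (auto intro!: known_bounded_diff sde_known_bounded[OF X] sde_known_bounded[OF Y])
  define D where "D \<omega> = X t \<omega> - X s \<omega>" for \<omega>
  define E where "E \<omega> = Y t \<omega> - Y s \<omega>" for \<omega>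
  have kD: "known_bounded t D" and kE: "known_bounded t E" using kd by (simp_all add: D_def[abs_def] E_def[abs_def])
  have kh: "known_bounded s (\<lambda>\<omega>. p2 (X s \<omega>) * q (Y s \<omega>) / 2)" "known_bounded s (\<lambda>\<omega>. p (X s \<omega>) * q2 (Y s \<omega>) / 2)"
    "known_bounded s (\<lambda>\<omega>. p1 (X s \<omega>) * q1 (Y s \<omega>))" "known_bounded s (\<lambda>\<omega>. p1 (X s \<omega>) * q (Y s \<omega>))"
    "known_bounded s (\<lambda>\<omega>. p (X s \<omega>) * q1 (Y s \<omega>))"
    unfolding divide_inverse by (intro known_bounded_mult kp kq known_bounded_const)+
  define f0 where "f0 \<omega> = p (X t \<omega>) * q (Y t \<omega>)" for \<omega>
  define f1 where "f1 \<omega> = p (X s \<omega>) * q (Y s \<omega>)" for \<omega>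
  define f2 where "f2 \<omega> = (p1 (X s \<omega>) * q (Y s \<omega>)) * D \<omega>" for \<omega>
  define f3 where "f3 \<omega> = (p (X s \<omega>) * q1 (Y s \<omega>)) * E \<omega>" for \<omega>
  define f4 where "f4 \<omega> = (p2 (X s \<omega>) * q (Y s \<omega>) / 2) * (D \<omega> * D \<omega>)" for \<omega>
  define f5 where "f5 \<omega> = (p (X s \<omega>) * q2 (Y s \<omega>) / 2) * (E \<omega> * E \<omega>)" for \<omega>
  define f6 where "f6 \<omega> = (p1 (X s \<omega>) * q1 (Y s \<omega>)) * (D \<omega> * E \<omega>)" for \<omega>
  have i0: "integrable M f0" unfolding f0_def[abs_def] by (rule known_bounded_integrable[OF known_bounded_mult[OF kp(4) kq(4)] t])
  have i1: "integrable M f1" unfolding f1_def[abs_def] by (rule known_bounded_integrable[OF known_bounded_mult[OF kp(1) kq(1)] st(1)])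
  have i2: "integrable M f2" unfolding f2_def[abs_def] by (rule known_bounded_integrable[OF known_bounded_mult[OF up[OF kh(4)] kD] t])
  have i3: "integrable M f3" unfolding f3_def[abs_def] by (rule known_bounded_integrable[OF known_bounded_mult[OF up[OF kh(5)] kE] t])
  have i4: "integrable M f4" unfolding f4_def[abs_def] by (rule known_bounded_integrable[OF known_bounded_mult[OF up[OF kh(1)] known_bounded_mult[OF kD kD]] t])
  have i5: "integrable M f5" unfolding f5_def[abs_def] by (rule known_bounded_integrable[OF known_bounded_mult[OF up[OF kh(2)] known_bounded_mult[OF kE kE]] t])
  have i6: "integrable M f6" unfolding f6_def[abs_def] by (rule known_bounded_integrable[OF known_bounded_mult[OF up[OF kh(3)] known_bounded_mult[OF kD kE]] t])
  have e2: "integral\<^sup>L M f2 = 0" unfolding f2_def[abs_def] D_def by (rule sde_increment_mean[OF X st kh(4)])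
  have e3: "integral\<^sup>L M f3 = 0" unfolding f3_def[abs_def] E_def by (rule sde_increment_mean[OF Y st kh(5)])
  have e4: "integral\<^sup>L M f4 = (u \<bullet> u) * integral {s..t} (\<lambda>r. \<integral>\<omega>. (p2 (X s \<omega>) * q (Y s \<omega>) / 2) * (a (X r \<omega>) * a (X r \<omega>)) \<partial>M)"
    unfolding f4_def[abs_def] D_def by (rule sde_increment_covariance[OF X X compact_Icc a st kh(1)])
  have e5: "integral\<^sup>L M f5 = (v \<bullet> v) * integral {s..t} (\<lambda>r. \<integral>\<omega>. (p (X s \<omega>) * q2 (Y s \<omega>) / 2) * (a (Y r \<omega>) * a (Y r \<omega>)) \<partial>M)"
    unfolding f5_def[abs_def] E_def by (rule sde_increment_covariance[OF Y Y compact_Icc a st kh(2)])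
  have e6: "integral\<^sup>L M f6 = (u \<bullet> v) * integral {s..t} (\<lambda>r. \<integral>\<omega>. (p1 (X s \<omega>) * q1 (Y s \<omega>)) * (a (X r \<omega>) * a (Y r \<omega>)) \<partial>M)"
    unfolding f6_def[abs_def] D_def E_def by (rule sde_increment_covariance[OF X Y compact_Icc a st kh(3)])
  define C where "C = K * N + (N / 2 + 2 * K) * (2 * N + 4 * K) + N * (N / 2 + 2 * K)"
  have iD3: "integrable M (\<lambda>\<omega>. \<bar>D \<omega>\<bar>^3)" by (rule known_bounded_integrable[OF known_bounded_power[OF known_bounded_abs[OF kD]] t])
  have iE3: "integrable M (\<lambda>\<omega>. \<bar>E \<omega>\<bar>^3)" by (rule known_bounded_integrable[OF known_bounded_power[OF known_bounded_abs[OF kE]] t])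
  define R where "R \<omega> = f0 \<omega> - f1 \<omega> - (f2 \<omega> + f3 \<omega> + f4 \<omega> + f5 \<omega> + f6 \<omega>)" for \<omega>
  have iR: "integrable M R" unfolding R_def[abs_def]
    by (intro Bochner_Integration.integrable_diff Bochner_Integration.integrable_add i0 i1 i2 i3 i4 i5 i6)
  have "\<bar>integral\<^sup>L M R\<bar> \<le> (\<integral>\<omega>. \<bar>R \<omega>\<bar> \<partial>M)" by (rule integral_abs_bound)
  also have "\<dots> \<le> (\<integral>\<omega>. C * (\<bar>D \<omega>\<bar>^3 + \<bar>E \<omega>\<bar>^3) \<partial>M)"
  proof (rule integral_mono_AE)
    show "AE \<omega> in M. \<bar>R \<omega>\<bar> \<le> C * (\<bar>D \<omega>\<bar>^3 + \<bar>E \<omega>\<bar>^3)"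
      using AX AY
    proof eventually_elim
      case (elim \<omega>)
      have in': "X s \<omega> \<in> {-1..1}" "X t \<omega> \<in> {-1..1}" "Y s \<omega> \<in> {-1..1}" "Y t \<omega> \<in> {-1..1}"
        using elim st t by auto
      have d: "\<bar>D \<omega>\<bar> \<le> 2" "\<bar>E \<omega>\<bar> \<le> 2" using in' by (auto simp: D_def E_def)
      have "\<bar>p (X t \<omega>) * q (Y t \<omega>) - p (X s \<omega>) * q (Y s \<omega>) - (p1 (X s \<omega>) * q (Y s \<omega>) * D \<omega> + p (X s \<omega>) * q1 (Y s \<omega>) * E \<omega>
          + p2 (X s \<omega>) * q (Y s \<omega>) / 2 * (D \<omega>)\<^sup>2 + p (X s \<omega>) * q2 (Y s \<omega>) / 2 * (E \<omega>)\<^sup>2 + p1 (X s \<omega>) * q1 (Y s \<omega>) * (D \<omega> * E \<omega>))\<bar>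
        \<le> C * (\<bar>D \<omega>\<bar>^3 + \<bar>E \<omega>\<bar>^3)"
        unfolding C_def
        by (rule product_taylor_bound)
           (use pT[OF in'(1,2)] qT[OF in'(3,4)] d K N bd[OF in'(1)] bd[OF in'(3)] in \<open>auto simp: D_def E_def\<close>)
      then show ?case by (simp only: R_def f0_def f1_def f2_def f3_def f4_def f5_def f6_def power2_eq_square)
    qed
  qed (use iR iD3 iE3 in auto)
  also have "\<dots> = C * ((\<integral>\<omega>. \<bar>D \<omega>\<bar>^3 \<partial>M) + (\<integral>\<omega>. \<bar>E \<omega>\<bar>^3 \<partial>M))" using iD3 iE3 by simp
  finally have "\<bar>integral\<^sup>L M R\<bar> \<le> \<dots>" .
  moreover have "integral\<^sup>L M R = integral\<^sup>L M f0 - integral\<^sup>L M f1 - (integral\<^sup>L M f2 + integral\<^sup>L M f3 + integral\<^sup>L M f4 + integral\<^sup>L M f5 + integral\<^sup>L M f6)"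
    unfolding R_def[abs_def] using i0 i1 i2 i3 i4 i5 i6 by simp
  ultimately show ?thesis
    unfolding e2 e3 e4 e5 e6 C_def by (simp add: f0_def[abs_def] f1_def[abs_def] D_def E_def)
qed

text \<open>Summation of \<open>dynkin_step\<close> over a uniform partition telescopes. Vanishing
  cubic variation removes the Taylor remainders, and the uniform L1 modulus of continuity removes
  the freezing of the coefficients.\<close>

lemma dynkin_formula:
  assumes X: "sde_solution M F B {-1..1} a u 0 X" and Y: "sde_solution M F B {-1..1} a v 0 Y"
    and a: "a \<in> borel_measurable borel" "continuous_on {-1..1} a"
    and pm: "p \<in> borel_measurable borel" "p1 \<in> borel_measurable borel" "p2 \<in> borel_measurable borel"
    and qm: "q \<in> borel_measurable borel" "q1 \<in> borel_measurable borel" "q2 \<in> borel_measurable borel"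
    and pc: "continuous_on {-1..1} p" "continuous_on {-1..1} p1" "continuous_on {-1..1} p2"
    and qc: "continuous_on {-1..1} q" "continuous_on {-1..1} q1" "continuous_on {-1..1} q2"
    and pT: "\<And>x x'. x \<in> {-1..1} \<Longrightarrow> x' \<in> {-1..1} \<Longrightarrow> \<bar>p x' - p x - p1 x * (x' - x) - p2 x / 2 * (x' - x)\<^sup>2\<bar> \<le> K * \<bar>x' - x\<bar>^3"
    and qT: "\<And>x x'. x \<in> {-1..1} \<Longrightarrow> x' \<in> {-1..1} \<Longrightarrow> \<bar>q x' - q x - q1 x * (x' - x) - q2 x / 2 * (x' - x)\<^sup>2\<bar> \<le> K * \<bar>x' - x\<bar>^3"
    and K: "0 \<le> K" and T: "0 \<le> T"
  shows "(\<integral>\<omega>. p (X T \<omega>) * q (Y T \<omega>) \<partial>M) - p 0 * q 0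
    = integral {0..T} (\<lambda>r. (u \<bullet> u) * (\<integral>\<omega>. (p2 (X r \<omega>) * q (Y r \<omega>) / 2) * (a (X r \<omega>) * a (X r \<omega>)) \<partial>M)
       + (v \<bullet> v) * (\<integral>\<omega>. (p (X r \<omega>) * q2 (Y r \<omega>) / 2) * (a (Y r \<omega>) * a (Y r \<omega>)) \<partial>M)
       + (u \<bullet> v) * (\<integral>\<omega>. (p1 (X r \<omega>) * q1 (Y r \<omega>)) * (a (X r \<omega>) * a (Y r \<omega>)) \<partial>M))"
proof -
  let ?I = "{-1..1::real}"
  define P where "P t \<omega> = (X t \<omega>, Y t \<omega>)" for t \<omega>
  have P: "compact_process (?I \<times> ?I) P"
    using sde_compact_process_pair[OF X Y compact_Icc] by (simp add: P_def[abs_def])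
  define g1 where "g1 z = p2 (fst z) * q (snd z) / 2" for z
  define g2 where "g2 z = p (fst z) * q2 (snd z) / 2" for z
  define g3 where "g3 z = p1 (fst z) * q1 (snd z)" for z
  define w1 where "w1 z = a (fst z) * a (fst z)" for z :: "real \<times> real"
  define w2 where "w2 z = a (snd z) * a (snd z)" for z :: "real \<times> real"
  define w3 where "w3 z = a (fst z) * a (snd z)" for z
  have gm: "g1 \<in> borel_measurable borel" "g2 \<in> borel_measurable borel" "g3 \<in> borel_measurable borel"
    unfolding g1_def[abs_def] g2_def[abs_def] g3_def[abs_def]
    by (intro borel_measurable_divide borel_measurable_times borel_measurable_fst_compose borel_measurable_snd_compose pm qm borel_measurable_const)+
  have wm: "w1 \<in> borel_measurable borel" "w2 \<in> borel_measurable borel" "w3 \<in> borel_measurable borel"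
    unfolding w1_def[abs_def] w2_def[abs_def] w3_def[abs_def]
    by (intro borel_measurable_times borel_measurable_fst_compose borel_measurable_snd_compose a)+
  have gc: "continuous_on (?I \<times> ?I) g1" "continuous_on (?I \<times> ?I) g2" "continuous_on (?I \<times> ?I) g3"
    unfolding g1_def[abs_def] g2_def[abs_def] g3_def[abs_def] divide_inverse
    by (intro continuous_on_mult continuous_on_fst_compose continuous_on_snd_compose pc qc continuous_on_const)+
  have wc: "continuous_on (?I \<times> ?I) w1" "continuous_on (?I \<times> ?I) w2" "continuous_on (?I \<times> ?I) w3"
    unfolding w1_def[abs_def] w2_def[abs_def] w3_def[abs_def]
    by (intro continuous_on_mult continuous_on_fst_compose continuous_on_snd_compose a)+
  have "continuous_on ?I (\<lambda>x. \<bar>p x\<bar> + \<bar>p1 x\<bar> + \<bar>p2 x\<bar> + \<bar>q x\<bar> + \<bar>q1 x\<bar> + \<bar>q2 x\<bar>)"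
    by (intro continuous_on_add continuous_on_rabs pc qc)
  then obtain N where "0 < N" and N: "\<And>x. x \<in> ?I \<Longrightarrow> \<bar>\<bar>p x\<bar> + \<bar>p1 x\<bar> + \<bar>p2 x\<bar> + \<bar>q x\<bar> + \<bar>q1 x\<bar> + \<bar>q2 x\<bar>\<bar> \<le> N"
    using compact_continuous_bound[OF compact_Icc] by blast
  have bd: "\<bar>p x\<bar> \<le> N \<and> \<bar>p1 x\<bar> \<le> N \<and> \<bar>p2 x\<bar> \<le> N \<and> \<bar>q x\<bar> \<le> N \<and> \<bar>q1 x\<bar> \<le> N \<and> \<bar>q2 x\<bar> \<le> N" if "x \<in> ?I" for x
    using N[OF that] by linarith
  have "compact (?I \<times> ?I)" by (intro compact_Times compact_Icc)
  moreover have "continuous_on (?I \<times> ?I) (\<lambda>x. \<bar>w1 x\<bar> + \<bar>w2 x\<bar> + \<bar>w3 x\<bar>)"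
    by (intro continuous_on_add continuous_on_rabs wc)
  ultimately obtain A where A0: "0 < A" and A: "\<And>x. x \<in> ?I \<times> ?I \<Longrightarrow> \<bar>\<bar>w1 x\<bar> + \<bar>w2 x\<bar> + \<bar>w3 x\<bar>\<bar> \<le> A"
    using compact_continuous_bound by blast
  have Ab: "\<bar>w1 x\<bar> \<le> A" "\<bar>w2 x\<bar> \<le> A" "\<bar>w3 x\<bar> \<le> A" if "x \<in> ?I \<times> ?I" for x
    using A[OF that] by linarith+
  define L1 where "L1 r = (\<integral>\<omega>. g1 (P r \<omega>) * w1 (P r \<omega>) \<partial>M)" for r
  define L2 where "L2 r = (\<integral>\<omega>. g2 (P r \<omega>) * w2 (P r \<omega>) \<partial>M)" for r
  define L3 where "L3 r = (\<integral>\<omega>. g3 (P r \<omega>) * w3 (P r \<omega>) \<partial>M)" for r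
  have Lc: "continuous_on {0..T} (\<lambda>r. \<integral>\<omega>. g (P r \<omega>) * w (P r \<omega>) \<partial>M)"
    if "g \<in> borel_measurable borel" "w \<in> borel_measurable borel" "continuous_on (?I \<times> ?I) g" "continuous_on (?I \<times> ?I) w" for g w :: "real \<times> real \<Rightarrow> real"
    using compact_process_continuous[OF P borel_measurable_times[OF that(1,2)] continuous_on_mult[OF that(3,4)], of "\<lambda>_. 1" 1 T] by simp
  have L1c: "continuous_on {0..T} L1" unfolding L1_def[abs_def] by (rule Lc[OF gm(1) wm(1) gc(1) wc(1)])
  have L2c: "continuous_on {0..T} L2" unfolding L2_def[abs_def] by (rule Lc[OF gm(2) wm(2) gc(2) wc(2)])
  have L3c: "continuous_on {0..T} L3" unfolding L3_def[abs_def] by (rule Lc[OF gm(3) wm(3) gc(3) wc(3)])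
  \<comment> \<open>The expectation at time \<open>r\<close> of the generator of the pair applied to
    \<open>p(x) q(y)\<close>; the factors 1/2 of the pure second-order terms sit in
    \<open>g1\<close> and \<open>g2\<close>.\<close>
  define U where "U r = (u \<bullet> u) * L1 r + (v \<bullet> v) * L2 r + (u \<bullet> v) * L3 r" for r
  have Uc: "continuous_on {0..T} U"
    unfolding U_def[abs_def] by (intro continuous_on_add continuous_on_mult continuous_on_const L1c L2c L3c)
  define h where "h r = (\<integral>\<omega>. p (X r \<omega>) * q (Y r \<omega>) \<partial>M)" for r
  define C where "C = K * N + (N / 2 + 2 * K) * (2 * N + 4 * K) + N * (N / 2 + 2 * K)"
  have C0: "0 \<le> C" using K \<open>0 < N\<close> by (simp add: C_def)
  define W where "W = \<bar>u \<bullet> u\<bar> + \<bar>v \<bullet> v\<bar> + \<bar>u \<bullet> v\<bar>"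
  have W0: "0 \<le> W" by (simp add: W_def)
  define cX where "cX s t = (\<integral>\<omega>. \<bar>X t \<omega> - X s \<omega>\<bar>^3 \<partial>M)" for s t
  define cY where "cY s t = (\<integral>\<omega>. \<bar>Y t \<omega> - Y s \<omega>\<bar>^3 \<partial>M)" for s t
  have step: "\<bar>h t - h s - integral {s..t} U\<bar> \<le> C * (cX s t + cY s t) + W * (A * e * (t - s))"
    if st: "0 \<le> s" "s \<le> t" "t \<le> T" and e: "\<And>r. r \<in> {s..t} \<Longrightarrow> (\<integral>\<omega>. \<bar>g1 (P s \<omega>) - g1 (P r \<omega>)\<bar> \<partial>M) \<le> e"
      "\<And>r. r \<in> {s..t} \<Longrightarrow> (\<integral>\<omega>. \<bar>g2 (P s \<omega>) - g2 (P r \<omega>)\<bar> \<partial>M) \<le> e"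
      "\<And>r. r \<in> {s..t} \<Longrightarrow> (\<integral>\<omega>. \<bar>g3 (P s \<omega>) - g3 (P r \<omega>)\<bar> \<partial>M) \<le> e" for s t e
  proof -
    define J1 where "J1 = integral {s..t} (\<lambda>r. \<integral>\<omega>. g1 (P s \<omega>) * w1 (P r \<omega>) \<partial>M)"
    define J2 where "J2 = integral {s..t} (\<lambda>r. \<integral>\<omega>. g2 (P s \<omega>) * w2 (P r \<omega>) \<partial>M)"
    define J3 where "J3 = integral {s..t} (\<lambda>r. \<integral>\<omega>. g3 (P s \<omega>) * w3 (P r \<omega>) \<partial>M)"
    have a1: "\<bar>h t - h s - ((u \<bullet> u) * J1 + (v \<bullet> v) * J2 + (u \<bullet> v) * J3)\<bar> \<le> C * (cX s t + cY s t)"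
      unfolding h_def J1_def J2_def J3_def C_def cX_def cY_def P_def g1_def g2_def g3_def w1_def w2_def w3_def fst_conv snd_conv
      by (rule dynkin_step[OF X Y a pm qm bd pT qT K st(1,2)])
    have b1: "\<bar>J1 - integral {s..t} L1\<bar> \<le> A * e * (t - s)"
      unfolding J1_def L1_def[abs_def]
      by (rule frozen_integral_bound[OF P gm(1) gc(1) wm(1) wc(1) Ab(1) less_imp_le[OF A0] st(1,2) e(1)])
    have b2: "\<bar>J2 - integral {s..t} L2\<bar> \<le> A * e * (t - s)"
      unfolding J2_def L2_def[abs_def]
      by (rule frozen_integral_bound[OF P gm(2) gc(2) wm(2) wc(2) Ab(2) less_imp_le[OF A0] st(1,2) e(2)])
    have b3: "\<bar>J3 - integral {s..t} L3\<bar> \<le> A * e * (t - s)"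
      unfolding J3_def L3_def[abs_def]
      by (rule frozen_integral_bound[OF P gm(3) gc(3) wm(3) wc(3) Ab(3) less_imp_le[OF A0] st(1,2) e(3)])
    have sub: "{s..t} \<subseteq> {0..T}" using st by auto
    have int: "L1 integrable_on {s..t}" "L2 integrable_on {s..t}" "L3 integrable_on {s..t}"
      by (intro integrable_continuous_real continuous_on_subset[OF L1c sub] continuous_on_subset[OF L2c sub] continuous_on_subset[OF L3c sub])+
    have "integral {s..t} U = (u \<bullet> u) * integral {s..t} L1 + (v \<bullet> v) * integral {s..t} L2 + (u \<bullet> v) * integral {s..t} L3"
    proof (rule integral_unique)
      show "(U has_integral (u \<bullet> u) * integral {s..t} L1 + (v \<bullet> v) * integral {s..t} L2 + (u \<bullet> v) * integral {s..t} L3) {s..t}"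
        unfolding U_def[abs_def]
        by (intro has_integral_add has_integral_mult_right integrable_integral int)
    qed
    then have "h t - h s - integral {s..t} U = (h t - h s - ((u \<bullet> u) * J1 + (v \<bullet> v) * J2 + (u \<bullet> v) * J3))
      + ((u \<bullet> u) * (J1 - integral {s..t} L1) + (v \<bullet> v) * (J2 - integral {s..t} L2) + (u \<bullet> v) * (J3 - integral {s..t} L3))"
      by (simp add: algebra_simps)
    moreover have "\<bar>(u \<bullet> u) * (J1 - integral {s..t} L1)\<bar> \<le> \<bar>u \<bullet> u\<bar> * (A * e * (t - s))"
      unfolding abs_mult by (intro mult_left_mono b1) auto
    moreover have "\<bar>(v \<bullet> v) * (J2 - integral {s..t} L2)\<bar> \<le> \<bar>v \<bullet> v\<bar> * (A * e * (t - s))"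
      unfolding abs_mult by (intro mult_left_mono b2) auto
    moreover have "\<bar>(u \<bullet> v) * (J3 - integral {s..t} L3)\<bar> \<le> \<bar>u \<bullet> v\<bar> * (A * e * (t - s))"
      unfolding abs_mult by (intro mult_left_mono b3) auto
    moreover have "W * (A * e * (t - s)) = \<bar>u \<bullet> u\<bar> * (A * e * (t - s)) + \<bar>v \<bullet> v\<bar> * (A * e * (t - s)) + \<bar>u \<bullet> v\<bar> * (A * e * (t - s))"
      by (simp only: W_def distrib_right)
    ultimately show ?thesis using a1 by linarith
  qed
  \<comment> \<open>The two cubic sums are each below \<open>e\<close>, which gives
    \<open>2 * C * e\<close>; the freezing errors are proportional to the interval lengths, which
    add up to \<open>T\<close>.\<close>
  have small: "\<bar>h T - h 0 - integral {0..T} U\<bar> \<le> (2 * C + W * A * T) * e" if e: "0 < e" for e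
  proof -
    obtain d1 where d1: "0 < d1" "\<And>r s. r \<in> {0..T} \<Longrightarrow> s \<in> {0..T} \<Longrightarrow> \<bar>r - s\<bar> < d1 \<Longrightarrow> (\<integral>\<omega>. \<bar>g1 (P r \<omega>) - g1 (P s \<omega>)\<bar> \<partial>M) < e"
      using compact_process_L1_uniform[OF P gm(1) gc(1) e, of T] by blast
    obtain d2 where d2: "0 < d2" "\<And>r s. r \<in> {0..T} \<Longrightarrow> s \<in> {0..T} \<Longrightarrow> \<bar>r - s\<bar> < d2 \<Longrightarrow> (\<integral>\<omega>. \<bar>g2 (P r \<omega>) - g2 (P s \<omega>)\<bar> \<partial>M) < e"
      using compact_process_L1_uniform[OF P gm(2) gc(2) e, of T] by blast
    obtain d3 where d3: "0 < d3" "\<And>r s. r \<in> {0..T} \<Longrightarrow> s \<in> {0..T} \<Longrightarrow> \<bar>r - s\<bar> < d3 \<Longrightarrow> (\<integral>\<omega>. \<bar>g3 (P r \<omega>) - g3 (P s \<omega>)\<bar> \<partial>M) < e"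
      using compact_process_L1_uniform[OF P gm(3) gc(3) e, of T] by blast
    have "(\<lambda>m. T * inverse (real (Suc m))) \<longlonglongrightarrow> T * 0"
      by (intro tendsto_mult tendsto_const LIMSEQ_inverse_real_of_nat)
    then have "eventually (\<lambda>m. T * inverse (real (Suc m)) < min d1 (min d2 d3)) sequentially"
      using d1 d2 d3 by (intro order_tendstoD(2)) auto
    moreover have "eventually (\<lambda>m. (\<Sum>k<Suc m. cX (T * real k / real (Suc m)) (T * real (Suc k) / real (Suc m))) < e) sequentially"
      unfolding cX_def by (rule order_tendstoD(2)[OF cubic_variation_tendsto_0[OF X T] e])
    moreover have "eventually (\<lambda>m. (\<Sum>k<Suc m. cY (T * real k / real (Suc m)) (T * real (Suc k) / real (Suc m))) < e) sequentially"
      unfolding cY_def by (rule order_tendstoD(2)[OF cubic_variation_tendsto_0[OF Y T] e])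
    ultimately have "eventually (\<lambda>m. T * inverse (real (Suc m)) < min d1 (min d2 d3) \<and>
      (\<Sum>k<Suc m. cX (T * real k / real (Suc m)) (T * real (Suc k) / real (Suc m))) < e \<and>
      (\<Sum>k<Suc m. cY (T * real k / real (Suc m)) (T * real (Suc k) / real (Suc m))) < e) sequentially"
      by eventually_elim blast
    then obtain m where m: "T * inverse (real (Suc m)) < min d1 (min d2 d3)"
      "(\<Sum>k<Suc m. cX (T * real k / real (Suc m)) (T * real (Suc k) / real (Suc m))) < e"
      "(\<Sum>k<Suc m. cY (T * real k / real (Suc m)) (T * real (Suc k) / real (Suc m))) < e"
      unfolding eventually_sequentially by blast
    define t where "t k = T * real k / real (Suc m)" for k
    have t0: "t 0 = 0" and tT: "t (Suc m) = T" by (simp_all add: t_def)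
    have tn: "0 \<le> t k" for k using T by (simp add: t_def)
    have tm: "t k \<le> t (Suc k)" for k using T by (simp add: t_def divide_right_mono mult_left_mono)
    have tle: "t k \<le> T" if "k \<le> Suc m" for k
      using lift_Suc_mono_le[of t, OF tm that] tT by simp
    have dt: "t (Suc k) - t k = T * inverse (real (Suc m))" for k
      by (simp add: t_def divide_inverse algebra_simps)
    have each: "\<bar>h (t (Suc k)) - h (t k) - integral {t k..t (Suc k)} U\<bar>
        \<le> C * (cX (t k) (t (Suc k)) + cY (t k) (t (Suc k))) + W * (A * e * (t (Suc k) - t k))" if k: "k < Suc m" for k
    proof (rule step[OF tn tm tle])
      show "Suc k \<le> Suc m" using k by simp
      fix r assume r: "r \<in> {t k..t (Suc k)}"
      have "t k \<in> {0..T}" "r \<in> {0..T}" using r tn[of k] tle[of k] tle[of "Suc k"] k by auto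
      moreover have "\<bar>t k - r\<bar> < min d1 (min d2 d3)" using r dt[of k] m(1) by auto
      ultimately show "(\<integral>\<omega>. \<bar>g1 (P (t k) \<omega>) - g1 (P r \<omega>)\<bar> \<partial>M) \<le> e" "(\<integral>\<omega>. \<bar>g2 (P (t k) \<omega>) - g2 (P r \<omega>)\<bar> \<partial>M) \<le> e"
        "(\<integral>\<omega>. \<bar>g3 (P (t k) \<omega>) - g3 (P r \<omega>)\<bar> \<partial>M) \<le> e"
        using d1(2) d2(2) d3(2) by (meson less_imp_le min_less_iff_conj)+
    qed
    have "h T - h 0 - integral {0..T} U = (\<Sum>k<Suc m. h (t (Suc k)) - h (t k) - integral {t k..t (Suc k)} U)"
    proof -
      have "(\<Sum>k<Suc m. integral {t k..t (Suc k)} U) = integral {0..t (Suc m)} U"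
        by (rule integral_partition_sum[OF Uc t0 tm]) (simp add: tT)
      moreover have "(\<Sum>k<Suc m. h (t (Suc k)) - h (t k)) = h (t (Suc m)) - h (t 0)"
        by (rule sum_lessThan_telescope)
      ultimately show ?thesis by (simp only: sum_subtractf tT t0)
    qed
    also have "\<bar>\<dots>\<bar> \<le> (\<Sum>k<Suc m. \<bar>h (t (Suc k)) - h (t k) - integral {t k..t (Suc k)} U\<bar>)"
      by (rule sum_abs)
    also have "\<dots> \<le> (\<Sum>k<Suc m. C * (cX (t k) (t (Suc k)) + cY (t k) (t (Suc k))) + W * (A * e * (t (Suc k) - t k)))"
      by (intro sum_mono each) auto
    also have "\<dots> = C * ((\<Sum>k<Suc m. cX (t k) (t (Suc k))) + (\<Sum>k<Suc m. cY (t k) (t (Suc k)))) + W * (A * e * (\<Sum>k<Suc m. t (Suc k) - t k))"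
      by (simp only: sum.distrib sum_distrib_left[symmetric])
    also have "(\<Sum>k<Suc m. t (Suc k) - t k) = T"
      by (simp only: sum_lessThan_telescope t0 tT diff_zero)
    also have "C * ((\<Sum>k<Suc m. cX (t k) (t (Suc k))) + (\<Sum>k<Suc m. cY (t k) (t (Suc k)))) \<le> C * (e + e)"
      using m(2,3) C0 unfolding t_def by (intro mult_left_mono add_mono) auto
    finally show ?thesis by (simp add: algebra_simps)
  qed
  have "\<bar>h T - h 0 - integral {0..T} U\<bar> = 0"
  proof (rule ccontr)
    define err where "err = \<bar>h T - h 0 - integral {0..T} U\<bar>"
    define c where "c = 2 * C + W * A * T"
    have c0: "0 \<le> c" using C0 W0 A0 T by (simp add: c_def)
    assume "\<not> ?thesis"
    then have err: "0 < err" by (simp add: err_def)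
    \<comment> \<open>The tolerance \<open>err / (c + 1)\<close> turns the estimate into
      \<open>err * (c + 1) \<le> c * err\<close>, impossible for a positive error.\<close>
    have "err \<le> c * (err / (c + 1))"
      unfolding err_def c_def by (rule small) (use err c0 in \<open>simp add: err_def c_def\<close>)
    then have "err * (c + 1) \<le> c * err" using c0 by (simp add: field_simps)
    then show False using err by (simp add: algebra_simps)
  qed
  moreover have "h 0 = p 0 * q 0"
  proof -
    note [measurable] = sde_measurable[OF X order_refl] sde_measurable[OF Y order_refl] pm qm
    have "AE \<omega> in M. X 0 \<omega> = 0" "AE \<omega> in M. Y 0 \<omega> = 0" using X Y by (auto simp: sde_solution_def)
    then have "AE \<omega> in M. p (X 0 \<omega>) * q (Y 0 \<omega>) = p 0 * q 0" by eventually_elim simp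
    then have "h 0 = (\<integral>\<omega>. p 0 * q 0 \<partial>M)"
      unfolding h_def by (intro integral_cong_AE) measurable
    then show ?thesis by (simp add: prob_space)
  qed
  ultimately have "h T - p 0 * q 0 = integral {0..T} U" by simp
  then show ?thesis
    unfolding h_def U_def[abs_def] L1_def[abs_def] L2_def[abs_def] L3_def[abs_def] P_def g1_def g2_def g3_def w1_def w2_def w3_def fst_conv snd_conv .
qed

end

section \<open>Convergence to the absorbing points\<close>

text \<open>A Cauchy criterion at infinity with an integer base point; integers keep the events of
  the probabilistic argument countable.\<close>

lemma convergent_at_top_of_oscillation:
  fixes f :: "real \<Rightarrow> real"
  assumes "\<And>c. 0 < c \<Longrightarrow> \<exists>n::nat. \<forall>r\<ge>real n. \<bar>f r - f (real n)\<bar> \<le> c"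
  shows "\<exists>l. (f \<longlongrightarrow> l) at_top"
proof -
  have "Cauchy (\<lambda>i. f (real i))"
  proof (rule metric_CauchyI)
    fix e :: real assume "0 < e"
    then obtain n where n: "\<And>r. r \<ge> real n \<Longrightarrow> \<bar>f r - f (real n)\<bar> \<le> e / 3"
      using assms[of "e / 3"] by auto
    show "\<exists>M. \<forall>m\<ge>M. \<forall>n\<ge>M. dist (f (real m)) (f (real n)) < e"
    proof (intro exI[of _ n] allI impI)
      fix i j assume "n \<le> i" "n \<le> j"
      then have "real n \<le> real i" "real n \<le> real j" by auto
      from n[OF this(1)] n[OF this(2)] show "dist (f (real i)) (f (real j)) < e" using \<open>0 < e\<close> unfolding dist_real_def by linarith
    qed
  qed
  then obtain l where l: "(\<lambda>i. f (real i)) \<longlonglongrightarrow> l" using Cauchy_convergent convergent_def by blast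
  have "(f \<longlongrightarrow> l) at_top"
  proof (rule tendstoI)
    fix e :: real assume e: "0 < e"
    then obtain n where n: "\<And>r. r \<ge> real n \<Longrightarrow> \<bar>f r - f (real n)\<bar> \<le> e / 3"
      using assms[of "e / 3"] by auto
    have "eventually (\<lambda>i. dist (f (real i)) l < e / 3 \<and> n \<le> i) sequentially"
      using e by (intro eventually_conj tendstoD[OF l] eventually_ge_at_top) auto
    then obtain i where i: "dist (f (real i)) l < e / 3" "n \<le> i" by (auto dest: eventually_happens)
    have ni: "\<bar>f (real i) - f (real n)\<bar> \<le> e / 3" using i by (intro n) auto
    show "eventually (\<lambda>r. dist (f r) l < e) at_top"
      using eventually_ge_at_top[of "real n"]
    proof eventually_elim
      case (elim r)
      then show ?case using n[of r] ni i(1) unfolding dist_real_def by linarith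
    qed
  qed
  then show ?thesis by blast
qed

context brownian_motion begin

lemma sde_increment_second_moment:
  assumes X: "sde_solution M F B {-1..1} a u x X" and st: "0 \<le> s" "s \<le> t"
  shows "(\<integral>\<omega>. (X t \<omega> - X s \<omega>)\<^sup>2 \<partial>M) = (\<integral>\<omega>. (X t \<omega>)\<^sup>2 \<partial>M) - (\<integral>\<omega>. (X s \<omega>)\<^sup>2 \<partial>M)"
proof -
  have t: "0 \<le> t" using st by simp
  have "integrable M (\<lambda>\<omega>. (X t \<omega>)\<^sup>2)" "integrable M (\<lambda>\<omega>. (X s \<omega>)\<^sup>2)"
    by (intro known_bounded_integrable[OF known_bounded_power[OF sde_known_bounded[OF X _ order_refl]]] t st)+
  then show ?thesis using sde_increment_square[OF X st known_bounded_const[of s 1]] by simp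
qed

text \<open>Kolmogorov's inequality by induction on the step. \<open>J n\<close> indicates that the
  level has been exceeded by step \<open>n\<close>: where it jumps to 1, \<open>Y\<^sup>2\<close>
  already pays \<open>c\<^sup>2\<close>, and where it equals 1, a martingale increment does not
  lower the mean of \<open>Y\<^sup>2\<close>.\<close>

lemma sde_maximal_inequality:
  assumes X: "sde_solution M F B {-1..1} a u x X" and t0: "0 \<le> t 0" and t: "\<And>k. t k \<le> t (Suc k)" and c: "0 < c"
  shows "{\<omega> \<in> space M. \<exists>k\<le>n. c < \<bar>X (t k) \<omega> - X (t 0) \<omega>\<bar>} \<in> sets M" (is "?A n \<in> _")
    and "prob {\<omega> \<in> space M. \<exists>k\<le>n. c < \<bar>X (t k) \<omega> - X (t 0) \<omega>\<bar>}
      \<le> ((\<integral>\<omega>. (X (t n) \<omega>)\<^sup>2 \<partial>M) - (\<integral>\<omega>. (X (t 0) \<omega>)\<^sup>2 \<partial>M)) / c\<^sup>2"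
proof -
  have mono: "t i \<le> t j" if "i \<le> j" for i j using lift_Suc_mono_le[of t, OF t that] .
  have nn: "0 \<le> t k" for k using mono[of 0 k] t0 by simp
  define Y where "Y k \<omega> = X (t k) \<omega> - X (t 0) \<omega>" for k \<omega>
  define J where "J n \<omega> = (if \<exists>k\<le>n. c < \<bar>Y k \<omega>\<bar> then 1 else 0 :: real)" for n \<omega>
  have kY: "known_bounded (t j) (Y i)" if "i \<le> j" for i j
    unfolding Y_def[abs_def] using that
    by (intro known_bounded_diff sde_known_bounded[OF X nn mono]) auto
  have JS: "J (Suc n) = (\<lambda>\<omega>. max (J n \<omega>) (if c < \<bar>Y (Suc n) \<omega>\<bar> then 1 else 0))" for n
    by (auto simp: J_def fun_eq_iff le_Suc_eq)
  have J01: "J n \<omega> = 0 \<or> J n \<omega> = 1" for n \<omega> by (simp add: J_def)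
  have Jm: "J n \<in> borel_measurable (F (t n))" for n
  proof (induction n)
    case 0
    note [measurable] = known_bounded_measurable[OF kY[of 0 0]]
    show ?case unfolding J_def[abs_def] by simp
  next
    case (Suc n)
    note [measurable] = known_bounded_measurable[OF kY[of "Suc n" "Suc n", OF order_refl]] measurable_F_mono[OF Suc nn t]
    show ?case unfolding JS by measurable
  qed
  have kJ: "known_bounded (t j) (J i)" if "i \<le> j" for i j
  proof -
    have "known_bounded (t i) (J i)" using Jm[of i] by (auto simp: known_bounded_def J_def intro!: exI[of _ 1])
    then show ?thesis by (rule known_bounded_mono[OF _ nn mono[OF that]])
  qed
  note [measurable] = known_bounded_measurable_M[OF kY[OF order_refl] nn] known_bounded_measurable_M[OF kJ[OF order_refl] nn]
  have AJ: "?A n = {\<omega> \<in> space M. J n \<omega> = 1}" for n by (auto simp: J_def Y_def)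
  show meas: "?A n \<in> sets M" for n unfolding AJ by measurable
  note I = known_bounded_integrable[OF _ nn]
  have main: "c\<^sup>2 * (\<integral>\<omega>. J n \<omega> \<partial>M) \<le> (\<integral>\<omega>. J n \<omega> * (Y n \<omega>)\<^sup>2 \<partial>M)" for n
  proof (induction n)
    case 0
    have "J 0 \<omega> = 0" for \<omega> using c by (simp add: J_def Y_def)
    then show ?case by simp
  next
    case (Suc n)
    define d where "d \<omega> = X (t (Suc n)) \<omega> - X (t n) \<omega>" for \<omega>
    have kd: "known_bounded (t (Suc n)) d"
      unfolding d_def[abs_def] by (intro known_bounded_diff sde_known_bounded[OF X nn mono]) auto
    have YS: "Y (Suc n) \<omega> = Y n \<omega> + d \<omega>" for \<omega> by (simp add: Y_def d_def)
    note kb = known_bounded_add known_bounded_diff known_bounded_mult known_bounded_power known_bounded_const kd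
      kJ[of n "Suc n"] kJ[of "Suc n" "Suc n"] kY[of n "Suc n"] kY[of "Suc n" "Suc n"]
    have 0: "(\<integral>\<omega>. (J n \<omega> * (2 * Y n \<omega>)) * d \<omega> \<partial>M) = 0"
      unfolding d_def by (rule sde_increment_mean[OF X nn t]) (intro known_bounded_mult known_bounded_const kJ kY order_refl)
    have i1: "integrable M (\<lambda>\<omega>. J n \<omega> * (Y n \<omega>)\<^sup>2)" by (rule I[of "Suc n"], intro kb) auto
    have i2: "integrable M (\<lambda>\<omega>. (J n \<omega> * (2 * Y n \<omega>)) * d \<omega>)" by (rule I[of "Suc n"], intro kb) auto
    have i3: "integrable M (\<lambda>\<omega>. c\<^sup>2 * (J (Suc n) \<omega> - J n \<omega>))" by (rule I[of "Suc n"], intro kb) auto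
    have i4: "integrable M (\<lambda>\<omega>. J (Suc n) \<omega> * (Y (Suc n) \<omega>)\<^sup>2)" by (rule I[of "Suc n"], intro kb) auto
    have iJ: "integrable M (J n)" "integrable M (J (Suc n))" by (rule I[of "Suc n"], intro kJ, simp)+
    have "c\<^sup>2 * (\<integral>\<omega>. J (Suc n) \<omega> \<partial>M) = c\<^sup>2 * (\<integral>\<omega>. J n \<omega> \<partial>M) + (\<integral>\<omega>. c\<^sup>2 * (J (Suc n) \<omega> - J n \<omega>) \<partial>M)"
      using iJ by (simp add: algebra_simps)
    also have "\<dots> \<le> (\<integral>\<omega>. J n \<omega> * (Y n \<omega>)\<^sup>2 \<partial>M) + (\<integral>\<omega>. (J n \<omega> * (2 * Y n \<omega>)) * d \<omega> \<partial>M) + (\<integral>\<omega>. c\<^sup>2 * (J (Suc n) \<omega> - J n \<omega>) \<partial>M)"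
      using Suc 0 by simp
    also have "\<dots> = (\<integral>\<omega>. J n \<omega> * (Y n \<omega>)\<^sup>2 + (J n \<omega> * (2 * Y n \<omega>)) * d \<omega> + c\<^sup>2 * (J (Suc n) \<omega> - J n \<omega>) \<partial>M)"
      using i1 i2 i3 by simp
    also have "\<dots> \<le> (\<integral>\<omega>. J (Suc n) \<omega> * (Y (Suc n) \<omega>)\<^sup>2 \<partial>M)"
    proof (rule integral_mono)
      fix \<omega>
      consider "J n \<omega> = 1" "J (Suc n) \<omega> = 1" | "J n \<omega> = 0" "J (Suc n) \<omega> = 1" "c < \<bar>Y (Suc n) \<omega>\<bar>" | "J n \<omega> = 0" "J (Suc n) \<omega> = 0"
        by (cases "c < \<bar>Y (Suc n) \<omega>\<bar>"; use J01[of n \<omega>] JS[of n] in \<open>auto simp: fun_eq_iff\<close>)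
      then show "J n \<omega> * (Y n \<omega>)\<^sup>2 + (J n \<omega> * (2 * Y n \<omega>)) * d \<omega> + c\<^sup>2 * (J (Suc n) \<omega> - J n \<omega>) \<le> J (Suc n) \<omega> * (Y (Suc n) \<omega>)\<^sup>2"
      proof cases
        case 1
        have "(Y n \<omega>)\<^sup>2 + 2 * Y n \<omega> * d \<omega> \<le> (Y n \<omega> + d \<omega>)\<^sup>2" by (simp add: power2_sum)
        then show ?thesis using 1 by (simp add: YS)
      next
        case 2
        have "c\<^sup>2 \<le> \<bar>Y (Suc n) \<omega>\<bar>\<^sup>2" using 2 c by (intro power_mono) auto
        then show ?thesis using 2 by simp
      qed simp
    qed (use i1 i2 i3 i4 in auto)
    finally show ?case .
  qed
  have "c\<^sup>2 * prob (?A n) = c\<^sup>2 * (\<integral>\<omega>. J n \<omega> \<partial>M)"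
  proof -
    define S where "S = ?A n"
    have "J n \<omega> = indicator S \<omega>" if "\<omega> \<in> space M" for \<omega>
      using that by (simp add: J_def Y_def S_def)
    then have "(\<integral>\<omega>. J n \<omega> \<partial>M) = (\<integral>\<omega>. indicator S \<omega> \<partial>M)"
      by (rule Bochner_Integration.integral_cong[OF refl])
    also have "\<dots> = prob S"
      by (simp add: S_def Int_absorb2 Collect_restrict)
    finally show ?thesis by (simp only: S_def)
  qed
  also note main
  also have "(\<integral>\<omega>. J n \<omega> * (Y n \<omega>)\<^sup>2 \<partial>M) \<le> (\<integral>\<omega>. (Y n \<omega>)\<^sup>2 \<partial>M)"
  proof (rule integral_mono)
    show "integrable M (\<lambda>\<omega>. J n \<omega> * (Y n \<omega>)\<^sup>2)" by (rule I[of n], intro known_bounded_mult known_bounded_power kJ kY order_refl)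
    show "integrable M (\<lambda>\<omega>. (Y n \<omega>)\<^sup>2)" by (rule I[of n], intro known_bounded_power kY order_refl)
  qed (simp add: J_def)
  also have "\<dots> = (\<integral>\<omega>. (X (t n) \<omega>)\<^sup>2 \<partial>M) - (\<integral>\<omega>. (X (t 0) \<omega>)\<^sup>2 \<partial>M)"
    unfolding Y_def by (rule sde_increment_second_moment[OF X nn mono]) simp
  finally show "prob (?A n) \<le> ((\<integral>\<omega>. (X (t n) \<omega>)\<^sup>2 \<partial>M) - (\<integral>\<omega>. (X (t 0) \<omega>)\<^sup>2 \<partial>M)) / c\<^sup>2"
    using c by (simp add: field_simps)
qed

lemma sde_second_moment_bounds:
  assumes X: "sde_solution M F B {-1..1} a u x X" and st: "0 \<le> s" "s \<le> t"
  shows "(\<integral>\<omega>. (X s \<omega>)\<^sup>2 \<partial>M) \<le> (\<integral>\<omega>. (X t \<omega>)\<^sup>2 \<partial>M)" "(\<integral>\<omega>. (X t \<omega>)\<^sup>2 \<partial>M) \<le> 1"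
proof -
  have "0 \<le> (\<integral>\<omega>. (X t \<omega> - X s \<omega>)\<^sup>2 \<partial>M)" by simp
  then show "(\<integral>\<omega>. (X s \<omega>)\<^sup>2 \<partial>M) \<le> (\<integral>\<omega>. (X t \<omega>)\<^sup>2 \<partial>M)" using sde_increment_second_moment[OF X st] by linarith
  have t: "0 \<le> t" using st by simp
  have "AE \<omega> in M. \<forall>t\<ge>0. X t \<omega> \<in> {-1..1}" using X by (simp add: sde_solution_def)
  then have "AE \<omega> in M. (X t \<omega>)\<^sup>2 \<le> 1"
    by eventually_elim (use t in \<open>auto simp: abs_square_le_1 abs_le_iff minus_le_iff\<close>)
  then have "(\<integral>\<omega>. (X t \<omega>)\<^sup>2 \<partial>M) \<le> (\<integral>\<omega>. 1 \<partial>M)"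
    by (intro integral_mono_AE known_bounded_integrable[OF known_bounded_power[OF sde_known_bounded[OF X t order_refl]] t]) auto
  then show "(\<integral>\<omega>. (X t \<omega>)\<^sup>2 \<partial>M) \<le> 1" by (simp add: prob_space)
qed

text \<open>Second moments increase and are bounded, so their increase after time \<open>n\<close>
  becomes arbitrarily small. By the maximal inequality, so does the probability of a later deviation
  by more than \<open>c\<close>, first on dyadic grids and then, by continuity of the paths, at all
  times.\<close>

lemma sde_oscillation:
  assumes X: "sde_solution M F B {-1..1} a u x X" and c: "0 < c"
  shows "AE \<omega> in M. \<exists>n::nat. \<forall>r\<ge>real n. \<bar>X r \<omega> - X (real n) \<omega>\<bar> \<le> c"
proof -
  define V where "V s = (\<integral>\<omega>. (X s \<omega>)\<^sup>2 \<partial>M)" for s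
  have Vm: "V s \<le> V t" if "0 \<le> s" "s \<le> t" for s t unfolding V_def by (rule sde_second_moment_bounds[OF X that])
  have V1: "V t \<le> 1" if "0 \<le> t" for t unfolding V_def by (rule sde_second_moment_bounds(2)[OF X order_refl that])
  have "incseq (\<lambda>n. V (real n))" by (auto simp: incseq_def intro!: Vm)
  moreover have "\<And>i. V (real i) \<le> 1" by (intro V1) simp
  ultimately obtain L where L: "(\<lambda>n. V (real n)) \<longlonglongrightarrow> L" "\<And>i. V (real i) \<le> L" using incseq_convergent by blast
  have VL: "V t \<le> L" if "0 \<le> t" for t
  proof -
    obtain i :: nat where "t \<le> real i" using real_arch_simple by blast
    then show ?thesis using Vm[OF that, of "real i"] L(2)[of i] by simp
  qed
  define \<tau> where "\<tau> n m k = real n + real k / 2 ^ m" for n m k :: nat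
  have \<tau>0: "\<tau> n m 0 = real n" for n m by (simp add: \<tau>_def)
  have \<tau>s: "\<tau> n m k \<le> \<tau> n m (Suc k)" for n m k by (simp add: \<tau>_def divide_right_mono)
  \<comment> \<open>With mesh \<open>1 / 2 ^ m\<close> the \<open>4 ^ m\<close> steps reach the time
    \<open>n + 2 ^ m\<close>: refining the grid also pushes the horizon to infinity, while the
    events still increase in \<open>m\<close>.\<close>
  define G where "G n m = {\<omega> \<in> space M. \<exists>k\<le>4 ^ m. c < \<bar>X (\<tau> n m k) \<omega> - X (\<tau> n m 0) \<omega>\<bar>}" for n m :: nat
  have Gm: "G n m \<in> sets M" for n m
    unfolding G_def by (rule sde_maximal_inequality(1)[OF X, where t="\<tau> n m"]) (auto simp: \<tau>0 \<tau>s c)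
  have Gp: "prob (G n m) \<le> (L - V (real n)) / c\<^sup>2" for n m
  proof -
    have "prob (G n m) \<le> (V (\<tau> n m (4 ^ m)) - V (\<tau> n m 0)) / c\<^sup>2"
      unfolding G_def V_def by (rule sde_maximal_inequality(2)[OF X, where t="\<tau> n m"]) (auto simp: \<tau>0 \<tau>s c)
    also have "\<dots> \<le> (L - V (real n)) / c\<^sup>2"
      by (intro divide_right_mono diff_mono VL) (auto simp: \<tau>0 \<tau>_def)
    finally show ?thesis .
  qed
  have Ginc: "incseq (G n)" for n
  proof (rule incseq_SucI)
    fix m
    show "G n m \<subseteq> G n (Suc m)"
    proof
      fix \<omega> assume "\<omega> \<in> G n m"
      then obtain k where k: "\<omega> \<in> space M" "k \<le> 4 ^ m" "c < \<bar>X (\<tau> n m k) \<omega> - X (\<tau> n m 0) \<omega>\<bar>" by (auto simp: G_def)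
      have "\<tau> n m k = \<tau> n (Suc m) (2 * k)" by (simp add: \<tau>_def)
      then show "\<omega> \<in> G n (Suc m)" using k by (auto simp: G_def \<tau>0 intro!: exI[of _ "2 * k"])
    qed
  qed
  have Up: "prob (\<Union>m. G n m) \<le> (L - V (real n)) / c\<^sup>2" for n
    by (rule LIMSEQ_le_const2[OF finite_Lim_measure_incseq[OF _ Ginc]]) (use Gm Gp in auto)
  have UM: "(\<Union>m. G n m) \<in> sets M" for n using Gm by auto
  have "prob (\<Inter>n. \<Union>m. G n m) = 0"
  proof (rule antisym)
    have "(\<lambda>n. (L - V (real n)) / c\<^sup>2) \<longlonglongrightarrow> (L - L) / c\<^sup>2" using c by (intro tendsto_intros L) auto
    moreover have "prob (\<Inter>n. \<Union>m. G n m) \<le> (L - V (real n)) / c\<^sup>2" for n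
    proof -
      have "prob (\<Inter>n. \<Union>m. G n m) \<le> prob (\<Union>m. G n m)"
        using UM by (intro finite_measure_mono) auto
      then show ?thesis using Up[of n] by simp
    qed
    ultimately show "prob (\<Inter>n. \<Union>m. G n m) \<le> 0" by (intro LIMSEQ_le_const) auto
  qed simp
  moreover have "(\<Inter>n. \<Union>m. G n m) \<in> sets M" using UM by auto
  ultimately have "(\<Inter>n. \<Union>m. G n m) \<in> null_sets M"
    by (auto simp: null_sets_def emeasure_eq_measure)
  then have "AE \<omega> in M. \<omega> \<notin> (\<Inter>n. \<Union>m. G n m)" by (rule AE_not_in)
  moreover have "AE \<omega> in M. continuous_on {0..} (\<lambda>t. X t \<omega>)" using X by (simp add: sde_solution_def)
  ultimately show ?thesis
    using AE_space
  proof eventually_elim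
    case (elim \<omega>)
    from elim(1) obtain n where n: "\<And>m. \<omega> \<notin> G n m" by blast
    have dy: "\<bar>X (\<tau> n m k) \<omega> - X (real n) \<omega>\<bar> \<le> c" for m k
    proof -
      \<comment> \<open>A dyadic time beyond the horizon of level \<open>m\<close> is reached on a
        finer level. The choice \<open>j = k\<close> is ample, since then \<open>k * 2 ^ j\<close>
        is at most \<open>4 ^ j\<close>.\<close>
      define j where "j = k"
      have j: "k \<le> 2 ^ j" unfolding j_def using less_exp[of k] by (rule less_imp_le)
      have "k * 2 ^ j \<le> 2 ^ j * 2 ^ j" using j by simp
      also have "\<dots> = (4::nat) ^ j" by (simp add: power_mult_distrib[symmetric])
      also have "\<dots> \<le> 4 ^ (m + j)" by (intro power_increasing) auto
      finally have "k * 2 ^ j \<le> 4 ^ (m + j)" .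
      moreover have "\<tau> n m k = \<tau> n (m + j) (k * 2 ^ j)" by (simp add: \<tau>_def power_add)
      ultimately show ?thesis using n[of "m + j"] elim(3) by (auto simp: G_def \<tau>0 not_less)
    qed
    have "\<bar>X r \<omega> - X (real n) \<omega>\<bar> \<le> c" if r: "real n \<le> r" for r
    proof -
      define k where "k m = nat \<lfloor>(r - real n) * 2 ^ m\<rfloor>" for m
      have "(\<lambda>m. \<tau> n m (k m)) \<longlonglongrightarrow> r"
      proof (rule tendsto_sandwich)
        have "r - (1 / 2) ^ m \<le> \<tau> n m (k m) \<and> \<tau> n m (k m) \<le> r" for m
        proof -
          have "0 \<le> (r - real n) * 2 ^ m" using r by simp
          then have "real (k m) = of_int \<lfloor>(r - real n) * 2 ^ m\<rfloor>" by (simp add: k_def)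
          then have le: "real (k m) \<le> (r - real n) * 2 ^ m" "(r - real n) * 2 ^ m - 1 \<le> real (k m)" by linarith+
          have 1: "real (k m) / 2 ^ m \<le> r - real n" using le(1) by (simp add: pos_divide_le_eq)
          have "(r - real n - 1 / 2 ^ m) * 2 ^ m = (r - real n) * 2 ^ m - 1" by (simp add: left_diff_distrib)
          then have "r - real n - 1 / 2 ^ m \<le> real (k m) / 2 ^ m" using le(2) by (simp add: pos_le_divide_eq)
          then show ?thesis using 1 unfolding \<tau>_def power_one_over[symmetric] by linarith
        qed
        then show "eventually (\<lambda>m. r - (1/2)^m \<le> \<tau> n m (k m)) sequentially" "eventually (\<lambda>m. \<tau> n m (k m) \<le> r) sequentially" by auto
        have "(\<lambda>m. r - (1/2)^m) \<longlonglongrightarrow> r - 0" by (intro tendsto_diff tendsto_const LIMSEQ_power_zero) auto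
        then show "(\<lambda>m. r - (1/2)^m) \<longlonglongrightarrow> r" by simp
      qed simp
      then have "(\<lambda>m. X (\<tau> n m (k m)) \<omega>) \<longlonglongrightarrow> X r \<omega>"
        by (rule continuous_on_tendsto_compose[OF elim(2)]) (use r in \<open>auto simp: \<tau>_def\<close>)
      then have "(\<lambda>m. \<bar>X (\<tau> n m (k m)) \<omega> - X (real n) \<omega>\<bar>) \<longlonglongrightarrow> \<bar>X r \<omega> - X (real n) \<omega>\<bar>"
        by (intro tendsto_intros)
      then show ?thesis by (rule LIMSEQ_le_const2) (use dy in auto)
    qed
    then show ?case by blast
  qed
qed

text \<open>The countably many tolerances \<open>inverse (real (Suc j))\<close> exchange "for each
  tolerance, almost surely" for "almost surely, for each tolerance".\<close>

lemma sde_convergent: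
  assumes X: "sde_solution M F B {-1..1} a u x X"
  shows "AE \<omega> in M. \<exists>l. ((\<lambda>t. X t \<omega>) \<longlongrightarrow> l) at_top"
proof -
  have "AE \<omega> in M. \<forall>j. \<exists>n::nat. \<forall>r\<ge>real n. \<bar>X r \<omega> - X (real n) \<omega>\<bar> \<le> inverse (real (Suc j))"
    unfolding AE_all_countable by (intro allI sde_oscillation[OF X]) simp
  then show ?thesis
  proof eventually_elim
    case (elim \<omega>)
    show ?case
    proof (rule convergent_at_top_of_oscillation)
      fix c :: real assume "0 < c"
      then obtain j where j: "inverse (real (Suc j)) < c" using reals_Archimedean by blast
      obtain n :: nat where "\<And>r. r \<ge> real n \<Longrightarrow> \<bar>X r \<omega> - X (real n) \<omega>\<bar> \<le> inverse (real (Suc j))" using elim by blast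
      then show "\<exists>n::nat. \<forall>r\<ge>real n. \<bar>X r \<omega> - X (real n) \<omega>\<bar> \<le> c" using j by (meson less_imp_le order_trans)
    qed
  qed
qed

text \<open>By the isometry \<open>u \<bullet> u\<close> times the time integral of the mean of
  \<open>a(X)\<^sup>2\<close> never exceeds 1. The integrand converges to the mean of
  \<open>a(\<sigma>)\<^sup>2\<close>, which must therefore be 0, so \<open>\<sigma>\<close> is a
  zero of \<open>a\<close>.\<close>

lemma sde_limit_absorbed:
  assumes X: "sde_solution M F B {-1..1} a u 0 X" and a[measurable]: "a \<in> borel_measurable borel" and ac: "continuous_on {-1..1} a"
    and a0: "\<And>x. \<bar>x\<bar> < 1 \<Longrightarrow> a x \<noteq> 0" and u: "u \<noteq> 0" and \<sigma>[measurable]: "\<sigma> \<in> borel_measurable M"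
    and lim: "AE \<omega> in M. \<forall>l. ((\<lambda>t. X t \<omega>) \<longlongrightarrow> l) at_top \<longrightarrow> \<sigma> \<omega> = l"
  shows "AE \<omega> in M. ((\<lambda>t. X t \<omega>) \<longlongrightarrow> \<sigma> \<omega>) at_top \<and> \<sigma> \<omega> \<in> {-1, 1}"
proof -
  have conv: "AE \<omega> in M. ((\<lambda>t. X t \<omega>) \<longlongrightarrow> \<sigma> \<omega>) at_top"
    using lim sde_convergent[OF X] by eventually_elim blast
  have AX: "AE \<omega> in M. \<forall>t\<ge>0. X t \<omega> \<in> {-1..1}" using X by (simp add: sde_solution_def)
  have sI: "AE \<omega> in M. \<sigma> \<omega> \<in> {-1..1}"
    using conv AX
  proof eventually_elim
    case (elim \<omega>)
    show ?case
      by (rule Lim_in_closed_set[OF closed_atLeastAtMost _ _ elim(1)])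
         (use elim(2) in \<open>auto intro!: eventually_mono[OF eventually_ge_at_top[of 0]]\<close>)
  qed
  obtain A where A: "0 < A" "\<And>x. x \<in> {-1..1} \<Longrightarrow> \<bar>a x\<bar> \<le> A"
    using compact_continuous_bound[OF compact_Icc ac] by blast
  define e where "e t = (\<integral>\<omega>. 1 * (a (X t \<omega>) * a (X t \<omega>)) \<partial>M)" for t
  define f where "f = (\<integral>\<omega>. a (\<sigma> \<omega>) * a (\<sigma> \<omega>) \<partial>M)"
  \<comment> \<open>\<open>max 0\<close> keeps the times nonnegative, since the process is
    constrained only there.\<close>
  have lim_e: "((\<lambda>t. e (max 0 t)) \<longlongrightarrow> f) at_top"
  proof (rule tendsto_at_topI_sequentially)
    fix \<rho> :: "nat \<Rightarrow> real" assume \<rho>: "filterlim \<rho> at_top sequentially"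
    have \<rho>': "filterlim (\<lambda>n. max 0 (\<rho> n)) at_top sequentially"
      by (rule filterlim_at_top_mono[OF \<rho>]) auto
    show "(\<lambda>n. e (max 0 (\<rho> n))) \<longlonglongrightarrow> f"
      unfolding e_def f_def mult_1_left
    proof (rule integral_dominated_convergence[where w="\<lambda>_. A * A"])
      fix n :: nat
      have p: "0 \<le> max 0 (\<rho> n)" by simp
      note [measurable] = sde_measurable[OF X p]
      show "(\<lambda>\<omega>. a (X (max 0 (\<rho> n)) \<omega>) * a (X (max 0 (\<rho> n)) \<omega>)) \<in> borel_measurable M" by measurable
      show "AE \<omega> in M. norm (a (X (max 0 (\<rho> n)) \<omega>) * a (X (max 0 (\<rho> n)) \<omega>)) \<le> A * A"
        using AX
      proof eventually_elim
        case (elim \<omega>)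
        have "\<bar>a (X (max 0 (\<rho> n)) \<omega>)\<bar> \<le> A" using elim p by (intro A) blast
        then show ?case unfolding real_norm_def abs_mult by (intro mult_mono) (use A in auto)
      qed
    next
      show "AE \<omega> in M. (\<lambda>n. a (X (max 0 (\<rho> n)) \<omega>) * a (X (max 0 (\<rho> n)) \<omega>)) \<longlonglongrightarrow> a (\<sigma> \<omega>) * a (\<sigma> \<omega>)"
        using conv AX sI
      proof eventually_elim
        case (elim \<omega>)
        have l: "(\<lambda>n. X (max 0 (\<rho> n)) \<omega>) \<longlonglongrightarrow> \<sigma> \<omega>"
          by (rule filterlim_compose[OF elim(1) \<rho>'])
        have m: "\<forall>n. X (max 0 (\<rho> n)) \<omega> \<in> {-1..1}" using elim(2) max.cobounded1 by blast
        have "(\<lambda>n. a (X (max 0 (\<rho> n)) \<omega>)) \<longlonglongrightarrow> a (\<sigma> \<omega>)"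
          by (rule continuous_on_tendsto_compose[OF ac l elim(3)]) (use m in auto)
        then show ?case by (intro tendsto_mult)
      qed
    qed (use a \<sigma> in auto)
  qed
  have ec: "continuous_on {0..T} e" for T
  proof -
    have "continuous_on {0..T} (\<lambda>r. \<integral>\<omega>. 1 * (case (X r \<omega>, X r \<omega>) of (x, y) \<Rightarrow> a x * a y) \<partial>M)"
    proof (rule compact_process_continuous[OF sde_compact_process_pair[OF X X compact_Icc], where C=1])
      show "(\<lambda>(x, y). a x * a y) \<in> borel_measurable borel" by (simp add: borel_prod[symmetric])
      show "continuous_on ({-1..1} \<times> {-1..1}) (\<lambda>(x, y). a x * a y)"
        unfolding case_prod_beta by (intro continuous_intros continuous_on_compose2[OF ac]) auto
    qed auto
    then show ?thesis by (simp add: e_def[abs_def])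
  qed
  have bound: "(u \<bullet> u) * integral {0..T} e \<le> 1" if T: "0 \<le> T" for T
  proof -
    have "(\<integral>\<omega>. 1 * ((X T \<omega> - X 0 \<omega>) * (X T \<omega> - X 0 \<omega>)) \<partial>M) = (u \<bullet> u) * integral {0..T} e"
      unfolding e_def[abs_def] by (rule sde_increment_covariance[OF X X compact_Icc a ac order_refl T known_bounded_const])
    moreover have "(\<integral>\<omega>. (X T \<omega> - X 0 \<omega>)\<^sup>2 \<partial>M) \<le> 1"
    proof -
      have "0 \<le> (\<integral>\<omega>. (X 0 \<omega>)\<^sup>2 \<partial>M)" by simp
      then show ?thesis
        using sde_increment_second_moment[OF X order_refl T] sde_second_moment_bounds(2)[OF X order_refl T] by linarith
    qed
    ultimately show ?thesis by (simp add: power2_eq_square)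
  qed
  have e0: "0 \<le> e t" for t by (simp add: e_def)
  have "f \<le> 0"
  proof (rule ccontr)
    assume "\<not> f \<le> 0"
    then have f: "0 < f" by simp
    have uu: "0 < u \<bullet> u" using u by simp
    have "eventually (\<lambda>t. f / 2 < e (max 0 t)) at_top"
      by (rule order_tendstoD(1)[OF lim_e]) (use f in simp)
    then obtain T1 where T1: "\<And>t. t \<ge> T1 \<Longrightarrow> f / 2 < e (max 0 t)" unfolding eventually_at_top_linorder by blast
    define T0 where "T0 = max 0 T1"
    have T0: "0 \<le> T0" "\<And>t. t \<ge> T0 \<Longrightarrow> f / 2 \<le> e t"
    proof -
      show "0 \<le> T0" by (simp add: T0_def)
      fix t assume "T0 \<le> t"
      then have "T1 \<le> t" "max 0 t = t" by (auto simp: T0_def)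
      then show "f / 2 \<le> e t" using T1[of t] by simp
    qed
    \<comment> \<open>Long enough that an integrand of at least \<open>f / 2\<close> after
      \<open>T0\<close>, multiplied by \<open>u \<bullet> u\<close>, accumulates to 2, above the
      bound 1.\<close>
    define T where "T = T0 + 4 / (f * (u \<bullet> u))"
    have pos: "0 < 4 / (f * (u \<bullet> u))" using f uu by simp
    have TT: "T0 \<le> T" "0 \<le> T" using pos T0 by (auto simp: T_def)
    have int: "e integrable_on {0..T}" by (rule integrable_continuous_real[OF ec])
    have int2: "e integrable_on {T0..T}" "e integrable_on {0..T0}"
      using T0 TT by (auto intro!: integrable_continuous_real continuous_on_subset[OF ec[of T]])
    have "integral {T0..T} (\<lambda>_. f / 2) \<le> integral {T0..T} e"
      by (rule Henstock_Kurzweil_Integration.integral_le[OF _ int2(1)]) (use T0 in auto)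
    then have "(T - T0) * (f / 2) \<le> integral {T0..T} e" using TT by simp
    moreover have "0 \<le> integral {0..T0} e" by (rule Henstock_Kurzweil_Integration.integral_nonneg[OF int2(2)]) (use e0 in auto)
    moreover have "integral {0..T0} e + integral {T0..T} e = integral {0..T} e"
      by (rule Henstock_Kurzweil_Integration.integral_combine[OF T0(1) TT(1) int])
    ultimately have "(T - T0) * (f / 2) \<le> integral {0..T} e" by linarith
    then have "(u \<bullet> u) * ((T - T0) * (f / 2)) \<le> (u \<bullet> u) * integral {0..T} e" using uu by (intro mult_left_mono) auto
    moreover have "(u \<bullet> u) * ((T - T0) * (f / 2)) = 2" using f uu by (simp add: T_def)
    ultimately show False using bound[OF TT(2)] by linarith
  qed
  moreover have "0 \<le> f" by (simp add: f_def)
  ultimately have "f = 0" by simp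
  have "AE \<omega> in M. norm (a (\<sigma> \<omega>) * a (\<sigma> \<omega>)) \<le> A * A"
    using sI
  proof eventually_elim
    case (elim \<omega>)
    from A(2)[OF this] show ?case unfolding real_norm_def abs_mult by (intro mult_mono) (use A in auto)
  qed
  then have "integrable M (\<lambda>\<omega>. a (\<sigma> \<omega>) * a (\<sigma> \<omega>))"
    by (rule integrable_const_bound) (use a \<sigma> in measurable)
  from integral_nonneg_eq_0_iff_AE[OF this] \<open>f = 0\<close> have "AE \<omega> in M. a (\<sigma> \<omega>) * a (\<sigma> \<omega>) = 0"
    by (simp add: f_def)
  with conv sI show ?thesis
  proof eventually_elim
    case (elim \<omega>)
    have "\<not> \<bar>\<sigma> \<omega>\<bar> < 1" using elim(3) a0 by fastforce
    then show ?case using elim(1,2) by auto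
  qed
qed

end

section \<open>Gaussian derivatives as functions on the state space\<close>

lemma Phi_eq_cdf: "Phi x = cdf std_normal_distribution x"
proof -
  have "cdf std_normal_distribution x = (\<integral>s. indicator {..x} s \<partial>std_normal_distribution)"
    by (simp add: cdf_def)
  also have "\<dots> = (\<integral>s. std_normal_density s *\<^sub>R indicator {..x} s \<partial>lborel)"
    by (rule integral_density) auto
  finally have "cdf std_normal_distribution x = (\<integral>s. indicator {..x} s *\<^sub>R std_normal_density s \<partial>lborel)"
    by (simp add: mult.commute)
  then show ?thesis
    by (simp add: Phi_def set_lebesgue_integral_def std_normal_density_def mult.left_commute)
qed

lemma Phi_tendsto_at_bot: "(Phi \<longlongrightarrow> 0) at_bot"
  using finite_borel_measure.cdf_lim_at_bot[of std_normal_distribution] real_dist_normal_dist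
  by (simp add: Phi_eq_cdf[abs_def] real_distribution.axioms real_distribution.finite_borel_measure_M)

lemma Phi_tendsto_at_top: "(Phi \<longlongrightarrow> 1) at_top"
  using real_distribution.cdf_lim_at_top_prob[OF real_dist_normal_dist]
  by (simp add: Phi_eq_cdf[abs_def])

lemma std_normal_density_continuous: "continuous_on A std_normal_density"
  unfolding std_normal_density_def[abs_def] by (intro continuous_intros) auto

lemma Phi_diff:
  assumes "a \<le> b"
  shows "Phi b - Phi a = integral {a..b} std_normal_density"
proof -
  have i: "set_integrable lborel A std_normal_density" if "A \<in> sets borel" for A
    unfolding set_integrable_def using that by (intro integrable_mult_indicator) auto
  have P: "Phi x = (LINT s:{..x}|lborel. std_normal_density s)" for x
    by (simp add: Phi_def set_lebesgue_integral_def std_normal_density_def mult.left_commute)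
  have eq: "{..b} = {..a} \<union> {a<..b}" using assms by auto
  have "(LINT s:{..a} \<union> {a<..b}|lborel. std_normal_density s)
      = (LINT s:{..a}|lborel. std_normal_density s) + (LINT s:{a<..b}|lborel. std_normal_density s)"
    by (rule set_integral_Un[OF _ i i]) auto
  then have "Phi b = Phi a + (LINT s:{a<..b}|lborel. std_normal_density s)"
    unfolding P[of a] P[of b] eq[symmetric] .
  also have "(LINT s:{a<..b}|lborel. std_normal_density s) = integral {a<..b} std_normal_density"
    by (rule set_borel_integral_eq_integral(2)[OF i]) simp
  also have "\<dots> = integral {a..b} std_normal_density"
    by (rule integral_spike_set; rule negligible_subset[OF negligible_sing[of a]]) auto
  finally show ?thesis by simp
qed

lemma Phi_deriv: "(Phi has_real_derivative std_normal_density x) (at x)"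
proof -
  have "((\<lambda>y. integral {x - 1..y} std_normal_density) has_real_derivative std_normal_density x) (at x within {x - 1..x + 1})"
    by (rule integral_has_real_derivative[OF std_normal_density_continuous]) simp
  then have "((\<lambda>y. Phi (x - 1) + integral {x - 1..y} std_normal_density) has_real_derivative 0 + std_normal_density x) (at x within {x - 1..x + 1})"
    by (intro DERIV_add DERIV_const)
  then have "(Phi has_real_derivative 0 + std_normal_density x) (at x within {x - 1..x + 1})"
    by (rule has_field_derivative_transform_within[where d=1]) (auto simp: Phi_diff[symmetric])
  then show ?thesis by (subst (asm) at_within_Icc_at) auto
qed

lemma Phi_strict_mono: "x < y \<Longrightarrow> Phi x < Phi y"
  by (rule DERIV_pos_imp_increasing) (use Phi_deriv normal_density_pos[of 1 0] in auto)

lemma Phi_less_iff: "Phi x < Phi y \<longleftrightarrow> x < y"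
  using Phi_strict_mono[of x y] Phi_strict_mono[of y x] by (cases x y rule: linorder_cases) auto

lemma inv_Phi_Phi[simp]: "inv Phi (Phi x) = x"
  by (rule inv_f_f, rule linorder_injI) (simp add: Phi_strict_mono less_imp_neq)

lemma Phi_isCont: "isCont Phi x"
  using Phi_deriv by (rule DERIV_isCont)

lemma Phi_bounds: "0 < Phi x" "Phi x < 1"
proof -
  have "0 \<le> Phi (x - 1)"
    unfolding Phi_eq_cdf cdf_def by simp
  then show "0 < Phi x" using Phi_strict_mono[of "x - 1" x] by simp
  have "Phi (x + 1) \<le> 1"
    unfolding Phi_eq_cdf cdf_def
    using prob_space.prob_le_1[OF real_distribution.axioms(1)[OF real_dist_normal_dist]] by simp
  then show "Phi x < 1" using Phi_strict_mono[of x "x + 1"] by simp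
qed

lemma Phi_surj:
  assumes "0 < p" "p < 1"
  shows "\<exists>x. Phi x = p"
proof -
  obtain a where a: "Phi a < p"
    using order_tendstoD(2)[OF Phi_tendsto_at_bot assms(1)] by (auto simp: eventually_at_bot_linorder)
  obtain b where b: "p < Phi b"
    using order_tendstoD(1)[OF Phi_tendsto_at_top assms(2)] by (auto simp: eventually_at_top_linorder)
  have "Phi a < Phi b" using a b by simp
  then have "a \<le> b" by (simp add: Phi_less_iff)
  then show ?thesis using IVT'[of Phi a p b] a b Phi_isCont by (auto intro: continuous_at_imp_continuous_on)
qed

lemma Phi_inv_Phi: "0 < p \<Longrightarrow> p < 1 \<Longrightarrow> Phi (inv Phi p) = p"
  using Phi_surj by (metis inv_Phi_Phi)

text \<open>Reflection symmetry of the density gives \<open>Phi 0 = 1 - Phi 0\<close>. It makes the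
  state 0 correspond to the Gaussian coordinate 0, so initial values of observables are Gaussian
  derivatives at 0.\<close>

lemma Phi_0: "Phi 0 = 1 / 2"
proof -
  have P: "Phi x = (LINT s:{..x}|lborel. std_normal_density s)" for x
    by (simp add: Phi_def set_lebesgue_integral_def std_normal_density_def mult.left_commute)
  have i: "integrable lborel (\<lambda>s. indicator A s *\<^sub>R std_normal_density s)" if "A \<in> sets borel" for A
    using that by (intro integrable_mult_indicator) auto
  have "Phi 0 = (\<integral>s. indicator {..0} s *\<^sub>R std_normal_density s \<partial>lborel)"
    by (simp add: P set_lebesgue_integral_def)
  also have "\<dots> = (\<integral>s. indicator {..0} (- s) *\<^sub>R std_normal_density (- s) \<partial>lborel)"
    using lborel_integral_real_affine[of "-1" "\<lambda>s. indicator {..0} s *\<^sub>R std_normal_density s" 0] by simp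
  also have "\<dots> = (\<integral>s. indicator {0..} s *\<^sub>R std_normal_density s \<partial>lborel)"
    by (intro Bochner_Integration.integral_cong) (auto simp: indicator_def std_normal_density_def)
  also have "\<dots> = (\<integral>s. std_normal_density s - indicator {..0} s *\<^sub>R std_normal_density s \<partial>lborel)"
  proof (rule integral_cong_AE)
    show "AE s in lborel. indicator {0..} s *\<^sub>R std_normal_density s = std_normal_density s - indicator {..0} s *\<^sub>R std_normal_density s"
      using AE_lborel_singleton[of 0] by eventually_elim (auto simp: indicator_def)
  qed (use i in auto)
  also have "\<dots> = 1 - Phi 0"
    using i[of "{..0}"] by (simp add: P set_lebesgue_integral_def)
  finally show ?thesis by simp
qed

text \<open>The functions \<open>2 \<phi>\<^sup>(\<^sup>n\<^sup>)\<close>, where \<open>\<phi>\<close> is the standard Gaussian density.\<close>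

fun gauss_deriv :: "nat \<Rightarrow> real \<Rightarrow> real" where
  "gauss_deriv 0 y = sqrt (2 / pi) * exp (- (1 / 2) * y\<^sup>2)"
| "gauss_deriv (Suc 0) y = - y * gauss_deriv 0 y"
| "gauss_deriv (Suc (Suc n)) y = - y * gauss_deriv (Suc n) y - real (Suc n) * gauss_deriv n y"

lemma gauss_deriv_0: "gauss_deriv 0 y = 2 * std_normal_density y"
proof -
  have "sqrt (2 / pi) = 2 / sqrt (2 * pi)"
    by (simp add: real_sqrt_divide real_sqrt_mult field_simps)
  then show ?thesis by (simp add: std_normal_density_def)
qed

text \<open>Differentiating the Hermite recurrence that defines the function and inserting the
  derivatives of its two predecessors produces the recurrence with the index raised by one.\<close>

lemma gauss_deriv_DERIV: "(gauss_deriv n has_real_derivative gauss_deriv (Suc n) y) (at y)"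
proof (induction n arbitrary: y rule: induct_nat_012)
  case 0
  have "((\<lambda>y. sqrt (2 / pi) * exp (- (1 / 2) * y\<^sup>2)) has_real_derivative gauss_deriv (Suc 0) y) (at y)"
    by (auto intro!: derivative_eq_intros)
  then show ?case by (simp add: gauss_deriv.simps(1)[abs_def])
next
  case 1
  have z: "(gauss_deriv 0 has_real_derivative gauss_deriv (Suc 0) y) (at y)" for y
    unfolding gauss_deriv.simps(1)[abs_def] by (auto intro!: derivative_eq_intros)
  have "((\<lambda>y. - y * gauss_deriv 0 y) has_real_derivative (- 1) * gauss_deriv 0 y + gauss_deriv (Suc 0) y * (- y)) (at y)"
    by (rule DERIV_mult[OF DERIV_minus[OF DERIV_ident] z])
  then show ?case by (simp add: gauss_deriv.simps(2)[abs_def] algebra_simps)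
next
  case (ge2 n)
  have "((\<lambda>y. - y * gauss_deriv (Suc n) y - real (Suc n) * gauss_deriv n y) has_real_derivative
    ((- 1) * gauss_deriv (Suc n) y + gauss_deriv (Suc (Suc n)) y * (- y)) - real (Suc n) * gauss_deriv (Suc n) y) (at y)"
    by (rule DERIV_diff[OF DERIV_mult[OF DERIV_minus[OF DERIV_ident] ge2(2)] DERIV_cmult[OF ge2(1)]])
  then show ?case by (simp add: gauss_deriv.simps(3)[abs_def] algebra_simps)
qed

text \<open>The power of \<open>y\<close> is there for the induction, as each use of the recurrence
  brings in one more factor \<open>y\<close>.\<close>

lemma gauss_deriv_power_tendsto_0: "((\<lambda>y. y ^ k * gauss_deriv n y) \<longlongrightarrow> 0) at_infinity"
proof -
  have z: "((\<lambda>y. y ^ k * gauss_deriv 0 y) \<longlongrightarrow> 0) at_infinity" for k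
  proof -
    have "((\<lambda>y::real. norm y ^ k / exp (norm y)) \<longlongrightarrow> 0) at_infinity"
      by (rule filterlim_compose[OF tendsto_power_div_exp_0 filterlim_norm_at_top])
    then have lim: "((\<lambda>y::real. sqrt (2 / pi) * (norm y ^ k / exp (norm y))) \<longlongrightarrow> sqrt (2 / pi) * 0) at_infinity"
      by (intro tendsto_mult tendsto_const)
    show ?thesis
    proof (rule Lim_null_comparison)
      show "((\<lambda>y::real. sqrt (2 / pi) * (norm y ^ k / exp (norm y))) \<longlongrightarrow> 0) at_infinity" using lim by simp
      show "\<forall>\<^sub>F y in at_infinity. norm (y ^ k * gauss_deriv 0 y) \<le> sqrt (2 / pi) * (norm y ^ k / exp (norm y))"
        unfolding eventually_at_infinity
      proof (intro exI[of _ 2] allI impI)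
        \<comment> \<open>From \<open>\<bar>y\<bar> = 2\<close> on, \<open>y\<^sup>2 / 2\<close> is
          at least \<open>\<bar>y\<bar>\<close>, so the Gaussian is dominated by
          \<open>exp (- \<bar>y\<bar>)\<close>.\<close>
        fix y :: real assume y: "2 \<le> norm y"
        have "2 * \<bar>y\<bar> \<le> \<bar>y\<bar> * \<bar>y\<bar>" using y by (intro mult_right_mono) auto
        then have "- (1 / 2) * y\<^sup>2 \<le> - \<bar>y\<bar>" by (simp add: power2_eq_square abs_mult_self_eq)
        then have "exp (- (1 / 2) * y\<^sup>2) \<le> inverse (exp \<bar>y\<bar>)" by (simp add: exp_minus[symmetric])
        then have "\<bar>y\<bar> ^ k * exp (- (1 / 2) * y\<^sup>2) \<le> \<bar>y\<bar> ^ k * inverse (exp \<bar>y\<bar>)" by (intro mult_left_mono) auto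
        then have "sqrt (2 / pi) * (\<bar>y\<bar> ^ k * exp (- (1 / 2) * y\<^sup>2)) \<le> sqrt (2 / pi) * (\<bar>y\<bar> ^ k * inverse (exp \<bar>y\<bar>))"
          by (rule mult_left_mono) simp
        moreover have "norm (y ^ k * gauss_deriv 0 y) = sqrt (2 / pi) * (\<bar>y\<bar> ^ k * exp (- (1 / 2) * y\<^sup>2))"
          by (simp add: abs_mult power_abs)
        moreover have "\<bar>y\<bar> ^ k * inverse (exp \<bar>y\<bar>) = norm y ^ k / exp (norm y)"
          by (simp only: real_norm_def divide_inverse)
        ultimately show "norm (y ^ k * gauss_deriv 0 y) \<le> sqrt (2 / pi) * (norm y ^ k / exp (norm y))"
          by (simp only:)
      qed
    qed
  qed
  show ?thesis
  proof (induction n arbitrary: k rule: induct_nat_012)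
    case 0
    show ?case by (rule z)
  next
    case 1
    have "((\<lambda>y. - (y ^ Suc k * gauss_deriv 0 y)) \<longlongrightarrow> - 0) at_infinity" by (intro tendsto_minus z)
    then show ?case by (simp add: mult.assoc mult.left_commute)
  next
    case (ge2 n)
    have "((\<lambda>y. - (y ^ Suc k * gauss_deriv (Suc n) y) - real (Suc n) * (y ^ k * gauss_deriv n y)) \<longlongrightarrow> - 0 - real (Suc n) * 0) at_infinity"
      by (intro tendsto_minus tendsto_diff tendsto_mult tendsto_const ge2)
    then show ?case by (simp add: algebra_simps)
  qed
qed

section \<open>The Gaussian coordinate on the state space and its observables\<close>

definition gauss_chart :: "real \<Rightarrow> real" where
  "gauss_chart s = inv Phi ((1 - s) / 2)"

text \<open>The value 0 off the open interval is the limit at both endpoints, so the function is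
  continuous on the whole line (\<open>hermite_obs_isCont\<close>) and takes its absorbed value 0 at
  the points where the solutions end up.\<close>

definition hermite_obs :: "nat \<Rightarrow> real \<Rightarrow> real" where
  "hermite_obs n s = (if \<bar>s\<bar> < 1 then gauss_deriv n (gauss_chart s) else 0)"

lemma hermite_obs_0: "hermite_obs 0 = \<xi>"
  by (rule ext) (simp add: hermite_obs_def \<xi>_def gauss_chart_def)

lemma gauss_chart_0: "gauss_chart 0 = 0"
  using inv_Phi_Phi[of 0] by (simp add: gauss_chart_def Phi_0)

lemma hermite_obs_at_0: "hermite_obs n 0 = gauss_deriv n 0"
  by (simp add: hermite_obs_def gauss_chart_0)

lemma Phi_gauss_chart: "\<bar>s\<bar> < 1 \<Longrightarrow> Phi (gauss_chart s) = (1 - s) / 2"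
  unfolding gauss_chart_def by (rule Phi_inv_Phi) auto

lemma gauss_chart_antimono:
  assumes "\<bar>s\<bar> < 1" "\<bar>t\<bar> < 1" "s \<le> t"
  shows "gauss_chart t \<le> gauss_chart s"
proof (rule ccontr)
  assume "\<not> ?thesis"
  then have "Phi (gauss_chart s) < Phi (gauss_chart t)" by (intro Phi_strict_mono) simp
  then show False using assms by (simp add: Phi_gauss_chart)
qed

lemma \<xi>_pos: "\<bar>s\<bar> < 1 \<Longrightarrow> 0 < \<xi> s"
  by (simp add: \<xi>_def)

text \<open>Moving \<open>s\<close> towards 0 moves the Gaussian coordinate towards 0, where the
  density is largest. This monotonicity keeps the quotient in \<open>scaled_hermite_bounds\<close>
  at most 1.\<close>

lemma \<xi>_scale_le:
  assumes "0 \<le> \<theta>" "\<theta> \<le> 1" "\<bar>s\<bar> < 1"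
  shows "\<xi> s \<le> \<xi> (\<theta> * s)"
proof -
  have "\<bar>\<theta> * s\<bar> \<le> \<bar>s\<bar>" using assms by (simp add: abs_mult mult_left_le_one_le)
  then have ts: "\<bar>\<theta> * s\<bar> < 1" using assms by simp
  have "(gauss_chart (\<theta> * s))\<^sup>2 \<le> (gauss_chart s)\<^sup>2"
  proof (cases "0 \<le> s")
    case True
    then have "0 \<le> \<theta> * s" "\<theta> * s \<le> s" using assms by (auto simp: mult_left_le_one_le)
    then have "gauss_chart (\<theta> * s) \<le> 0" "gauss_chart s \<le> gauss_chart (\<theta> * s)"
      using gauss_chart_antimono[of 0 "\<theta> * s"] gauss_chart_antimono[of "\<theta> * s" s] ts assms by (auto simp: gauss_chart_0)
    then show ?thesis by (simp add: abs_le_square_iff[symmetric])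
  next
    case False
    then have "\<theta> * s \<le> 0" "s \<le> \<theta> * s"
      using assms mult_right_mono_neg[of \<theta> 1 s] mult_nonneg_nonpos[of \<theta> s] by simp_all
    then have "0 \<le> gauss_chart (\<theta> * s)" "gauss_chart (\<theta> * s) \<le> gauss_chart s"
      using gauss_chart_antimono[of "\<theta> * s" 0] gauss_chart_antimono[of s "\<theta> * s"] ts assms by (auto simp: gauss_chart_0)
    then show ?thesis by (simp add: abs_le_square_iff[symmetric])
  qed
  then show ?thesis using ts assms by (simp add: \<xi>_def gauss_chart_def)
qed

text \<open>The inverse function rule for \<open>Phi\<close>: the slope \<open>- 1 / 2\<close> of
  \<open>(1 - s) / 2\<close> combines with the density to \<open>\<xi>\<close>, which is twice the
  density. The chart is decreasing, hence the minus signs in the derivatives below.\<close>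

lemma gauss_chart_DERIV:
  assumes "\<bar>s\<bar> < 1"
  shows "(gauss_chart has_real_derivative - 1 / \<xi> s) (at s)"
proof -
  define p where "p = (1 - s) / 2"
  have p: "0 < p" "p < 1" using assms by (auto simp: p_def)
  have c: "isCont (inv Phi) p"
  proof -
    have "isCont (inv Phi) (Phi (inv Phi p))"
      by (rule isCont_inverse_function[where d=1]) (auto intro: Phi_isCont)
    then show ?thesis using p by (simp add: Phi_inv_Phi)
  qed
  have d: "(inv Phi has_real_derivative inverse (std_normal_density (inv Phi p))) (at p)"
  proof (rule DERIV_inverse_function[where f=Phi and a=0 and b=1, OF Phi_deriv _ p _ c])
    show "std_normal_density (inv Phi p) \<noteq> 0" using normal_density_pos[of 1 0 "inv Phi p"] by linarith
  qed (rule Phi_inv_Phi)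
  have "((\<lambda>s. (1 - s) / 2) has_real_derivative - 1 / 2) (at s)"
    by (auto intro!: derivative_eq_intros)
  from DERIV_chain2[OF d[unfolded p_def] this]
  have "((\<lambda>s. inv Phi ((1 - s) / 2)) has_real_derivative inverse (std_normal_density (inv Phi ((1 - s) / 2))) * (- 1 / 2)) (at s)" .
  moreover have "\<xi> s = gauss_deriv 0 (inv Phi ((1 - s) / 2))"
    using assms by (simp only: \<xi>_def gauss_deriv.simps if_True)
  moreover have "inverse D * (- 1 / 2) = - 1 / (2 * D)" for D :: real
    by (cases "D = 0") (simp_all add: field_simps)
  ultimately show ?thesis unfolding gauss_chart_def[abs_def] by (simp only: gauss_deriv_0)
qed

lemma eventually_abs_less: "\<bar>s::real\<bar> < 1 \<Longrightarrow> eventually (\<lambda>x. \<bar>x\<bar> < 1) (nhds s)"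
  by (rule eventually_nhds_in_open[of "{x. \<bar>x\<bar> < 1}", simplified]) (intro open_Collect_less continuous_intros)

lemma hermite_obs_DERIV:
  assumes "\<bar>s\<bar> < 1"
  shows "(hermite_obs n has_real_derivative - hermite_obs (Suc n) s / \<xi> s) (at s)"
proof -
  have d: "((\<lambda>s. gauss_deriv n (gauss_chart s)) has_real_derivative gauss_deriv (Suc n) (gauss_chart s) * (- 1 / \<xi> s)) (at s)"
    by (rule DERIV_chain2[OF gauss_deriv_DERIV gauss_chart_DERIV[OF assms]])
  have ev: "eventually (\<lambda>x. hermite_obs n x = gauss_deriv n (gauss_chart x)) (nhds s)"
    using eventually_abs_less[OF assms] by eventually_elim (simp add: hermite_obs_def)
  have "(hermite_obs n has_real_derivative gauss_deriv (Suc n) (gauss_chart s) * (- 1 / \<xi> s)) (at s)"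
    by (subst DERIV_cong_ev[OF refl ev refl]) (rule d)
  then show ?thesis using assms by (simp add: hermite_obs_def)
qed

lemma hermite_obs_Suc_Suc:
  "hermite_obs (Suc (Suc n)) s = - gauss_chart s * hermite_obs (Suc n) s - real (Suc n) * hermite_obs n s"
  by (simp add: hermite_obs_def)

lemma hermite_obs_1: "hermite_obs (Suc 0) s = - gauss_chart s * \<xi> s"
  by (simp add: hermite_obs_0[symmetric] hermite_obs_def)

lemma \<xi>_DERIV: "\<bar>s\<bar> < 1 \<Longrightarrow> (\<xi> has_real_derivative gauss_chart s) (at s)"
  using hermite_obs_DERIV[of s 0] \<xi>_pos[of s] by (simp add: hermite_obs_0 hermite_obs_1)

text \<open>The terms with \<open>gauss_chart s\<close> cancel by the Hermite recurrence. Multiplied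
  by \<open>(\<xi> s)\<^sup>2 / 2\<close> this is the eigenfunction equation for the
  generator.\<close>

lemma hermite_obs_DERIV2:
  assumes "\<bar>s\<bar> < 1"
  shows "((\<lambda>s. - hermite_obs (Suc n) s / \<xi> s) has_real_derivative - real (Suc n) * hermite_obs n s / (\<xi> s)\<^sup>2) (at s)"
proof -
  have "((\<lambda>s. - hermite_obs (Suc n) s / \<xi> s) has_real_derivative
    ((- (- hermite_obs (Suc (Suc n)) s / \<xi> s)) * \<xi> s - (- hermite_obs (Suc n) s) * gauss_chart s) / (\<xi> s * \<xi> s)) (at s)"
    using \<xi>_pos[OF assms] by (intro DERIV_divide DERIV_minus hermite_obs_DERIV \<xi>_DERIV assms) auto
  moreover have "((- (- hermite_obs (Suc (Suc n)) s / \<xi> s)) * \<xi> s - (- hermite_obs (Suc n) s) * gauss_chart s) / (\<xi> s * \<xi> s)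
    = - real (Suc n) * hermite_obs n s / (\<xi> s)\<^sup>2"
    using \<xi>_pos[OF assms] by (simp add: hermite_obs_Suc_Suc power2_eq_square field_simps)
  ultimately show ?thesis by (simp only:)
qed

text \<open>The third derivative serves the cubic Taylor remainder; what counts is its continuity on
  compact parts of the open interval.\<close>

lemma hermite_obs_DERIV3:
  assumes "\<bar>s\<bar> < 1"
  shows "((\<lambda>s. - real (Suc n) * hermite_obs n s / (\<xi> s)\<^sup>2) has_real_derivative
    real (Suc n) * (hermite_obs (Suc n) s + 2 * hermite_obs n s * gauss_chart s) / (\<xi> s)^3) (at s)"
proof -
  have "((\<lambda>s. - real (Suc n) * hermite_obs n s / (\<xi> s)\<^sup>2) has_real_derivative
    ((- real (Suc n) * (- hermite_obs (Suc n) s / \<xi> s)) * (\<xi> s)\<^sup>2 - (- real (Suc n) * hermite_obs n s) * (real 2 * (gauss_chart s * \<xi> s ^ (2 - Suc 0)))) / ((\<xi> s)\<^sup>2 * (\<xi> s)\<^sup>2)) (at s)"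
    using \<xi>_pos[OF assms] by (intro DERIV_divide DERIV_cmult DERIV_power hermite_obs_DERIV \<xi>_DERIV assms) auto
  moreover have "((- real (Suc n) * (- hermite_obs (Suc n) s / \<xi> s)) * (\<xi> s)\<^sup>2 - (- real (Suc n) * hermite_obs n s) * (real 2 * (gauss_chart s * \<xi> s ^ (2 - Suc 0)))) / ((\<xi> s)\<^sup>2 * (\<xi> s)\<^sup>2)
    = real (Suc n) * (hermite_obs (Suc n) s + 2 * hermite_obs n s * gauss_chart s) / (\<xi> s)^3"
    using \<xi>_pos[OF assms] by (simp add: field_simps power2_eq_square power3_eq_cube)
  ultimately show ?thesis by (simp only:)
qed

lemma hermite_obs_isCont: "isCont (hermite_obs n) s"
proof (cases "\<bar>s\<bar> < 1")
  case True
  then show ?thesis using hermite_obs_DERIV by (blast intro: DERIV_isCont)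
next
  case False
  have "hermite_obs n \<midarrow>s\<rightarrow> hermite_obs n s"
  proof (rule LIM_I)
    fix e :: real assume e: "0 < e"
    have "((\<lambda>y. y ^ 0 * gauss_deriv n y) \<longlongrightarrow> 0) at_infinity" by (rule gauss_deriv_power_tendsto_0)
    from tendstoD[OF this e] obtain R where R: "\<And>y. R \<le> norm y \<Longrightarrow> \<bar>gauss_deriv n y\<bar> < e"
      by (auto simp: eventually_at_infinity)
    define R' where "R' = max R 1"
    have R': "\<bar>gauss_deriv n y\<bar> < e" if "R' \<le> \<bar>y\<bar>" for y using that by (intro R) (simp add: R'_def)
    \<comment> \<open>Converts the tail \<open>\<bar>y\<bar> \<ge> R'\<close> of the Gaussian
      coordinate into a neighbourhood of the endpoints; the factor 2 is that of
      \<open>s = 1 - 2 * Phi y\<close>, and the minimum covers both ends.\<close>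
    define d where "d = 2 * min (Phi (- R')) (1 - Phi R')"
    have d: "0 < d" using Phi_bounds by (simp add: d_def)
    have dle: "d \<le> 2 * Phi (- R')" "d \<le> 2 * (1 - Phi R')" unfolding d_def by (simp_all add: min_def)
    show "\<exists>d>0. \<forall>x. x \<noteq> s \<and> norm (x - s) < d \<longrightarrow> norm (hermite_obs n x - hermite_obs n s) < e"
    proof (intro exI[of _ d] conjI d allI impI)
      fix x assume x: "x \<noteq> s \<and> norm (x - s) < d"
      have s0: "hermite_obs n s = 0" using False by (simp add: hermite_obs_def)
      show "norm (hermite_obs n x - hermite_obs n s) < e"
      proof (cases "\<bar>x\<bar> < 1")
        case False
        then show ?thesis using s0 e by (simp add: hermite_obs_def)
      next
        case True
        note P = Phi_gauss_chart[OF True]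
        have "R' \<le> \<bar>gauss_chart x\<bar>"
        proof (cases "1 \<le> s")
          case True
          then have "1 - d < x" using x by (simp add: abs_less_iff)
          then have "Phi (gauss_chart x) < Phi (- R')" using dle(1) by (simp add: P)
          then have "gauss_chart x < - R'" by (simp only: Phi_less_iff)
          then show ?thesis by simp
        next
          case False
          then have "s \<le> - 1" using \<open>\<not> \<bar>s\<bar> < 1\<close> by linarith
          then have "x < - 1 + d" using x by (simp add: abs_less_iff)
          then have "Phi R' < Phi (gauss_chart x)" using dle(2) by (simp add: P)
          then have "R' < gauss_chart x" by (simp only: Phi_less_iff)
          then show ?thesis by simp
        qed
        then show ?thesis using R'[of "gauss_chart x"] True s0 by (simp add: hermite_obs_def)
      qed
    qed
  qed
  then show ?thesis by (simp add: isCont_def)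
qed

lemma hermite_obs_continuous: "continuous_on A (hermite_obs n)"
  using hermite_obs_isCont by (simp add: continuous_at_imp_continuous_on)

lemma hermite_obs_measurable[measurable]: "hermite_obs n \<in> borel_measurable borel"
  by (rule borel_measurable_continuous_onI[OF hermite_obs_continuous])

lemma \<xi>_continuous: "continuous_on A \<xi>"
  using hermite_obs_continuous[of A 0] by (simp add: hermite_obs_0)

lemma \<xi>_measurable[measurable]: "\<xi> \<in> borel_measurable borel"
  using hermite_obs_measurable[of 0] by (simp add: hermite_obs_0)

section \<open>The power series of arcsin\<close>

lemma gauss_deriv_at_0_rec: "(gauss_deriv (Suc (Suc n)) 0)\<^sup>2 = (real (Suc n))\<^sup>2 * (gauss_deriv n 0)\<^sup>2"
  by (simp add: power_mult_distrib)

lemma gauss_deriv_at_0_odd: "gauss_deriv (Suc (2 * m)) 0 = 0"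
  by (induction m) auto

text \<open>At 0 the recurrence yields double factorials, and the quotient is \<open>2 / pi\<close>
  times the central binomial coefficient over \<open>4 ^ m\<close>. The generalized binomial form
  matches the binomial series with exponent -1/2.\<close>

lemma gauss_deriv_at_0_even:
  "(gauss_deriv (2 * m) 0)\<^sup>2 / fact (2 * m) = 2 / pi * ((- 1) ^ m * ((- 1 / 2 :: real) gchoose m))"
proof (induction m)
  case (Suc m)
  define g where "g = (- 1 / 2 :: real) gchoose m"
  define b where "b = (gauss_deriv (2 * m) 0)\<^sup>2"
  have "real (Suc m) * ((- 1 / 2 :: real) gchoose (Suc m)) = (- 1 / 2 - real m) * g"
    using gbinomial_mult_1[of "- 1 / 2 :: real" m] by (simp add: g_def algebra_simps)
  then have gS: "(- 1 / 2 :: real) gchoose (Suc m) = - (g * (real (Suc (2 * m)) / real (Suc (Suc (2 * m)))))"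
    by (simp add: divide_simps) (simp add: algebra_simps)
  have "(gauss_deriv (2 * Suc m) 0)\<^sup>2 / fact (2 * Suc m) = (real (Suc (2 * m)))\<^sup>2 * b / fact (Suc (Suc (2 * m)))"
    using gauss_deriv_at_0_rec[of "2 * m"] by (simp add: b_def)
  also have "\<dots> = b / fact (2 * m) * (real (Suc (2 * m)) / real (Suc (Suc (2 * m))))"
    by (simp add: power2_eq_square divide_simps)
  also have "b / fact (2 * m) = 2 / pi * ((- 1) ^ m * g)" using Suc by (simp add: b_def g_def)
  also have "2 / pi * ((- 1) ^ m * g) * (real (Suc (2 * m)) / real (Suc (Suc (2 * m)))) = 2 / pi * ((- 1) ^ Suc m * ((- 1 / 2 :: real) gchoose (Suc m)))"
    unfolding gS by simp
  finally show ?case .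
qed simp

text \<open>The coefficient of the power \<open>Suc n\<close>, not \<open>n\<close>, in the series
  of \<open>2 / pi * arcsin\<close>.\<close>

definition arcsin_coeff :: "nat \<Rightarrow> real" where
  "arcsin_coeff n = (gauss_deriv n 0)\<^sup>2 / fact (Suc n)"

lemma arcsin_coeff_nonneg: "0 \<le> arcsin_coeff n"
  by (simp add: arcsin_coeff_def)

text \<open>The binomial series in \<open>- x\<^sup>2\<close> occupies the even indices, and the odd
  coefficients vanish because the odd Gaussian derivatives are 0 at 0.\<close>

lemma arcsin_deriv_sums:
  assumes "\<bar>x\<bar> < 1"
  shows "(\<lambda>n. arcsin_coeff n * real (Suc n) * x ^ n) sums (2 / pi * inverse (sqrt (1 - x\<^sup>2)))"
proof -
  have x2: "x\<^sup>2 < 1" using assms by (simp add: abs_square_less_1)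
  define f where "f n = arcsin_coeff n * real (Suc n) * x ^ n" for n
  have "(\<lambda>m. ((- 1 / 2) gchoose m) * (- x\<^sup>2) ^ m) sums (1 + - x\<^sup>2) powr (- 1 / 2)"
    by (rule gen_binomial_real) (use x2 in simp)
  then have "(\<lambda>m. 2 / pi * (((- 1 / 2) gchoose m) * (- x\<^sup>2) ^ m)) sums (2 / pi * (1 - x\<^sup>2) powr (- 1 / 2))"
    by (intro sums_mult) simp
  moreover have "(1 - x\<^sup>2) powr (- 1 / 2) = inverse (sqrt (1 - x\<^sup>2))"
    using x2 by (simp add: powr_minus powr_half_sqrt)
  moreover have "2 / pi * (((- 1 / 2) gchoose m) * (- x\<^sup>2) ^ m) = f (2 * m)" for m
  proof -
    have "f (2 * m) = (gauss_deriv (2 * m) 0)\<^sup>2 / fact (2 * m) * x ^ (2 * m)"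
      by (simp add: f_def arcsin_coeff_def divide_simps)
    also have "\<dots> = 2 / pi * (((- 1 / 2) gchoose m) * ((- 1) ^ m * (x\<^sup>2) ^ m))"
      unfolding gauss_deriv_at_0_even by (simp add: power_mult)
    also have "(- 1) ^ m * (x\<^sup>2) ^ m = (- x\<^sup>2) ^ m" by (simp add: power_mult_distrib[symmetric])
    finally show ?thesis by simp
  qed
  ultimately have "(\<lambda>m. f (2 * m)) sums (2 / pi * inverse (sqrt (1 - x\<^sup>2)))" by simp
  moreover have "f n = 0" if "n \<notin> range ((*) 2)" for n
  proof -
    have "odd n" using that by (metis evenE rangeI)
    then obtain m where "n = Suc (2 * m)" by (metis oddE Suc_eq_plus1)
    then show ?thesis by (simp add: f_def arcsin_coeff_def gauss_deriv_at_0_odd del: gauss_deriv.simps)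
  qed
  ultimately show ?thesis
    unfolding f_def[symmetric] using sums_mono_reindex[of "(*) 2" f] by (simp add: strict_mono_def)
qed

lemma arcsin_sums_open:
  assumes x: "\<bar>x\<bar> < 1"
  shows "(\<lambda>n. arcsin_coeff n * x ^ Suc n) sums (2 / pi * arcsin x)"
proof -
  let ?S = "\<lambda>x. \<Sum>n. arcsin_coeff n * x ^ Suc n"
  have D: "(?S has_real_derivative 2 / pi * inverse (sqrt (1 - y\<^sup>2))) (at y)" if "\<bar>y\<bar> < 1" for y
  proof -
    have "(?S has_real_derivative (\<Sum>n. arcsin_coeff n * real (Suc n) * y ^ n)) (at y)"
    proof (rule DERIV_power_series'[where R=1])
      fix x :: real assume "x \<in> {-1<..<1}"
      then have "\<bar>x\<bar> < 1" by auto
      from sums_summable[OF arcsin_deriv_sums[OF this]]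
      show "summable (\<lambda>n. arcsin_coeff n * real (Suc n) * x ^ n)" .
    qed (use that in auto)
    then show ?thesis using arcsin_deriv_sums[OF that] by (simp add: sums_iff)
  qed
  have summ: "summable (\<lambda>n. arcsin_coeff n * x ^ Suc n)"
  proof (rule summable_comparison_test')
    have "summable (\<lambda>n. arcsin_coeff n * real (Suc n) * \<bar>x\<bar> ^ n)"
      using arcsin_deriv_sums[of "\<bar>x\<bar>"] x by (simp add: sums_iff)
    then show "summable (\<lambda>n. arcsin_coeff n * real (Suc n) * \<bar>x\<bar> ^ n)" .
    fix n
    have "norm (arcsin_coeff n * x ^ Suc n) = arcsin_coeff n * (\<bar>x\<bar> * \<bar>x\<bar> ^ n)"
      by (simp add: abs_mult power_abs arcsin_coeff_nonneg)
    also have "\<dots> \<le> arcsin_coeff n * (real (Suc n) * \<bar>x\<bar> ^ n)"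
      using x arcsin_coeff_nonneg by (intro mult_left_mono mult_right_mono) auto
    finally show "norm (arcsin_coeff n * x ^ Suc n) \<le> arcsin_coeff n * real (Suc n) * \<bar>x\<bar> ^ n" by (simp add: mult.assoc)
  qed
  have zd: "((\<lambda>x. ?S x - 2 / pi * arcsin x) has_real_derivative 0) (at y)" if "y \<in> {-1<..<1}" for y
  proof -
    have y: "\<bar>y\<bar> < 1" using that by auto
    have "(arcsin has_real_derivative inverse (sqrt (1 - y\<^sup>2))) (at y)" by (rule DERIV_arcsin) (use that in auto)
    from DERIV_diff[OF D[OF y] DERIV_cmult[OF this, of "2 / pi"]] show ?thesis by simp
  qed
  have "\<exists>c. \<forall>y\<in>{-1<..<1}. ?S y - 2 / pi * arcsin y = c"
    by (rule has_field_derivative_zero_constant[OF convex_real_interval(8)])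
       (rule has_field_derivative_at_within[OF zd])
  then obtain c where c: "\<And>y. y \<in> {-1<..<1} \<Longrightarrow> ?S y - 2 / pi * arcsin y = c" by blast
  have "c = 0" using c[of 0] by simp
  moreover have "x \<in> {-1<..<1}" using x by auto
  ultimately have "?S x = 2 / pi * arcsin x" using c[of x] by simp
  then show ?thesis using summ by (simp add: sums_iff)
qed

text \<open>Nonnegative coefficients make the boundary value elementary: letting \<open>x\<close>
  increase to 1 bounds each partial sum by 1, while the full sum dominates
  \<open>2 / pi * arcsin x\<close> for every \<open>x\<close> in \<open>[0, 1)\<close>. The value 1
  is what later forces the remainder to 0.\<close>

lemma arcsin_coeff_sums: "arcsin_coeff sums 1"
proof -
  have part: "(\<Sum>n<N. arcsin_coeff n * x ^ Suc n) \<le> 1" if x: "0 \<le> x" "x < 1" for x N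
  proof -
    have s: "(\<lambda>n. arcsin_coeff n * x ^ Suc n) sums (2 / pi * arcsin x)" by (rule arcsin_sums_open) (use x in auto)
    then have "(\<Sum>n<N. arcsin_coeff n * x ^ Suc n) \<le> 2 / pi * arcsin x"
      using sum_le_suminf[of "\<lambda>n. arcsin_coeff n * x ^ Suc n" "{..<N}"] x arcsin_coeff_nonneg by (simp add: sums_iff)
    also have "\<dots> \<le> 2 / pi * (pi / 2)" using arcsin_ubound[of x] x by (intro mult_left_mono) auto
    finally show ?thesis by simp
  qed
  define z where "z i = 1 - inverse (real (Suc i))" for i
  have z: "0 \<le> z i" "z i < 1" for i by (auto simp: z_def field_simps)
  have zI: "z i \<in> {-1..1}" for i using z(1)[of i] z(2)[of i] by auto
  have zl: "z \<longlonglongrightarrow> 1" unfolding z_def[abs_def] using LIMSEQ_inverse_real_of_nat_add_minus[of 1] by simp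
  have part1: "(\<Sum>n<N. arcsin_coeff n) \<le> 1" for N
  proof -
    have "(\<lambda>i. \<Sum>n<N. arcsin_coeff n * z i ^ Suc n) \<longlonglongrightarrow> (\<Sum>n<N. arcsin_coeff n * 1 ^ Suc n)"
      by (intro tendsto_sum tendsto_mult tendsto_const tendsto_power zl)
    from LIMSEQ_le_const2[OF this, of 1] show ?thesis using part[OF z] by auto
  qed
  have summ: "summable arcsin_coeff"
  proof (rule bounded_imp_summable[of _ 1])
    show "(\<Sum>k\<le>n. arcsin_coeff k) \<le> 1" for n
      using part1[of "Suc n"] by (simp only: lessThan_Suc_atMost)
  qed (rule arcsin_coeff_nonneg)
  have "suminf arcsin_coeff \<le> 1" by (rule suminf_le_const[OF summ part1])
  moreover have "1 \<le> suminf arcsin_coeff"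
  proof -
    have "(\<lambda>i. 2 / pi * arcsin (z i)) \<longlonglongrightarrow> 2 / pi * arcsin 1"
    proof (intro tendsto_mult tendsto_const)
      show "(\<lambda>i. arcsin (z i)) \<longlonglongrightarrow> arcsin 1"
        by (rule continuous_on_tendsto_compose[OF continuous_on_arcsin' zl]) (use zI in auto)
    qed
    moreover have "2 / pi * arcsin (z i) \<le> suminf arcsin_coeff" for i
    proof -
      have s: "(\<lambda>n. arcsin_coeff n * z i ^ Suc n) sums (2 / pi * arcsin (z i))" by (rule arcsin_sums_open) (use z[of i] in auto)
      have "arcsin_coeff n * z i ^ Suc n \<le> arcsin_coeff n" for n
        using z[of i] arcsin_coeff_nonneg[of n] by (intro mult_left_le power_le_one) auto
      then show ?thesis using s suminf_le[of "\<lambda>n. arcsin_coeff n * z i ^ Suc n" arcsin_coeff] summ by (simp add: sums_iff)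
    qed
    ultimately have "2 / pi * arcsin 1 \<le> suminf arcsin_coeff" by (intro LIMSEQ_le_const2) auto
    then show ?thesis by simp
  qed
  ultimately show ?thesis using summ by (simp add: sums_iff)
qed

lemma arcsin_sums:
  assumes "\<bar>x\<bar> \<le> 1"
  shows "(\<lambda>n. arcsin_coeff n * x ^ Suc n) sums (2 / pi * arcsin x)"
proof -
  consider "\<bar>x\<bar> < 1" | "x = 1" | "x = -1" using assms by linarith
  then show ?thesis
  proof cases
    case 3
    have "arcsin_coeff n * x ^ Suc n = - arcsin_coeff n" for n
    proof (cases "even n")
      case False
      then obtain m where "n = Suc (2 * m)" by (metis oddE Suc_eq_plus1)
      then show ?thesis by (simp add: arcsin_coeff_def gauss_deriv_at_0_odd del: gauss_deriv.simps)
    qed (simp add: 3)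
    moreover have "2 / pi * arcsin x = - 1" by (simp add: 3)
    ultimately show ?thesis using sums_minus[OF arcsin_coeff_sums] by (simp only:)
  qed (use arcsin_sums_open arcsin_coeff_sums in auto)
qed

text \<open>Lagrange's form of the remainder, with the factor 1/6 given away.\<close>

lemma cubic_taylor_bound:
  fixes f :: "real \<Rightarrow> real"
  assumes D: "\<And>x. x \<in> {a..b} \<Longrightarrow> (f has_real_derivative f1 x) (at x)" "\<And>x. x \<in> {a..b} \<Longrightarrow> (f1 has_real_derivative f2 x) (at x)"
      "\<And>x. x \<in> {a..b} \<Longrightarrow> (f2 has_real_derivative f3 x) (at x)"
    and K: "\<And>x. x \<in> {a..b} \<Longrightarrow> \<bar>f3 x\<bar> \<le> K" and x: "x \<in> {a..b}" "x' \<in> {a..b}"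
  shows "\<bar>f x' - f x - f1 x * (x' - x) - f2 x / 2 * (x' - x)\<^sup>2\<bar> \<le> K * \<bar>x' - x\<bar>^3"
proof (cases "x' = x")
  case False
  define d where "d m = (if m = 0 then f else if m = 1 then f1 else if m = 2 then f2 else f3)" for m :: nat
  have "\<exists>t. (if x' < x then x' < t \<and> t < x else x < t \<and> t < x') \<and>
    f x' = (\<Sum>m<3. (d m x / fact m) * (x' - x)^m) + (d 3 t / fact 3) * (x' - x)^3"
    by (rule Taylor[where a=a and b=b]) (use D x False in \<open>auto simp: d_def less_Suc_eq numeral_3_eq_3 numeral_2_eq_2\<close>)
  then obtain t where t: "if x' < x then x' < t \<and> t < x else x < t \<and> t < x'"
    "f x' = (\<Sum>m<3. (d m x / fact m) * (x' - x)^m) + (d 3 t / fact 3) * (x' - x)^3" by blast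
  have tI: "t \<in> {a..b}" using t(1) x by (auto split: if_splits)
  have "(\<Sum>m<3. (d m x / fact m) * (x' - x)^m) = f x + f1 x * (x' - x) + f2 x / 2 * (x' - x)\<^sup>2"
    by (simp add: d_def numeral_3_eq_3 lessThan_Suc power2_eq_square)
  moreover have "(fact 3 :: real) = 6" by (simp add: fact_numeral)
  ultimately have eq: "f x' - f x - f1 x * (x' - x) - f2 x / 2 * (x' - x)\<^sup>2 = f3 t / 6 * (x' - x)^3"
    using t(2) by (simp add: d_def)
  have "\<bar>f x' - f x - f1 x * (x' - x) - f2 x / 2 * (x' - x)\<^sup>2\<bar> = \<bar>f3 t\<bar> / 6 * \<bar>x' - x\<bar>^3"
    unfolding eq by (simp add: abs_mult power_abs)
  also have "\<dots> \<le> K * \<bar>x' - x\<bar>^3"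
    using K[OF tI] by (intro mult_right_mono) auto
  finally show ?thesis .
qed simp

section \<open>Regularisation near the absorbing points\<close>

lemma (in prob_space) expectation_tendsto_compact:
  assumes P: "compact_process S P"
    and G: "\<And>j::nat. G j \<in> borel_measurable borel" and H: "H \<in> borel_measurable borel"
    and bound: "\<And>j p. p \<in> S \<Longrightarrow> \<bar>G j p\<bar> \<le> C" and lim: "\<And>p. p \<in> S \<Longrightarrow> (\<lambda>j. G j p) \<longlonglongrightarrow> H p" and r: "0 \<le> r"
  shows "(\<lambda>j. \<integral>\<omega>. G j (P r \<omega>) \<partial>M) \<longlonglongrightarrow> (\<integral>\<omega>. H (P r \<omega>) \<partial>M :: real)"
proof (rule integral_dominated_convergence[where w="\<lambda>_. C"])
  have AS: "AE \<omega> in M. \<forall>t\<ge>0. P t \<omega> \<in> S" using P by (simp add: compact_process_def)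
  have Pm: "P r \<in> borel_measurable M" using P r by (simp add: compact_process_def)
  show "(\<lambda>\<omega>. H (P r \<omega>)) \<in> borel_measurable M" by (rule measurable_compose[OF Pm H])
  show "(\<lambda>\<omega>. G j (P r \<omega>)) \<in> borel_measurable M" for j by (rule measurable_compose[OF Pm G])
  show "AE \<omega> in M. (\<lambda>j. G j (P r \<omega>)) \<longlonglongrightarrow> H (P r \<omega>)"
    using AS by eventually_elim (use lim r in auto)
  show "AE \<omega> in M. norm (G j (P r \<omega>)) \<le> C" for j
    using AS by eventually_elim (use bound r in auto)
qed simp

text \<open>Dominated convergence twice with the same constant, over the sample space and then over
  time; continuity of each \<open>G j\<close> makes the expectations integrable in time.\<close>

lemma (in prob_space) expectation_integral_tendsto_compact:
  assumes P: "compact_process S P"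
    and G: "\<And>j::nat. G j \<in> borel_measurable borel" and Gc: "\<And>j. continuous_on S (G j)" and H: "H \<in> borel_measurable borel"
    and bound: "\<And>j p. p \<in> S \<Longrightarrow> \<bar>G j p\<bar> \<le> C" and lim: "\<And>p. p \<in> S \<Longrightarrow> (\<lambda>j. G j p) \<longlonglongrightarrow> H p"
  shows "(\<lambda>j. integral {0..T} (\<lambda>r. \<integral>\<omega>. G j (P r \<omega>) \<partial>M)) \<longlonglongrightarrow> integral {0..T} (\<lambda>r. \<integral>\<omega>. H (P r \<omega>) \<partial>M :: real)"
proof (rule dominated_convergence(2)[where h="\<lambda>_. C"])
  have AS: "AE \<omega> in M. \<forall>t\<ge>0. P t \<omega> \<in> S" using P by (simp add: compact_process_def)
  show "(\<lambda>r. \<integral>\<omega>. G j (P r \<omega>) \<partial>M) integrable_on {0..T}" for j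
    using compact_process_continuous[OF P G Gc, of "\<lambda>_. 1" 1 T j] by (intro integrable_continuous_real) simp
  show "(\<lambda>j. \<integral>\<omega>. G j (P r \<omega>) \<partial>M) \<longlonglongrightarrow> (\<integral>\<omega>. H (P r \<omega>) \<partial>M)" if "r \<in> {0..T}" for r
    by (rule expectation_tendsto_compact[OF P G H bound lim]) (use that in auto)
  show "norm (\<integral>\<omega>. G j (P r \<omega>) \<partial>M) \<le> C" if r: "r \<in> {0..T}" for j r
  proof -
    have i: "integrable M (\<lambda>\<omega>. G j (P r \<omega>))" by (rule compact_process_integrable[OF P G Gc]) (use r in auto)
    have "norm (\<integral>\<omega>. G j (P r \<omega>) \<partial>M) \<le> (\<integral>\<omega>. \<bar>G j (P r \<omega>)\<bar> \<partial>M)" by (simp add: integral_abs_bound)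
    also have "\<dots> \<le> (\<integral>\<omega>. C \<partial>M)"
    proof (rule integral_mono_AE)
      show "AE \<omega> in M. \<bar>G j (P r \<omega>)\<bar> \<le> C" using AS by eventually_elim (use bound r in auto)
    qed (use i in auto)
    finally show ?thesis by (simp add: prob_space)
  qed
qed auto

text \<open>
  The functions \<open>hermite_obs n\<close> are not differentiable at \<open>\<plusminus>1\<close>, but \<open>hermite_obs n (\<theta> x)\<close> with \<open>\<theta> < 1\<close> is smooth up to
  the boundary, and \<open>\<xi> x \<le> \<xi> (\<theta> x)\<close> keeps its image under the generator bounded as \<open>\<theta> \<rightarrow> 1\<close>.
\<close>

lemma scaled_hermite_bounds:
  assumes \<theta>: "0 \<le> \<theta>" "\<theta> \<le> 1" and x: "x \<in> {-1..1}"
    and H: "\<And>x. x \<in> {-1..1} \<Longrightarrow> \<bar>hermite_obs n x\<bar> \<le> H" "0 \<le> H"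
  shows "\<bar>\<theta> * (- hermite_obs n (\<theta> * x) / \<xi> (\<theta> * x)) * \<xi> x\<bar> \<le> H"
    and "\<bar>\<theta>\<^sup>2 * (- c * hermite_obs n (\<theta> * x) / (\<xi> (\<theta> * x))\<^sup>2) * (\<xi> x * \<xi> x)\<bar> \<le> \<bar>c\<bar> * H"
proof -
  \<comment> \<open>The first expression carries the factor \<open>\<theta> * q\<close>, the second
    its square; at the endpoints the numerator is 0.\<close>
  define q where "q = \<xi> x / \<xi> (\<theta> * x)"
  have q: "0 \<le> q" "q \<le> 1"
  proof -
    have nn: "0 \<le> \<xi> y" for y by (simp add: \<xi>_def)
    then show "0 \<le> q" by (simp add: q_def)
    show "q \<le> 1"
    proof (cases "\<bar>x\<bar> < 1")
      case True
      then show ?thesis using \<xi>_scale_le[OF \<theta> True] nn[of "\<theta> * x"] by (auto simp: q_def divide_le_eq_1)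
    next
      case False
      then show ?thesis by (simp add: q_def \<xi>_def)
    qed
  qed
  have tx: "\<theta> * x \<in> {-1..1}"
  proof -
    have "\<bar>\<theta> * x\<bar> \<le> 1" using \<theta> x by (auto simp: abs_mult intro!: mult_le_one)
    then show ?thesis by auto
  qed
  have "\<theta> * (- hermite_obs n (\<theta> * x) / \<xi> (\<theta> * x)) * \<xi> x = - ((\<theta> * q) * hermite_obs n (\<theta> * x))"
    by (simp add: q_def)
  moreover have "0 \<le> \<theta> * q" using \<theta> q by simp
  ultimately have "\<bar>\<theta> * (- hermite_obs n (\<theta> * x) / \<xi> (\<theta> * x)) * \<xi> x\<bar> = (\<theta> * q) * \<bar>hermite_obs n (\<theta> * x)\<bar>"
    by (simp only: abs_minus_cancel abs_mult[of "\<theta> * q"] abs_of_nonneg)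
  also have "\<dots> \<le> 1 * H" using \<theta> q H tx by (intro mult_mono mult_le_one) auto
  finally show "\<bar>\<theta> * (- hermite_obs n (\<theta> * x) / \<xi> (\<theta> * x)) * \<xi> x\<bar> \<le> H" by simp
  have "\<theta>\<^sup>2 * (- c * hermite_obs n (\<theta> * x) / (\<xi> (\<theta> * x))\<^sup>2) * (\<xi> x * \<xi> x) = - c * ((\<theta> * q)\<^sup>2 * hermite_obs n (\<theta> * x))"
    by (simp add: q_def power2_eq_square)
  then have "\<bar>\<theta>\<^sup>2 * (- c * hermite_obs n (\<theta> * x) / (\<xi> (\<theta> * x))\<^sup>2) * (\<xi> x * \<xi> x)\<bar> = \<bar>c\<bar> * ((\<theta> * q)\<^sup>2 * \<bar>hermite_obs n (\<theta> * x)\<bar>)"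
    by (simp add: abs_mult)
  also have "\<dots> \<le> \<bar>c\<bar> * (1 * H)"
    using \<theta> q H tx by (intro mult_left_mono mult_mono power_le_one mult_le_one) auto
  finally show "\<bar>\<theta>\<^sup>2 * (- c * hermite_obs n (\<theta> * x) / (\<xi> (\<theta> * x))\<^sup>2) * (\<xi> x * \<xi> x)\<bar> \<le> \<bar>c\<bar> * H" by simp
qed

text \<open>In the interior this is continuity with a nonzero denominator. At the endpoints the
  factor \<open>\<xi> x\<close> annihilates the last two expressions, in agreement with the value 0
  of their limits.\<close>

lemma scaled_hermite_tendsto:
  assumes \<theta>: "\<theta> \<longlonglongrightarrow> 1" and x: "x \<in> {-1..1}"
  shows "(\<lambda>j. hermite_obs n (\<theta> j * x)) \<longlonglongrightarrow> hermite_obs n x"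
    and "(\<lambda>j. \<theta> j * (- hermite_obs n (\<theta> j * x) / \<xi> (\<theta> j * x)) * \<xi> x) \<longlonglongrightarrow> - hermite_obs n x"
    and "(\<lambda>j. (\<theta> j)\<^sup>2 * (- c * hermite_obs n (\<theta> j * x) / (\<xi> (\<theta> j * x))\<^sup>2) * (\<xi> x * \<xi> x)) \<longlonglongrightarrow> - c * hermite_obs n x"
proof -
  have tx: "(\<lambda>j. \<theta> j * x) \<longlonglongrightarrow> x" using tendsto_mult[OF \<theta> tendsto_const[of x]] by simp
  have h: "(\<lambda>j. hermite_obs m (\<theta> j * x)) \<longlonglongrightarrow> hermite_obs m x" for m
    by (rule isCont_tendsto_compose[OF hermite_obs_isCont tx])
  show "(\<lambda>j. hermite_obs n (\<theta> j * x)) \<longlonglongrightarrow> hermite_obs n x" by (rule h)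
  have xi: "(\<lambda>j. \<xi> (\<theta> j * x)) \<longlonglongrightarrow> \<xi> x" using h[of 0] by (simp add: hermite_obs_0)
  have "(\<lambda>j. \<theta> j * (- hermite_obs n (\<theta> j * x) / \<xi> (\<theta> j * x)) * \<xi> x) \<longlonglongrightarrow> - hermite_obs n x \<and>
    (\<lambda>j. (\<theta> j)\<^sup>2 * (- c * hermite_obs n (\<theta> j * x) / (\<xi> (\<theta> j * x))\<^sup>2) * (\<xi> x * \<xi> x)) \<longlonglongrightarrow> - c * hermite_obs n x"
  proof (cases "\<bar>x\<bar> < 1")
    case True
    have pos: "\<xi> x \<noteq> 0" using \<xi>_pos[OF True] by simp
    have "(\<lambda>j. \<theta> j * (- hermite_obs n (\<theta> j * x) / \<xi> (\<theta> j * x)) * \<xi> x) \<longlonglongrightarrow> 1 * (- hermite_obs n x / \<xi> x) * \<xi> x"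
      by (intro tendsto_mult tendsto_divide tendsto_minus tendsto_const \<theta> h xi pos)
    moreover have "(\<lambda>j. (\<theta> j)\<^sup>2 * (- c * hermite_obs n (\<theta> j * x) / (\<xi> (\<theta> j * x))\<^sup>2) * (\<xi> x * \<xi> x)) \<longlonglongrightarrow> 1\<^sup>2 * (- c * hermite_obs n x / (\<xi> x)\<^sup>2) * (\<xi> x * \<xi> x)"
      by (intro tendsto_mult tendsto_divide tendsto_minus tendsto_power tendsto_const \<theta> h xi) (use pos in simp)
    ultimately show ?thesis using pos by (simp add: power2_eq_square)
  next
    case False
    then show ?thesis by (simp add: \<xi>_def hermite_obs_def)
  qed
  then show "(\<lambda>j. \<theta> j * (- hermite_obs n (\<theta> j * x) / \<xi> (\<theta> j * x)) * \<xi> x) \<longlonglongrightarrow> - hermite_obs n x"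
    "(\<lambda>j. (\<theta> j)\<^sup>2 * (- c * hermite_obs n (\<theta> j * x) / (\<xi> (\<theta> j * x))\<^sup>2) * (\<xi> x * \<xi> x)) \<longlonglongrightarrow> - c * hermite_obs n x"
    by blast+
qed

text \<open>A strict \<open>\<theta> < 1\<close> keeps \<open>\<theta> * x\<close> in a compact part
  of the open interval, where three continuous derivatives exist. The constant depends on \<theta>,
  which is harmless: Dynkin's formula is used for each fixed \<theta> before the limit.\<close>

lemma scaled_hermite_taylor:
  fixes n :: nat and \<theta> :: real
  assumes \<theta>: "0 < \<theta>" "\<theta> < 1"
  defines "p1 \<equiv> \<lambda>x. \<theta> * (- hermite_obs (Suc n) (\<theta> * x) / \<xi> (\<theta> * x))"
    and "p2 \<equiv> \<lambda>x. \<theta>\<^sup>2 * (- real (Suc n) * hermite_obs n (\<theta> * x) / (\<xi> (\<theta> * x))\<^sup>2)"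
  shows "continuous_on {-1..1} p1" "continuous_on {-1..1} p2"
    "\<exists>K\<ge>0. \<forall>x\<in>{-1..1}. \<forall>x'\<in>{-1..1}.
      \<bar>hermite_obs n (\<theta> * x') - hermite_obs n (\<theta> * x) - p1 x * (x' - x) - p2 x / 2 * (x' - x)\<^sup>2\<bar> \<le> K * \<bar>x' - x\<bar>^3"
proof -
  have tx: "\<bar>\<theta> * x\<bar> < 1" if "x \<in> {-1..1}" for x
  proof -
    have "\<bar>\<theta> * x\<bar> = \<theta> * \<bar>x\<bar>" using \<theta> by (simp add: abs_mult)
    also have "\<dots> \<le> \<theta> * 1" using \<theta> that by (intro mult_left_mono) auto
    finally show ?thesis using \<theta> by simp
  qed
  have lin: "((\<lambda>x. \<theta> * x) has_real_derivative \<theta>) (at x)" for x by (auto intro!: derivative_eq_intros)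
  define p3 where "p3 x = \<theta> * (\<theta> * (\<theta> * (real (Suc n) * (hermite_obs (Suc n) (\<theta> * x) + 2 * hermite_obs n (\<theta> * x) * gauss_chart (\<theta> * x)) / (\<xi> (\<theta> * x))^3)))" for x
  have D0: "((\<lambda>x. hermite_obs n (\<theta> * x)) has_real_derivative p1 x) (at x)" if "x \<in> {-1..1}" for x
    using DERIV_chain2[OF hermite_obs_DERIV[OF tx[OF that], of n] lin] by (simp add: p1_def mult.commute)
  have D1: "(p1 has_real_derivative p2 x) (at x)" if "x \<in> {-1..1}" for x
    using DERIV_cmult[OF DERIV_chain2[OF hermite_obs_DERIV2[OF tx[OF that], of n] lin], of \<theta>]
    by (simp add: p1_def p2_def power2_eq_square mult_ac)
  have D2: "(p2 has_real_derivative p3 x) (at x)" if "x \<in> {-1..1}" for x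
    using DERIV_cmult[OF DERIV_chain2[OF hermite_obs_DERIV3[OF tx[OF that], of n] lin], of "\<theta>\<^sup>2"]
    unfolding p2_def p3_def by (simp add: power2_eq_square mult_ac)
  show "continuous_on {-1..1} p1" by (intro continuous_at_imp_continuous_on ballI DERIV_isCont[OF D1])
  show "continuous_on {-1..1} p2" by (intro continuous_at_imp_continuous_on ballI DERIV_isCont[OF D2])
  have lc: "continuous_on {-1..1} (\<lambda>x. \<theta> * x)" by (intro continuous_intros)
  have gc: "continuous_on {-1..1} (\<lambda>x. gauss_chart (\<theta> * x))"
  proof (intro continuous_at_imp_continuous_on ballI)
    fix x :: real assume "x \<in> {-1..1}"
    from DERIV_isCont[OF DERIV_chain2[OF gauss_chart_DERIV[OF tx[OF this]] lin]] show "isCont (\<lambda>x. gauss_chart (\<theta> * x)) x" .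
  qed
  have xc: "continuous_on {-1..1} (\<lambda>x. \<xi> (\<theta> * x))"
    by (rule continuous_on_compose2[OF \<xi>_continuous lc subset_UNIV])
  have hc: "continuous_on {-1..1} (\<lambda>x. hermite_obs m (\<theta> * x))" for m
    by (rule continuous_on_compose2[OF hermite_obs_continuous lc subset_UNIV])
  have "continuous_on {-1..1} p3"
    unfolding p3_def
    by (intro continuous_on_mult continuous_on_divide continuous_on_add continuous_on_power continuous_on_const gc xc hc)
       (use \<xi>_pos[OF tx] in force)
  then obtain K where K: "0 < K" "\<And>x. x \<in> {-1..1} \<Longrightarrow> \<bar>p3 x\<bar> \<le> K"
    using compact_continuous_bound[OF compact_Icc] by blast
  show "\<exists>K\<ge>0. \<forall>x\<in>{-1..1}. \<forall>x'\<in>{-1..1}.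
      \<bar>hermite_obs n (\<theta> * x') - hermite_obs n (\<theta> * x) - p1 x * (x' - x) - p2 x / 2 * (x' - x)\<^sup>2\<bar> \<le> K * \<bar>x' - x\<bar>^3"
  proof (intro exI[of _ K] conjI ballI)
    fix x x' :: real assume x: "x \<in> {-1..1}" "x' \<in> {-1..1}"
    show "\<bar>hermite_obs n (\<theta> * x') - hermite_obs n (\<theta> * x) - p1 x * (x' - x) - p2 x / 2 * (x' - x)\<^sup>2\<bar> \<le> K * \<bar>x' - x\<bar>^3"
      by (rule cubic_taylor_bound[OF D0 D1 D2 K(2) x])
  qed (use K in simp)
qed

section \<open>The hierarchy of correlations\<close>

abbreviation (in prob_space) hermite_corr ::
    "nat \<Rightarrow> (real \<Rightarrow> 'a \<Rightarrow> real) \<Rightarrow> (real \<Rightarrow> 'a \<Rightarrow> real) \<Rightarrow> real \<Rightarrow> real" where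
  "hermite_corr n X Y r \<equiv> \<integral>\<omega>. hermite_obs n (X r \<omega>) * hermite_obs n (Y r \<omega>) \<partial>M"

context brownian_motion begin

lemma hermite_correlation_continuous:
  assumes X: "sde_solution M F B {-1..1} \<xi> u 0 X" and Y: "sde_solution M F B {-1..1} \<xi> v 0 Y"
  shows "continuous_on {0..T} (\<lambda>r. hermite_corr n X Y r)"
proof -
  have "continuous_on {0..T} (\<lambda>r. \<integral>\<omega>. 1 * (hermite_obs n (fst (X r \<omega>, Y r \<omega>)) * hermite_obs n (snd (X r \<omega>, Y r \<omega>))) \<partial>M)"
  proof (rule compact_process_continuous[OF sde_compact_process_pair[OF X Y compact_Icc], where C=1])
    show "(\<lambda>z. hermite_obs n (fst z) * hermite_obs n (snd z)) \<in> borel_measurable borel"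
      by (intro borel_measurable_times borel_measurable_fst_compose borel_measurable_snd_compose hermite_obs_measurable)
    show "continuous_on ({-1..1} \<times> {-1..1}) (\<lambda>z. hermite_obs n (fst z) * hermite_obs n (snd z))"
      by (intro continuous_on_mult continuous_on_compose2[OF hermite_obs_continuous[of UNIV]] continuous_intros) auto
  qed auto
  then show ?thesis by simp
qed

text \<open>Dynkin's formula for the scaled observables, then \<theta> to 1. Each variable
  contributes \<open>- (n + 1) / 2\<close>, and the product of the first derivatives with the two
  factors \<open>\<xi>\<close> turns into the pair of next observables.\<close>

lemma hermite_hierarchy:
  assumes X: "sde_solution M F B {-1..1} \<xi> u 0 X" and Y: "sde_solution M F B {-1..1} \<xi> v 0 Y"
    and u: "u \<bullet> u = 1" and v: "v \<bullet> v = 1" and T: "0 \<le> T"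
  shows "hermite_corr n X Y T - (gauss_deriv n 0)\<^sup>2
    = - real (Suc n) * integral {0..T} (\<lambda>r. hermite_corr n X Y r)
      + (u \<bullet> v) * integral {0..T} (\<lambda>r. hermite_corr (Suc n) X Y r)"
proof -
  let ?I = "{-1..1::real}"
  define c where "c = real (Suc n)"
  \<comment> \<open>The double \<open>Suc\<close> starts the sequence at 1/2, so that every member
    lies strictly between 0 and 1.\<close>
  define \<theta> where "\<theta> j = 1 - inverse (real (Suc (Suc j)))" for j
  have \<theta>: "0 < \<theta> j" "\<theta> j < 1" for j
  proof -
    have "inverse (real (Suc (Suc j))) < 1" by (rule inverse_less_1_iff[THEN iffD2]) simp
    then show "0 < \<theta> j" by (simp add: \<theta>_def)
    show "\<theta> j < 1" by (simp add: \<theta>_def)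
  qed
  have \<theta>lim: "\<theta> \<longlonglongrightarrow> 1"
  proof -
    have "(\<lambda>j. 1 - inverse (real (Suc (Suc j)))) \<longlonglongrightarrow> 1 - 0"
      by (intro tendsto_diff tendsto_const LIMSEQ_Suc[OF LIMSEQ_inverse_real_of_nat])
    then show ?thesis by (simp add: \<theta>_def[abs_def])
  qed
  define p where "p j x = hermite_obs n (\<theta> j * x)" for j x
  define p1 where "p1 j x = \<theta> j * (- hermite_obs (Suc n) (\<theta> j * x) / \<xi> (\<theta> j * x))" for j x
  define p2 where "p2 j x = (\<theta> j)\<^sup>2 * (- c * hermite_obs n (\<theta> j * x) / (\<xi> (\<theta> j * x))\<^sup>2)" for j x
  have pm: "p j \<in> borel_measurable borel" "p1 j \<in> borel_measurable borel" "p2 j \<in> borel_measurable borel" for j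
    unfolding p_def[abs_def] p1_def[abs_def] p2_def[abs_def] by measurable
  have pc: "continuous_on ?I (p j)" for j
    unfolding p_def[abs_def]
    by (rule continuous_on_compose2[OF hermite_obs_continuous _ subset_UNIV]) (intro continuous_intros)
  have p1c: "continuous_on ?I (p1 j)" and p2c: "continuous_on ?I (p2 j)" for j
    unfolding p1_def[abs_def] p2_def[abs_def] c_def using scaled_hermite_taylor(1,2)[OF \<theta>, of j n] by auto
  define P where "P t \<omega> = (X t \<omega>, Y t \<omega>)" for t \<omega>
  have P: "compact_process (?I \<times> ?I) P"
    using sde_compact_process_pair[OF X Y compact_Icc] by (simp add: P_def[abs_def])
  define G1 where "G1 j z = (p2 j (fst z) * p j (snd z) / 2) * (\<xi> (fst z) * \<xi> (fst z))" for j z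
  define G2 where "G2 j z = (p j (fst z) * p2 j (snd z) / 2) * (\<xi> (snd z) * \<xi> (snd z))" for j z
  define G3 where "G3 j z = (p1 j (fst z) * p1 j (snd z)) * (\<xi> (fst z) * \<xi> (snd z))" for j z
  define G where "G j z = G1 j z + G2 j z + (u \<bullet> v) * G3 j z" for j z
  have Gim: "G1 j \<in> borel_measurable borel" "G2 j \<in> borel_measurable borel" "G3 j \<in> borel_measurable borel" for j
    unfolding G1_def[abs_def] G2_def[abs_def] G3_def[abs_def]
    by (intro borel_measurable_divide borel_measurable_times borel_measurable_fst_compose borel_measurable_snd_compose pm \<xi>_measurable borel_measurable_const)+
  have Gic: "continuous_on (?I \<times> ?I) (G1 j)" "continuous_on (?I \<times> ?I) (G2 j)" "continuous_on (?I \<times> ?I) (G3 j)" for j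
    unfolding G1_def[abs_def] G2_def[abs_def] G3_def[abs_def] divide_inverse
    by (intro continuous_on_mult continuous_on_fst_compose continuous_on_snd_compose pc p1c p2c \<xi>_continuous continuous_on_const)+
  have Gm: "G j \<in> borel_measurable borel" for j
    unfolding G_def[abs_def] by (intro borel_measurable_add borel_measurable_times Gim borel_measurable_const)
  have Gc: "continuous_on (?I \<times> ?I) (G j)" for j
    unfolding G_def[abs_def] by (intro continuous_on_add continuous_on_mult Gic continuous_on_const)
  \<comment> \<open>The pointwise limit of the generator terms \<open>G j\<close>; the two minus
    signs of the first derivatives cancel in the coupling term.\<close>
  define Q where "Q z = - c * (hermite_obs n (fst z) * hermite_obs n (snd z)) + (u \<bullet> v) * (hermite_obs (Suc n) (fst z) * hermite_obs (Suc n) (snd z))" for z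
  have Qm: "Q \<in> borel_measurable borel"
    unfolding Q_def[abs_def] by (intro borel_measurable_add borel_measurable_times borel_measurable_fst_compose borel_measurable_snd_compose hermite_obs_measurable borel_measurable_const)
  obtain H where H: "0 < H" "\<And>x. x \<in> ?I \<Longrightarrow> \<bar>hermite_obs n x\<bar> \<le> H"
    using compact_continuous_bound[OF compact_Icc hermite_obs_continuous] by blast
  obtain H' where H': "0 < H'" "\<And>x. x \<in> ?I \<Longrightarrow> \<bar>hermite_obs (Suc n) x\<bar> \<le> H'"
    using compact_continuous_bound[OF compact_Icc hermite_obs_continuous] by blast
  have Geq: "G j z = (p2 j (fst z) * (\<xi> (fst z) * \<xi> (fst z))) * p j (snd z) / 2 + p j (fst z) * (p2 j (snd z) * (\<xi> (snd z) * \<xi> (snd z))) / 2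
    + (u \<bullet> v) * ((p1 j (fst z) * \<xi> (fst z)) * (p1 j (snd z) * \<xi> (snd z)))" for j z
    by (simp add: G_def G1_def G2_def G3_def mult_ac)
  have Glim: "(\<lambda>j. G j z) \<longlonglongrightarrow> Q z" if z: "z \<in> ?I \<times> ?I" for z
  proof -
    have z': "fst z \<in> ?I" "snd z \<in> ?I" using z by auto
    note l1 = scaled_hermite_tendsto(1)[OF \<theta>lim z'(1), of n, folded p_def] scaled_hermite_tendsto(1)[OF \<theta>lim z'(2), of n, folded p_def]
    note l2 = scaled_hermite_tendsto(2)[OF \<theta>lim z'(1), of "Suc n", folded p1_def] scaled_hermite_tendsto(2)[OF \<theta>lim z'(2), of "Suc n", folded p1_def]
    note l3 = scaled_hermite_tendsto(3)[OF \<theta>lim z'(1), of c n, folded p2_def] scaled_hermite_tendsto(3)[OF \<theta>lim z'(2), of c n, folded p2_def]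
    have "(\<lambda>j. G j z) \<longlonglongrightarrow> (- c * hermite_obs n (fst z)) * hermite_obs n (snd z) / 2 + hermite_obs n (fst z) * (- c * hermite_obs n (snd z)) / 2
      + (u \<bullet> v) * ((- hermite_obs (Suc n) (fst z)) * (- hermite_obs (Suc n) (snd z)))"
      unfolding Geq by (intro tendsto_add tendsto_mult tendsto_divide tendsto_const l1 l2 l3) auto
    then show ?thesis by (simp add: Q_def algebra_simps)
  qed
  \<comment> \<open>Independent of \<open>j\<close>, because \<open>scaled_hermite_bounds\<close> is
    uniform in \<theta>; this is what permits dominated convergence although the derivatives
    themselves are unbounded.\<close>
  define C where "C = c * H * H / 2 + H * (c * H) / 2 + \<bar>u \<bullet> v\<bar> * (H' * H')"
  have c0: "\<bar>c\<bar> = c" by (simp add: c_def)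
  have pb: "\<bar>p j x\<bar> \<le> H" if "x \<in> ?I" for j x
  proof -
    have "\<bar>\<theta> j * x\<bar> \<le> 1" using \<theta>[of j] that by (auto simp: abs_mult intro!: mult_le_one)
    then show ?thesis unfolding p_def by (intro H) auto
  qed
  have p1b: "\<bar>p1 j x * \<xi> x\<bar> \<le> H'" if "x \<in> ?I" for j x
    unfolding p1_def by (rule scaled_hermite_bounds(1)) (use \<theta>[of j] that H' in auto)
  have p2b: "\<bar>p2 j x * (\<xi> x * \<xi> x)\<bar> \<le> c * H" if "x \<in> ?I" for j x
  proof -
    have "\<bar>p2 j x * (\<xi> x * \<xi> x)\<bar> \<le> \<bar>c\<bar> * H"
      unfolding p2_def by (rule scaled_hermite_bounds(2)) (use \<theta>[of j] that H in auto)
    then show ?thesis by (simp only: c0)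
  qed
  have Gb: "\<bar>G j z\<bar> \<le> C" if z: "z \<in> ?I \<times> ?I" for j z
  proof -
    have z': "fst z \<in> ?I" "snd z \<in> ?I" using z by auto
    have ch: "0 \<le> c * H" using H by (simp add: c_def)
    have "\<bar>(p2 j (fst z) * (\<xi> (fst z) * \<xi> (fst z))) * p j (snd z)\<bar> \<le> c * H * H"
      unfolding abs_mult[of _ "p j (snd z)"] using ch by (intro mult_mono p2b pb z') auto
    moreover have "\<bar>p j (fst z) * (p2 j (snd z) * (\<xi> (snd z) * \<xi> (snd z)))\<bar> \<le> H * (c * H)"
      unfolding abs_mult[of "p j (fst z)"] using H by (intro mult_mono p2b pb z') auto
    moreover have "\<bar>(p1 j (fst z) * \<xi> (fst z)) * (p1 j (snd z) * \<xi> (snd z))\<bar> \<le> H' * H'"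
      unfolding abs_mult[of "p1 j (fst z) * \<xi> (fst z)"] using H' by (intro mult_mono p1b z') auto
    then have "\<bar>(u \<bullet> v) * ((p1 j (fst z) * \<xi> (fst z)) * (p1 j (snd z) * \<xi> (snd z)))\<bar> \<le> \<bar>u \<bullet> v\<bar> * (H' * H')"
      unfolding abs_mult[of "u \<bullet> v"] by (intro mult_left_mono) auto
    ultimately show ?thesis unfolding Geq C_def by linarith
  qed
  have dyn: "(\<integral>\<omega>. p j (X T \<omega>) * p j (Y T \<omega>) \<partial>M) - p j 0 * p j 0 = integral {0..T} (\<lambda>r. \<integral>\<omega>. G j (P r \<omega>) \<partial>M)" for j
  proof -
    have "\<exists>K\<ge>0. \<forall>x\<in>?I. \<forall>x'\<in>?I. \<bar>p j x' - p j x - p1 j x * (x' - x) - p2 j x / 2 * (x' - x)\<^sup>2\<bar> \<le> K * \<bar>x' - x\<bar>^3"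
      unfolding p_def p1_def p2_def c_def by (rule scaled_hermite_taylor(3)[OF \<theta>])
    then obtain K where K0: "0 \<le> K"
      and K: "\<forall>x\<in>?I. \<forall>x'\<in>?I. \<bar>p j x' - p j x - p1 j x * (x' - x) - p2 j x / 2 * (x' - x)\<^sup>2\<bar> \<le> K * \<bar>x' - x\<bar>^3" by blast
    note Kb = K[THEN bspec, THEN bspec]
    have "(\<integral>\<omega>. p j (X T \<omega>) * p j (Y T \<omega>) \<partial>M) - p j 0 * p j 0
      = integral {0..T} (\<lambda>r. (u \<bullet> u) * (\<integral>\<omega>. G1 j (P r \<omega>) \<partial>M) + (v \<bullet> v) * (\<integral>\<omega>. G2 j (P r \<omega>) \<partial>M) + (u \<bullet> v) * (\<integral>\<omega>. G3 j (P r \<omega>) \<partial>M))"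
      unfolding G1_def G2_def G3_def P_def fst_conv snd_conv
      by (rule dynkin_formula[OF X Y \<xi>_measurable \<xi>_continuous pm pm pc p1c p2c pc p1c p2c Kb Kb K0 T])
    also have "\<dots> = integral {0..T} (\<lambda>r. \<integral>\<omega>. G j (P r \<omega>) \<partial>M)"
    proof (rule Henstock_Kurzweil_Integration.integral_cong)
      fix r assume "r \<in> {0..T}"
      then have r: "0 \<le> r" by simp
      have i1: "integrable M (\<lambda>\<omega>. G1 j (P r \<omega>))" by (rule compact_process_integrable[OF P Gim(1) Gic(1) r])
      have i2: "integrable M (\<lambda>\<omega>. G2 j (P r \<omega>))" by (rule compact_process_integrable[OF P Gim(2) Gic(2) r])
      have i3: "integrable M (\<lambda>\<omega>. G3 j (P r \<omega>))" by (rule compact_process_integrable[OF P Gim(3) Gic(3) r])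
      show "(u \<bullet> u) * (\<integral>\<omega>. G1 j (P r \<omega>) \<partial>M) + (v \<bullet> v) * (\<integral>\<omega>. G2 j (P r \<omega>) \<partial>M) + (u \<bullet> v) * (\<integral>\<omega>. G3 j (P r \<omega>) \<partial>M) = (\<integral>\<omega>. G j (P r \<omega>) \<partial>M)"
        unfolding G_def u v using i1 i2 i3 by simp
    qed
    finally show ?thesis .
  qed
  have limR: "(\<lambda>j. integral {0..T} (\<lambda>r. \<integral>\<omega>. G j (P r \<omega>) \<partial>M)) \<longlonglongrightarrow> integral {0..T} (\<lambda>r. \<integral>\<omega>. Q (P r \<omega>) \<partial>M)"
    by (rule expectation_integral_tendsto_compact[OF P Gm Gc Qm Gb Glim])
  have limL: "(\<lambda>j. (\<integral>\<omega>. p j (X T \<omega>) * p j (Y T \<omega>) \<partial>M) - p j 0 * p j 0)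
      \<longlonglongrightarrow> hermite_corr n X Y T - (gauss_deriv n 0)\<^sup>2"
  proof (rule tendsto_diff)
    have "(\<lambda>j. \<integral>\<omega>. (\<lambda>z. p j (fst z) * p j (snd z)) (P T \<omega>) \<partial>M) \<longlonglongrightarrow> (\<integral>\<omega>. (\<lambda>z. hermite_obs n (fst z) * hermite_obs n (snd z)) (P T \<omega>) \<partial>M)"
    proof (rule expectation_tendsto_compact[OF P _ _ _ _ T, where C="H * H"])
      show "(\<lambda>z. p j (fst z) * p j (snd z)) \<in> borel_measurable borel" for j
        by (intro borel_measurable_times borel_measurable_fst_compose borel_measurable_snd_compose pm)
      show "(\<lambda>z. hermite_obs n (fst z) * hermite_obs n (snd z)) \<in> borel_measurable borel"
        by (intro borel_measurable_times borel_measurable_fst_compose borel_measurable_snd_compose hermite_obs_measurable)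
      fix z :: "real \<times> real" assume z: "z \<in> ?I \<times> ?I"
      then have z': "fst z \<in> ?I" "snd z \<in> ?I" by auto
      show "\<bar>p j (fst z) * p j (snd z)\<bar> \<le> H * H" for j
        unfolding abs_mult using H by (intro mult_mono pb z') auto
      show "(\<lambda>j. p j (fst z) * p j (snd z)) \<longlonglongrightarrow> hermite_obs n (fst z) * hermite_obs n (snd z)"
        unfolding p_def by (intro tendsto_mult scaled_hermite_tendsto(1) \<theta>lim z')
    qed
    then show "(\<lambda>j. \<integral>\<omega>. p j (X T \<omega>) * p j (Y T \<omega>) \<partial>M) \<longlonglongrightarrow> hermite_corr n X Y T"
      by (simp add: P_def)
    show "(\<lambda>j. p j 0 * p j 0) \<longlonglongrightarrow> (gauss_deriv n 0)\<^sup>2"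
      by (simp add: p_def hermite_obs_at_0 power2_eq_square)
  qed
  have "hermite_corr n X Y T - (gauss_deriv n 0)\<^sup>2 = integral {0..T} (\<lambda>r. \<integral>\<omega>. Q (P r \<omega>) \<partial>M)"
    by (rule LIMSEQ_unique[OF limL[unfolded dyn] limR])
  also have "\<dots> = integral {0..T} (\<lambda>r. - c * hermite_corr n X Y r
      + (u \<bullet> v) * hermite_corr (Suc n) X Y r)"
  proof (rule Henstock_Kurzweil_Integration.integral_cong)
    fix r assume "r \<in> {0..T}"
    then have r: "0 \<le> r" by simp
    have "integrable M (\<lambda>\<omega>. (\<lambda>z. hermite_obs m (fst z) * hermite_obs m (snd z)) (P r \<omega>))" for m
      by (rule compact_process_integrable[OF P _ _ r])
         (intro borel_measurable_times borel_measurable_fst_compose borel_measurable_snd_compose hermite_obs_measurable continuous_on_mult continuous_on_fst_compose continuous_on_snd_compose hermite_obs_continuous)+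
    then have i: "integrable M (\<lambda>\<omega>. hermite_obs m (X r \<omega>) * hermite_obs m (Y r \<omega>))" for m by (simp add: P_def)
    show "(\<integral>\<omega>. Q (P r \<omega>) \<partial>M) = - c * hermite_corr n X Y r
      + (u \<bullet> v) * hermite_corr (Suc n) X Y r"
      unfolding Q_def P_def fst_conv snd_conv
      by (subst Bochner_Integration.integral_add[OF integrable_mult_right[OF i] integrable_mult_right[OF i]]) simp
  qed
  also have "\<dots> = - c * integral {0..T} (\<lambda>r. hermite_corr n X Y r)
      + (u \<bullet> v) * integral {0..T} (\<lambda>r. hermite_corr (Suc n) X Y r)"
    by (rule integral_unique)
       (intro has_integral_add has_integral_mult_right integrable_integral integrable_continuous_real hermite_correlation_continuous[OF X Y])
  finally show ?thesis by (simp only: c_def)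
qed

text \<open>The bottom of the hierarchy: the covariance identity from time 0 with weight 1, where
  \<open>\<xi>\<close> itself is the observable of level 0.\<close>

lemma sticky_correlation:
  assumes X: "sde_solution M F B {-1..1} \<xi> u 0 X" and Y: "sde_solution M F B {-1..1} \<xi> v 0 Y" and T: "0 \<le> T"
  shows "(\<integral>\<omega>. X T \<omega> * Y T \<omega> \<partial>M)
    = (u \<bullet> v) * integral {0..T} (\<lambda>r. hermite_corr 0 X Y r)"
proof -
  have "AE \<omega> in M. X 0 \<omega> = 0" "AE \<omega> in M. Y 0 \<omega> = 0" using X Y by (auto simp: sde_solution_def)
  then have eq: "AE \<omega> in M. X T \<omega> * Y T \<omega> = 1 * ((X T \<omega> - X 0 \<omega>) * (Y T \<omega> - Y 0 \<omega>))"
    by eventually_elim simp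
  note [measurable] = sde_measurable[OF X T] sde_measurable[OF Y T] sde_measurable[OF X order_refl] sde_measurable[OF Y order_refl]
  have "(\<integral>\<omega>. X T \<omega> * Y T \<omega> \<partial>M) = (\<integral>\<omega>. 1 * ((X T \<omega> - X 0 \<omega>) * (Y T \<omega> - Y 0 \<omega>)) \<partial>M)"
    by (rule integral_cong_AE[OF _ _ eq]) measurable
  also have "\<dots> = (u \<bullet> v) * integral {0..T} (\<lambda>r. \<integral>\<omega>. 1 * (\<xi> (X r \<omega>) * \<xi> (Y r \<omega>)) \<partial>M)"
    by (rule sde_increment_covariance[OF X Y compact_Icc \<xi>_measurable \<xi>_continuous order_refl T known_bounded_const])
  finally show ?thesis by (simp add: hermite_obs_0)
qed

text \<open>Solving \<open>hermite_hierarchy\<close> for the time integral of level \<open>N\<close>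
  divides by \<open>N + 1\<close>, and these divisions build up the factorials. The identity is
  exact at each finite \<open>T\<close>, its last term being the remainder.\<close>

lemma sticky_correlation_expansion:
  fixes X Y :: "real \<Rightarrow> 'a \<Rightarrow> real"
  assumes X: "sde_solution M F B {-1..1} \<xi> u 0 X" and Y: "sde_solution M F B {-1..1} \<xi> v 0 Y"
    and u: "u \<bullet> u = 1" and v: "v \<bullet> v = 1" and T: "0 \<le> T"
  shows "(\<integral>\<omega>. X T \<omega> * Y T \<omega> \<partial>M)
    = (\<Sum>n<N. (u \<bullet> v) ^ Suc n / fact (Suc n) * ((gauss_deriv n 0)\<^sup>2 - hermite_corr n X Y T))
      + (u \<bullet> v) ^ Suc N / fact N * integral {0..T} (\<lambda>r. hermite_corr N X Y r)"
proof (induction N)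
  case 0
  then show ?case using sticky_correlation[OF X Y T] by simp
next
  case (Suc N)
  define \<rho> where "\<rho> = u \<bullet> v"
  define a where "a = hermite_corr N X Y T"
  define I where "I = integral {0..T} (\<lambda>r. hermite_corr N X Y r)"
  define J where "J = integral {0..T} (\<lambda>r. hermite_corr (Suc N) X Y r)"
  define b where "b = (gauss_deriv N 0)\<^sup>2"
  have "a - b = - real (Suc N) * I + \<rho> * J"
    using hermite_hierarchy[OF X Y u v T, of N] by (simp only: a_def b_def I_def J_def \<rho>_def)
  then have I: "I = (b - a + \<rho> * J) / real (Suc N)" by (simp add: field_simps)
  have "\<rho> ^ Suc N / fact N * I = \<rho> ^ Suc N / fact (Suc N) * (b - a) + \<rho> ^ Suc (Suc N) / fact (Suc N) * J"
  proof -
    have "r / k * ((x + \<rho> * J) / m) = r / (m * k) * x + (\<rho> * r) / (m * k) * J" if "k \<noteq> 0" "m \<noteq> 0" for r k m x :: real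
      using that by (simp add: field_simps)
    from this[of "fact N" "real (Suc N)" "\<rho> ^ Suc N" "b - a"] show ?thesis
      unfolding I fact_Suc power_Suc[of \<rho> "Suc N"] by simp
  qed
  then show ?case
    using Suc.IH unfolding sum.lessThan_Suc \<rho>_def[symmetric] a_def[symmetric] b_def[symmetric] I_def[symmetric] J_def[symmetric]
    by simp
qed

text \<open>The pointwise inequality \<open>\<bar>x * y\<bar> \<le> (x * x + y * y) / 2\<close>,
  integrated over the sample space and over time.\<close>

lemma hermite_correlation_bound:
  assumes X: "sde_solution M F B {-1..1} \<xi> u 0 X" and Y: "sde_solution M F B {-1..1} \<xi> v 0 Y"
  shows "\<bar>integral {0..T} (\<lambda>r. hermite_corr n X Y r)\<bar>
    \<le> (integral {0..T} (\<lambda>r. hermite_corr n X X r)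
      + integral {0..T} (\<lambda>r. hermite_corr n Y Y r)) / 2"
proof -
  let ?c = "\<lambda>X Y r. hermite_corr n X Y r"
  have int: "?c X Y integrable_on {0..T}" "?c X X integrable_on {0..T}" "?c Y Y integrable_on {0..T}"
    by (intro integrable_continuous_real hermite_correlation_continuous[OF X Y] hermite_correlation_continuous[OF X X] hermite_correlation_continuous[OF Y Y])+
  have i: "integrable M (\<lambda>\<omega>. hermite_obs n (X r \<omega>) * hermite_obs n (Y r \<omega>))"
    if X: "sde_solution M F B {-1..1} \<xi> u 0 X" and Y: "sde_solution M F B {-1..1} \<xi> v 0 Y" and r: "0 \<le> r" for X Y u v r
  proof -
    have "integrable M (\<lambda>\<omega>. (\<lambda>z. hermite_obs n (fst z) * hermite_obs n (snd z)) (X r \<omega>, Y r \<omega>))"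
    proof (rule compact_process_integrable[OF sde_compact_process_pair[OF X Y compact_Icc] _ _ r])
      show "(\<lambda>z. hermite_obs n (fst z) * hermite_obs n (snd z)) \<in> borel_measurable borel"
        by (intro borel_measurable_times borel_measurable_fst_compose borel_measurable_snd_compose hermite_obs_measurable)
      show "continuous_on ({-1..1} \<times> {-1..1}) (\<lambda>z. hermite_obs n (fst z) * hermite_obs n (snd z))"
        by (intro continuous_on_mult continuous_on_compose2[OF hermite_obs_continuous[of UNIV]] continuous_intros) auto
    qed
    then show ?thesis by simp
  qed
  have ptw: "norm (?c X Y r) \<le> (?c X X r + ?c Y Y r) / 2" if "r \<in> {0..T}" for r
  proof -
    have r: "0 \<le> r" using that by simp
    note ii = i[OF X Y r] i[OF X X r] i[OF Y Y r]
    have "norm (?c X Y r) \<le> (\<integral>\<omega>. \<bar>hermite_obs n (X r \<omega>) * hermite_obs n (Y r \<omega>)\<bar> \<partial>M)" by (simp add: integral_abs_bound)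
    also have "\<dots> \<le> (\<integral>\<omega>. (hermite_obs n (X r \<omega>) * hermite_obs n (X r \<omega>) + hermite_obs n (Y r \<omega>) * hermite_obs n (Y r \<omega>)) / 2 \<partial>M)"
    proof (rule integral_mono)
      fix \<omega>
      have "\<bar>x * y\<bar> \<le> (x * x + y * y) / 2" for x y :: real
      proof -
        have "0 \<le> (\<bar>x\<bar> - \<bar>y\<bar>)\<^sup>2" by simp
        then show ?thesis by (simp add: power2_diff abs_mult) (simp add: power2_eq_square)
      qed
      then show "\<bar>hermite_obs n (X r \<omega>) * hermite_obs n (Y r \<omega>)\<bar> \<le> (hermite_obs n (X r \<omega>) * hermite_obs n (X r \<omega>) + hermite_obs n (Y r \<omega>) * hermite_obs n (Y r \<omega>)) / 2" .
    qed (use ii in auto)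
    also have "\<dots> = (?c X X r + ?c Y Y r) / 2" using ii by simp
    finally show ?thesis .
  qed
  have hi: "((\<lambda>r. (?c X X r + ?c Y Y r) / 2) has_integral (integral {0..T} (?c X X) + integral {0..T} (?c Y Y)) / 2) {0..T}"
    by (intro has_integral_divide has_integral_add integrable_integral int)
  have "norm (integral {0..T} (?c X Y)) \<le> integral {0..T} (\<lambda>r. (?c X X r + ?c Y Y r) / 2)"
    by (rule integral_norm_bound_integral[OF int(1) has_integral_integrable[OF hi] ptw])
  then show ?thesis using integral_unique[OF hi] by simp
qed

text \<open>The expansion taken with equal processes writes the diagonal time integrals as a second
  moment minus a finite sum. Substituting this eliminates all time integrals, so that only
  quantities at the single time \<open>T\<close> remain.\<close>

lemma sticky_correlation_estimate:
  fixes X Y :: "real \<Rightarrow> 'a \<Rightarrow> real"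
  assumes X: "sde_solution M F B {-1..1} \<xi> u 0 X" and Y: "sde_solution M F B {-1..1} \<xi> v 0 Y"
    and u: "u \<bullet> u = 1" and v: "v \<bullet> v = 1" and T: "0 \<le> T"
  shows "\<bar>(\<integral>\<omega>. X T \<omega> * Y T \<omega> \<partial>M)
      - (\<Sum>n<N. (u \<bullet> v) ^ Suc n / fact (Suc n) * ((gauss_deriv n 0)\<^sup>2 - hermite_corr n X Y T))\<bar>
    \<le> (((\<integral>\<omega>. X T \<omega> * X T \<omega> \<partial>M)
      - (\<Sum>n<N. 1 / fact (Suc n) * ((gauss_deriv n 0)\<^sup>2 - hermite_corr n X X T)))
      + ((\<integral>\<omega>. Y T \<omega> * Y T \<omega> \<partial>M)
      - (\<Sum>n<N. 1 / fact (Suc n) * ((gauss_deriv n 0)\<^sup>2 - hermite_corr n Y Y T)))) / 2"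
proof -
  define I where "I = integral {0..T} (\<lambda>r. hermite_corr N X Y r)"
  define Ju where "Ju = integral {0..T} (\<lambda>r. hermite_corr N X X r)"
  define Jv where "Jv = integral {0..T} (\<lambda>r. hermite_corr N Y Y r)"
  have \<rho>: "\<bar>u \<bullet> v\<bar> \<le> 1"
    using Cauchy_Schwarz_ineq2[of u v] u v by (simp add: norm_eq_sqrt_inner)
  have "\<bar>(u \<bullet> v) ^ Suc N / fact N * I\<bar> = \<bar>u \<bullet> v\<bar> ^ Suc N * (\<bar>I\<bar> / fact N)"
    by (simp add: abs_mult power_abs)
  also have "\<dots> \<le> 1 * (\<bar>I\<bar> / fact N)"
    using \<rho> by (intro mult_right_mono power_le_one) auto
  also have "\<dots> \<le> ((Ju + Jv) / 2) / fact N"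
    using divide_right_mono[OF hermite_correlation_bound[OF X Y, of T N], of "fact N"]
    unfolding I_def Ju_def Jv_def mult_1_left by simp
  also have "\<dots> = (1 / fact N * Ju + 1 / fact N * Jv) / 2" by (simp add: add_divide_distrib)
  finally have b: "\<bar>(u \<bullet> v) ^ Suc N / fact N * I\<bar> \<le> (1 / fact N * Ju + 1 / fact N * Jv) / 2" .
  have combine: "\<bar>e - s\<bar> \<le> ((e1 - s1) + (e2 - s2)) / 2"
    if "\<bar>r\<bar> \<le> (p + q) / 2" "e = s + r" "e1 = s1 + p" "e2 = s2 + q" for e s e1 s1 e2 s2 r p q :: real
    using that by simp
  show ?thesis
    by (rule combine[OF b sticky_correlation_expansion[OF X Y u v T, of N, folded I_def]
          sticky_correlation_expansion[OF X X u u T, of N, folded Ju_def, unfolded u power_one]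
          sticky_correlation_expansion[OF Y Y v v T, of N, folded Jv_def, unfolded v power_one]])
qed

text \<open>The limit lies in \<open>S\<close> because \<open>S\<close> is closed, so continuity of
  \<open>g\<close> on \<open>S\<close> applies there as well; boundedness on \<open>S\<close> gives
  domination.\<close>

lemma limit_expectation:
  fixes g :: "real \<times> real \<Rightarrow> real"
  assumes P: "compact_process S P" and g: "g \<in> borel_measurable borel" "continuous_on S g"
    and \<sigma>: "\<sigma> \<in> borel_measurable M" and lim: "AE \<omega> in M. ((\<lambda>t. P t \<omega>) \<longlongrightarrow> \<sigma> \<omega>) at_top"
  shows "(\<lambda>i. \<integral>\<omega>. g (P (real i) \<omega>) \<partial>M) \<longlonglongrightarrow> (\<integral>\<omega>. g (\<sigma> \<omega>) \<partial>M)"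
proof -
  have S: "compact S" and AS: "AE \<omega> in M. \<forall>t\<ge>0. P t \<omega> \<in> S" using P by (auto simp: compact_process_def)
  obtain K where K: "\<And>p. p \<in> S \<Longrightarrow> \<bar>g p\<bar> \<le> K" using compact_continuous_bound[OF S g(2)] by blast
  show ?thesis
  proof (rule integral_dominated_convergence[where w="\<lambda>_. K"])
    show "(\<lambda>\<omega>. g (\<sigma> \<omega>)) \<in> borel_measurable M" by (rule measurable_compose[OF \<sigma> g(1)])
    show "(\<lambda>\<omega>. g (P (real i) \<omega>)) \<in> borel_measurable M" for i
      by (rule measurable_compose[OF _ g(1)]) (use P in \<open>simp add: compact_process_def\<close>)
    show "AE \<omega> in M. norm (g (P (real i) \<omega>)) \<le> K" for i
      using AS by eventually_elim (use K in auto)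
    show "AE \<omega> in M. (\<lambda>i. g (P (real i) \<omega>)) \<longlonglongrightarrow> g (\<sigma> \<omega>)"
      using AS lim
    proof eventually_elim
      case (elim \<omega>)
      have l: "(\<lambda>i. P (real i) \<omega>) \<longlonglongrightarrow> \<sigma> \<omega>" by (rule filterlim_compose[OF elim(2) filterlim_real_sequentially])
      have "\<sigma> \<omega> \<in> S"
        by (rule closed_sequentially[OF compact_imp_closed[OF S] _ l]) (use elim(1) in auto)
      then show ?case
        by (rule continuous_on_tendsto_compose[OF g(2) l]) (use elim(1) in auto)
    qed
  qed simp
qed

end

text \<open>The hypothesis fixes \<open>\<sigma> u\<close> only on paths that converge; almost sure
  convergence is part of the conclusion. The claim about values in \<open>{-1, 1}\<close> is
  confined to \<open>u \<noteq> 0\<close>, since with \<open>u = 0\<close> the solution stays at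
  0.\<close>

theorem theorem1p2:
  fixes M :: "'a measure" and F :: "real \<Rightarrow> 'a measure"
    and B :: "real \<Rightarrow> 'a \<Rightarrow> real ^ 'd"
    and W :: "real ^ 'd \<Rightarrow> real \<Rightarrow> 'a \<Rightarrow> real"
    and \<sigma> :: "real ^ 'd \<Rightarrow> 'a \<Rightarrow> real"
  assumes "brownian_motion M F B"
    and "\<And>u. sde_solution M F B {-1..1} \<xi> u 0 (W u)"
    and "\<And>u. \<sigma> u \<in> borel_measurable M"
    and "\<And>u. AE \<omega> in M. \<forall>l. ((\<lambda>t. W u t \<omega>) \<longlongrightarrow> l) at_top \<longrightarrow> \<sigma> u \<omega> = l"
  shows "(\<forall>u. u \<noteq> 0 \<longrightarrow>
           (AE \<omega> in M. ((\<lambda>t. W u t \<omega>) \<longlongrightarrow> \<sigma> u \<omega>) at_top \<and> \<sigma> u \<omega> \<in> {-1, 1})) \<and>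
         (\<forall>u v. u \<bullet> u = 1 \<longrightarrow> v \<bullet> v = 1 \<longrightarrow>
           (\<integral>\<omega>. \<sigma> u \<omega> * \<sigma> v \<omega> \<partial>M) = 2 / pi * arcsin (u \<bullet> v))"
proof (intro conjI allI impI)
  interpret brownian_motion M F B by fact
  note sol = assms(2) and [measurable] = assms(3)
  have \<xi>0: "\<xi> x \<noteq> 0" if "\<bar>x\<bar> < 1" for x using \<xi>_pos[OF that] by simp
  have conv: "AE \<omega> in M. ((\<lambda>t. W u t \<omega>) \<longlongrightarrow> \<sigma> u \<omega>) at_top \<and> \<sigma> u \<omega> \<in> {-1, 1}" if "u \<noteq> 0" for u
    by (rule sde_limit_absorbed[OF sol \<xi>_measurable \<xi>_continuous \<xi>0 that assms(3,4)])
  then show "AE \<omega> in M. ((\<lambda>t. W u t \<omega>) \<longlongrightarrow> \<sigma> u \<omega>) at_top \<and> \<sigma> u \<omega> \<in> {-1, 1}" if "u \<noteq> 0" for u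
    using that .
  fix u v :: "real ^ 'd" assume u: "u \<bullet> u = 1" and v: "v \<bullet> v = 1"
  define \<rho> where "\<rho> = u \<bullet> v"
  define c where "c = (\<integral>\<omega>. \<sigma> u \<omega> * \<sigma> v \<omega> \<partial>M)"
  have lim: "(\<lambda>i. \<integral>\<omega>. f (W a (real i) \<omega>) * f (W b (real i) \<omega>) \<partial>M) \<longlonglongrightarrow> (\<integral>\<omega>. f (\<sigma> a \<omega>) * f (\<sigma> b \<omega>) \<partial>M)"
    if a: "a \<bullet> a = 1" and b: "b \<bullet> b = 1" and f: "f \<in> borel_measurable borel" "continuous_on UNIV f" for a b and f :: "real \<Rightarrow> real"
  proof -
    have ab: "a \<noteq> 0" "b \<noteq> 0" using a b by auto
    have "(\<lambda>i. \<integral>\<omega>. (\<lambda>z. f (fst z) * f (snd z)) (W a (real i) \<omega>, W b (real i) \<omega>) \<partial>M)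
        \<longlonglongrightarrow> (\<integral>\<omega>. (\<lambda>z. f (fst z) * f (snd z)) (\<sigma> a \<omega>, \<sigma> b \<omega>) \<partial>M)"
    proof (rule limit_expectation[where g="\<lambda>z. f (fst z) * f (snd z)" and P="\<lambda>t \<omega>. (W a t \<omega>, W b t \<omega>)"
          and \<sigma>="\<lambda>\<omega>. (\<sigma> a \<omega>, \<sigma> b \<omega>)", OF sde_compact_process_pair[OF sol sol compact_Icc]])
      show "(\<lambda>z. f (fst z) * f (snd z)) \<in> borel_measurable borel"
        by (intro borel_measurable_times borel_measurable_fst_compose borel_measurable_snd_compose f)
      show "continuous_on ({-1..1} \<times> {-1..1}) (\<lambda>z. f (fst z) * f (snd z))"
        by (intro continuous_on_mult continuous_on_compose2[OF f(2)] continuous_intros) auto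
      show "(\<lambda>\<omega>. (\<sigma> a \<omega>, \<sigma> b \<omega>)) \<in> borel_measurable M" by measurable
      show "AE \<omega> in M. ((\<lambda>t. (W a t \<omega>, W b t \<omega>)) \<longlongrightarrow> (\<sigma> a \<omega>, \<sigma> b \<omega>)) at_top"
        using conv[OF ab(1)] conv[OF ab(2)] by eventually_elim (auto intro: tendsto_Pair)
    qed
    then show ?thesis by simp
  qed
  have corr: "(\<lambda>i. \<integral>\<omega>. W a (real i) \<omega> * W b (real i) \<omega> \<partial>M) \<longlonglongrightarrow> (\<integral>\<omega>. \<sigma> a \<omega> * \<sigma> b \<omega> \<partial>M)"
    if "a \<bullet> a = 1" "b \<bullet> b = 1" for a b
    using lim[OF that, of "\<lambda>x. x"] by simp
  have sq: "(\<integral>\<omega>. \<sigma> a \<omega> * \<sigma> a \<omega> \<partial>M) = 1" if "a \<bullet> a = 1" for a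
  proof -
    have "a \<noteq> 0" using that by auto
    from conv[OF this] have "AE \<omega> in M. \<sigma> a \<omega> * \<sigma> a \<omega> = 1" by eventually_elim auto
    then have "(\<integral>\<omega>. \<sigma> a \<omega> * \<sigma> a \<omega> \<partial>M) = (\<integral>\<omega>. 1 \<partial>M)" by (intro integral_cong_AE) measurable
    then show ?thesis by (simp add: prob_space)
  qed
  \<comment> \<open>All observables vanish at the absorbing points, so the correlations at time
    \<open>T\<close> drop out of the estimate in the limit.\<close>
  have herm: "(\<lambda>i. hermite_corr n (W a) (W b) (real i)) \<longlonglongrightarrow> 0"
    if "a \<bullet> a = 1" "b \<bullet> b = 1" for a b n
  proof -
    have "a \<noteq> 0" using that by auto
    from conv[OF this] have "AE \<omega> in M. hermite_obs n (\<sigma> a \<omega>) * hermite_obs n (\<sigma> b \<omega>) = 0"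
      by eventually_elim (auto simp: hermite_obs_def)
    then have "(\<integral>\<omega>. hermite_obs n (\<sigma> a \<omega>) * hermite_obs n (\<sigma> b \<omega>) \<partial>M) = (\<integral>\<omega>. 0 \<partial>M)"
      by (intro integral_cong_AE) measurable
    then show ?thesis using lim[OF that hermite_obs_measurable[of n] hermite_obs_continuous] by simp
  qed
  \<comment> \<open>The estimate along integer times: second moments tend to 1 since the limits are
    signs, and both diagonal remainders tend to the same 1 minus a partial sum.\<close>
  have est: "\<bar>c - (\<Sum>n<N. arcsin_coeff n * \<rho> ^ Suc n)\<bar> \<le> 1 - (\<Sum>n<N. arcsin_coeff n)" for N
  proof -
    let ?h = "\<lambda>a b n i. hermite_corr n (W a) (W b) (real i)"
    let ?b = "\<lambda>n. (gauss_deriv n 0)\<^sup>2"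
    have series: "(\<lambda>i. \<Sum>n<N. r ^ Suc n / fact (Suc n) * (?b n - ?h a b n i)) \<longlonglongrightarrow> (\<Sum>n<N. r ^ Suc n / fact (Suc n) * (?b n - 0))"
      if "a \<bullet> a = 1" "b \<bullet> b = 1" for a b r
      by (intro tendsto_sum tendsto_mult tendsto_diff tendsto_const herm that)
    have L: "(\<lambda>i. \<bar>(\<integral>\<omega>. W u (real i) \<omega> * W v (real i) \<omega> \<partial>M) - (\<Sum>n<N. \<rho> ^ Suc n / fact (Suc n) * (?b n - ?h u v n i))\<bar>)
        \<longlonglongrightarrow> \<bar>c - (\<Sum>n<N. \<rho> ^ Suc n / fact (Suc n) * (?b n - 0))\<bar>"
      unfolding c_def by (intro tendsto_rabs tendsto_diff corr series u v)
    have R: "(\<lambda>i. (((\<integral>\<omega>. W u (real i) \<omega> * W u (real i) \<omega> \<partial>M) - (\<Sum>n<N. 1 ^ Suc n / fact (Suc n) * (?b n - ?h u u n i)))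
        + ((\<integral>\<omega>. W v (real i) \<omega> * W v (real i) \<omega> \<partial>M) - (\<Sum>n<N. 1 ^ Suc n / fact (Suc n) * (?b n - ?h v v n i)))) / 2)
        \<longlonglongrightarrow> ((1 - (\<Sum>n<N. 1 ^ Suc n / fact (Suc n) * (?b n - 0))) + (1 - (\<Sum>n<N. 1 ^ Suc n / fact (Suc n) * (?b n - 0)))) / 2"
      using corr[OF u u] corr[OF v v] unfolding sq[OF u] sq[OF v]
      by (intro tendsto_divide tendsto_add tendsto_diff tendsto_const series u v) auto
    have "\<bar>c - (\<Sum>n<N. \<rho> ^ Suc n / fact (Suc n) * (?b n - 0))\<bar>
      \<le> ((1 - (\<Sum>n<N. 1 ^ Suc n / fact (Suc n) * (?b n - 0))) + (1 - (\<Sum>n<N. 1 ^ Suc n / fact (Suc n) * (?b n - 0)))) / 2"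
    proof (rule LIMSEQ_le[OF L R], intro exI[of _ 0] allI impI)
      fix i :: nat
      show "\<bar>(\<integral>\<omega>. W u (real i) \<omega> * W v (real i) \<omega> \<partial>M) - (\<Sum>n<N. \<rho> ^ Suc n / fact (Suc n) * (?b n - ?h u v n i))\<bar>
        \<le> (((\<integral>\<omega>. W u (real i) \<omega> * W u (real i) \<omega> \<partial>M) - (\<Sum>n<N. 1 ^ Suc n / fact (Suc n) * (?b n - ?h u u n i)))
        + ((\<integral>\<omega>. W v (real i) \<omega> * W v (real i) \<omega> \<partial>M) - (\<Sum>n<N. 1 ^ Suc n / fact (Suc n) * (?b n - ?h v v n i)))) / 2"
        using sticky_correlation_estimate[OF sol sol u v of_nat_0_le_iff, where N=N] unfolding \<rho>_def power_one .
    qed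
    then show ?thesis by (simp add: arcsin_coeff_def mult.commute)
  qed
  have \<rho>1: "\<bar>\<rho>\<bar> \<le> 1"
    using Cauchy_Schwarz_ineq2[of u v] u v by (simp add: \<rho>_def norm_eq_sqrt_inner)
  have "(\<lambda>N. \<bar>c - (\<Sum>n<N. arcsin_coeff n * \<rho> ^ Suc n)\<bar>) \<longlonglongrightarrow> \<bar>c - 2 / pi * arcsin \<rho>\<bar>"
    using arcsin_sums[OF \<rho>1] unfolding sums_def by (intro tendsto_rabs tendsto_diff tendsto_const)
  moreover have "(\<lambda>N. 1 - (\<Sum>n<N. arcsin_coeff n)) \<longlonglongrightarrow> 1 - 1"
    using arcsin_coeff_sums unfolding sums_def by (intro tendsto_diff tendsto_const)
  ultimately have "\<bar>c - 2 / pi * arcsin \<rho>\<bar> \<le> 1 - 1"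
    by (rule LIMSEQ_le) (use est in auto)
  then show "(\<integral>\<omega>. \<sigma> u \<omega> * \<sigma> v \<omega> \<partial>M) = 2 / pi * arcsin (u \<bullet> v)"
    by (simp add: c_def \<rho>_def)
qed

end
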